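(* Assume that $X$ is an Asplund space and let $f\colon T\times X\to\overline{\mathbb{R}}$ be a Lusin integrand with $f_t\in\Gamma_0(X)$ for all $t\in T$. Let $E_f(x):=\int_T f_t(x)\,d\mu$ for $x\in X$. Let $x_0\in X$ be such that $E_f(x_0)\in\mathbb{R}$ and suppose there exist $k\in L^1(T)$ and $\eta>0$ such that $f_t(x)\le k(t)$ for all $x\in\mathbb{B}_\eta(x_0)$ and all $t\in T$. Then for all $x\in\operatorname{dom}E_f$ and $\epsilon\ge0$, $$\partial_\epsilon E_f(x)=\bigcup_{\substack{\epsilon_1,\epsilon_2\ge0,\ \epsilon_1+\epsilon_2\le\epsilon\\ \ell\in\mathcal{Z}(\epsilon_1)}}\left(\int_T\partial_{\ell(t)}f_t(x)\,d\mu+N^{\epsilon_2}_{\operatorname{dom}E_f}(x)\right),$$ where, for a nonnegative $\ell\in L^1(T)$, $$\int_T\partial_{\ell(t)}f_t(x)\,d\mu:=\left\{\int_T\langle x^\ast(t),\cdot\,\rangle\,d\mu\in X^\ast:\ x^\ast\in L^1(T,X^\ast)\text{ and }x^\ast(t)\in\partial_{\ell(t)}f_t(x)\ \mu\text{-a.e.}\right\}.$$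
   Context: Standing assumptions: $X$ is a (not necessarily separable) Banach space with dual $X^\ast$, $(T,d)$ is a metric space, and $(T,\mathcal{A},\mu)$ is a complete $\sigma$-finite measure space with $\mathcal{A}$ containing the Borel $\sigma$-algebra of $T$; $\mu$ is inner regular, meaning that for all $\varepsilon>0$ and $B\in\mathcal{A}$ of finite measure there is a compact $K\subset B$ with $\mu(B\setminus K)<\varepsilon$. Notation: $\overline{\mathbb{R}}=[-\infty,\infty]$; $f_t(x):=f(t,x)$; $\operatorname{epi} f_t:=\{(x,\alpha)\in X\times\mathbb{R}: f_t(x)\le\alpha\}$; $\Gamma_0(X)$ is the set of proper convex lower semicontinuous functions on $X$; $\mathbb{B}_\eta(x_0)$ is the closed ball; $\operatorname{dom}E_f=\{x:E_f(x)<+\infty\}$; $\mathcal{Z}(\epsilon):=\{\ell\in L^1(T):\ell\ge0\ \mu\text{-a.e., }\int_T\ell\,d\mu\le\epsilon\}$. Integrals of extended-real-valued measurable functions are upper integrals: $\int_T g\,d\mu:=\int_T\max\{g,0\}\,d\mu+\int_T\min\{g,0\}\,d\mu$ with $+\infty+(-\infty)=+\infty$. For $g\colon X\to\overline{\mathbb{R}}$, $\epsilon\ge0$ and $x$ with $|g(x)|<\infty$: $\partial_\epsilon g(x):=\{x^\ast\in X^\ast:\langle x^\ast,y-x\rangle\le g(y)-g(x)+\epsilon\ \forall y\in X\}$, and $\partial_\epsilon g(x):=\emptyset$ if $|g(x)|=\infty$. $N_C^\epsilon(x):=\partial_\epsilon\delta_C(x)$ for $x\in C$, where $\delta_C$ is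 $0$ on $C$ and $+\infty$ elsewhere. $f$ is a Lusin integrand if for every $\varepsilon>0$ and $A\in\mathcal{A}$ of finite measure there is a compact $B\subset A$ with $\mu(A\setminus B)<\varepsilon$ such that $B\ni t\rightrightarrows\operatorname{epi} f_t$ is lower semicontinuous, i.e. for every $t\in B$ and open $V\subset X\times\mathbb{R}$ with $\operatorname{epi} f_t\cap V\ne\emptyset$ there is a neighbourhood $U$ of $t$ in $B$ with $\operatorname{epi} f_s\cap V\ne\emptyset$ for all $s\in U$. *)

theory Defs
  imports "HOL-Analysis.Analysis"
begin

text \<open>
  Asplund spaces, in the original sense: every continuous convex function on a nonempty open convex
  set is Frechet differentiable on a dense \<open>G\<^sub>\<delta>\<close> subset.  The derivative of
  \<^const>\<open>has_derivative\<close> is the Frechet derivative.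
\<close>

definition asplund_space :: "'a::banach itself \<Rightarrow> bool" where
  "asplund_space _ \<longleftrightarrow>
     (\<forall>(D :: 'a set) (g :: 'a \<Rightarrow> real).
        D \<noteq> {} \<and> open D \<and> convex D \<and> continuous_on D g \<and> convex_on D g \<longrightarrow>
        (\<exists>G. gdelta_in euclidean G \<and> G \<subseteq> D \<and> D \<subseteq> closure G \<and>
             (\<forall>x\<in>G. g differentiable (at x))))"

definition inner_regular :: "'t::metric_space measure \<Rightarrow> bool" where
  "inner_regular M \<longleftrightarrow>
     (\<forall>\<epsilon>>0. \<forall>B\<in>sets M. emeasure M B < \<infinity> \<longrightarrow>
        (\<exists>K. compact K \<and> K \<subseteq> B \<and> emeasure M (B - K) < ennreal \<epsilon>))"

definition epi :: "('a \<Rightarrow> ereal) \<Rightarrow> ('a \<times> real) set" where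
  "epi g = {(x, \<alpha>). g x \<le> ereal \<alpha>}"

definition edom :: "('a \<Rightarrow> ereal) \<Rightarrow> 'a set" where
  "edom g = {x. g x < \<infinity>}"

definition proper_fun :: "('a \<Rightarrow> ereal) \<Rightarrow> bool" where
  "proper_fun g \<longleftrightarrow> (\<forall>x. g x \<noteq> -\<infinity>) \<and> (\<exists>x. g x \<noteq> \<infinity>)"

definition lsc_fun :: "('a::topological_space \<Rightarrow> ereal) \<Rightarrow> bool" where
  "lsc_fun g \<longleftrightarrow> (\<forall>x. \<forall>a < g x. \<forall>\<^sub>F y in nhds x. a < g y)"

definition Gamma0 :: "('a::real_normed_vector \<Rightarrow> ereal) set" where
  "Gamma0 = {g. proper_fun g \<and> convex (epi g) \<and> lsc_fun g}"

definition lsc_multifun_on :: "'t::topological_space set \<Rightarrow> ('t \<Rightarrow> 'b::topological_space set) \<Rightarrow> bool" where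
  "lsc_multifun_on B F \<longleftrightarrow>
     (\<forall>t\<in>B. \<forall>V. open V \<and> F t \<inter> V \<noteq> {} \<longrightarrow>
        (\<exists>U. open U \<and> t \<in> U \<and> (\<forall>s\<in>U \<inter> B. F s \<inter> V \<noteq> {})))"

definition lusin_integrand ::
    "'t::metric_space measure \<Rightarrow> ('t \<Rightarrow> 'a::real_normed_vector \<Rightarrow> ereal) \<Rightarrow> bool" where
  "lusin_integrand M f \<longleftrightarrow>
     (\<forall>\<epsilon>>0. \<forall>A\<in>sets M. emeasure M A < \<infinity> \<longrightarrow>
        (\<exists>B. compact B \<and> B \<subseteq> A \<and> emeasure M (A - B) < ennreal \<epsilon> \<and>
             lsc_multifun_on B (\<lambda>t. epi (f t))))"

text \<open>
  The upper integral.  The map \<^const>\<open>e2ennreal\<close> truncates negative values to \<open>0\<close>, so the two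
  integrals are those of the positive and negative parts; on \<^typ>\<open>ereal\<close> one has
  \<open>\<infinity> - \<infinity> = \<infinity>\<close>, which is the required convention.
\<close>

definition upper_integral :: "'t measure \<Rightarrow> ('t \<Rightarrow> ereal) \<Rightarrow> ereal" where
  "upper_integral M g =
     enn2ereal (\<integral>\<^sup>+ t. e2ennreal (g t) \<partial>M) - enn2ereal (\<integral>\<^sup>+ t. e2ennreal (- g t) \<partial>M)"

definition integral_functional :: "'t measure \<Rightarrow> ('t \<Rightarrow> 'a \<Rightarrow> ereal) \<Rightarrow> 'a \<Rightarrow> ereal" where
  "integral_functional M f x = upper_integral M (\<lambda>t. f t x)"

definition eps_subdiff ::
    "real \<Rightarrow> ('a::real_normed_vector \<Rightarrow> ereal) \<Rightarrow> 'a \<Rightarrow> ('a \<Rightarrow>\<^sub>L real) set" where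
  "eps_subdiff \<epsilon> g x =
     (if \<bar>g x\<bar> < \<infinity>
      then {u. \<forall>y. ereal (blinfun_apply u (y - x)) \<le> g y - g x + ereal \<epsilon>}
      else {})"

definition indicator_fun :: "'a set \<Rightarrow> 'a \<Rightarrow> ereal" where
  "indicator_fun C x = (if x \<in> C then 0 else \<infinity>)"

definition eps_normal :: "real \<Rightarrow> 'a::real_normed_vector set \<Rightarrow> 'a \<Rightarrow> ('a \<Rightarrow>\<^sub>L real) set" where
  "eps_normal \<epsilon> C x = eps_subdiff \<epsilon> (indicator_fun C) x"

definition Zset :: "'t measure \<Rightarrow> real \<Rightarrow> ('t \<Rightarrow> real) set" where
  "Zset M \<epsilon> = {l. integrable M l \<and> (AE t in M. 0 \<le> l t) \<and> (\<integral>t. l t \<partial>M) \<le> \<epsilon>}"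

text \<open>
  Bochner integrability in a possibly nonseparable space; \<^const>\<open>integrable\<close> is restricted to
  second countable spaces.  A function is strongly measurable if it is almost everywhere the norm
  limit of a sequence of simple functions.
\<close>

definition strongly_measurable :: "'t measure \<Rightarrow> ('t \<Rightarrow> 'b::real_normed_vector) \<Rightarrow> bool" where
  "strongly_measurable M h \<longleftrightarrow>
     (\<exists>s. (\<forall>n. simple_function M (s n)) \<and> (AE t in M. (\<lambda>n. s n t) \<longlonglongrightarrow> h t))"

definition L1_Bochner :: "'t measure \<Rightarrow> ('t \<Rightarrow> 'b::real_normed_vector) set" where
  "L1_Bochner M = {h. strongly_measurable M h \<and> integrable M (\<lambda>t. norm (h t))}"

definition integral_eps_subdiff ::
    "'t measure \<Rightarrow> ('t \<Rightarrow> real) \<Rightarrow> ('t \<Rightarrow> 'a::real_normed_vector \<Rightarrow> ereal) \<Rightarrow> 'a \<Rightarrow> ('a \<Rightarrow>\<^sub>L real) set" where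
  "integral_eps_subdiff M l f x =
     {u. \<exists>h\<in>L1_Bochner M. (AE t in M. h t \<in> eps_subdiff (l t) (f t) x) \<and>
           (\<forall>v. blinfun_apply u v = (\<integral>t. blinfun_apply (h t) v \<partial>M))}"

end

theory Submission
  imports Defs "HOL-Probability.Discrete_Topology"
begin

text \<open>
  Write \<open>E\<close> for the integral functional.  That every element of the right-hand side is an
  \<open>\<epsilon>\<close>-subgradient follows by integrating the pointwise subgradient inequalities.  For the converse
  let \<open>u\<close> be an \<open>\<epsilon>\<close>-subgradient of \<open>E\<close> at \<open>x\<close>.

  \<^bold>\<open>From constants to bounded functions.\<close>  \<open>E\<close> is the restriction to the constants of the functional
  \<open>w \<mapsto> \<integral> f\<^sub>t (w t)\<close> on all bounded functions \<open>w : T \<rightarrow> X\<close>.  Taking the infimum of the integrals of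
  integrable majorants as its value, one needs no measurability of \<open>w\<close>, and the functional is convex.
  It is bounded above near the constant \<open>x0\<close> by \<open>\<integral> k\<close>, so the Hahn-Banach theorem extends \<open>u\<close> to
  a linear \<open>L\<close> on the bounded functions that is still dominated
  (\<open>exists_dominated_extension\<close>).

  \<^bold>\<open>The absolutely continuous part.\<close>  The total variation of the vector charge \<open>A \<mapsto> L (1\<^sub>A \<cdot>)\<close> is a
  bounded finitely additive charge.  As in the Yosida-Hewitt decomposition, it is countably additive
  on each member of a sequence \<open>G\<^sub>1 \<subseteq> G\<^sub>2 \<subseteq> \<dots>\<close> that exhausts \<open>T\<close> up to a null set, with an integrable
  density \<open>g\<close> there (\<open>Yosida_Hewitt_density\<close>).  Since \<open>X\<close> is Asplund, \<open>X\<^sup>*\<close> has the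
  Radon-Nikodym property, hence \<open>L (1\<^sub>A y) = \<integral>\<^sub>A \<langle>H t, y\<rangle>\<close> for \<open>A \<subseteq> G\<^sub>n\<close> with a Bochner integrable
  \<open>H\<close> (\<open>Radon_Nikodym_asplund\<close>, \<open>absolutely_continuous_part\<close>).  The property is
  proved directly: the support function of an average range is Frechet differentiable
  somewhere, and there it cuts off slices of small diameter.

  \<^bold>\<open>Splitting the inequality.\<close>  Apply \<open>L\<close> to functions that select a point near
  \<open>y\<^sub>i - x\<close> on pieces of \<open>G\<^sub>n\<close> and equal \<open>z - x\<close> off \<open>G\<^sub>n\<close>, where \<open>z\<close> is in the domain of \<open>E\<close>.
  Letting \<open>n \<rightarrow> \<infinity>\<close> separates the two contributions: for \<open>v = u - \<integral> H\<close>,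
  \<open>\<integral> (\<langle>H t, y\<^sub>i - x\<rangle> - f\<^sub>t y\<^sub>i + f\<^sub>t x) + \<langle>v, z - x\<rangle> \<le> \<epsilon>\<close>, up to an error that is controlled by the distance
  of the selected points from \<open>y\<^sub>i\<close> (\<open>selection_inequality\<close>).  Now let \<open>l t\<close> be the supremum
  of \<open>\<langle>H t, y - x\<rangle> - f\<^sub>t y + f\<^sub>t x\<close> over all \<open>y\<close>.  Then \<open>H t\<close> is an \<open>l t\<close>-subgradient, and
  \<open>\<integral> l + \<langle>v, z - x\<rangle> \<le> \<epsilon>\<close> for all \<open>z\<close> says that \<open>v\<close> is an \<open>(\<epsilon> - \<integral> l)\<close>-normal.

  \<^bold>\<open>Nonseparability.\<close>  The space \<open>X\<close> may be nonseparable, so the supremum over \<open>y\<close> need not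
  be a countable one.  Here the Lusin property enters: on a compact \<open>B \<subseteq> T\<close> on which the epigraphs are
  lower semicontinuous, the sets where the infimum of \<open>f\<^sub>t\<close> over a given ball is below a given level
  are relatively open.  Subsets of \<open>B\<close> are Lindelof and the values of \<open>H\<close> lie in a separable
  set, hence countably many balls suffice almost everywhere (\<open>countable_sampling\<close>).
\<close>

section \<open>Hahn-Banach theorems\<close>

definition sublinear :: "('v::real_vector \<Rightarrow> real) \<Rightarrow> bool" where
  "sublinear p \<longleftrightarrow> (\<forall>v w. p (v + w) \<le> p v + p w) \<and> (\<forall>c v. 0 \<le> c \<longrightarrow> p (c *\<^sub>R v) = c * p v)"

lemma sublinear_add: "sublinear p \<Longrightarrow> p (v + w) \<le> p v + p w"
  and sublinear_scale: "sublinear p \<Longrightarrow> 0 \<le> c \<Longrightarrow> p (c *\<^sub>R v) = c * p v"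
  by (auto simp: sublinear_def)

lemma sublinear_zero: "sublinear p \<Longrightarrow> p 0 = 0"
  using sublinear_scale[of p 0 0] by simp

lemma sublinearI:
  assumes add: "\<And>v w. p (v + w) \<le> p v + p w" and scale_le: "\<And>c v. 0 < c \<Longrightarrow> p (c *\<^sub>R v) \<le> c * p v"
    and zero: "p 0 = 0"
  shows "sublinear p"
proof -
  have "p (c *\<^sub>R v) = c * p v" if "0 \<le> c" for c v
  proof (cases "c = 0")
    case False
    then have "0 < c" using that by simp
    from scale_le[of "inverse c" "c *\<^sub>R v"] this have "p v * c \<le> p (c *\<^sub>R v)"
      by (simp add: field_simps)
    with scale_le[OF \<open>0 < c\<close>, of v] show ?thesis by (simp add: mult.commute)
  qed (simp add: zero)
  then show ?thesis using add by (simp add: sublinear_def)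
qed

lemma sublinear_minus: assumes "sublinear p" shows "- p (- v) \<le> p v"
  using sublinear_add[OF assms, of v "-v"] sublinear_zero[OF assms] by simp

text \<open>
  A chain of sublinear functions below \<open>q\<close> is pointwise bounded below by \<open>- q (- v)\<close>, so its
  infimum is finite; subadditivity survives because two members of the chain can be replaced by the
  smaller one.  This is the hypothesis of Zorn's lemma for the existence of minimal sublinear functions.
\<close>

lemma sublinear_chain_Inf:
  fixes C :: "('v::real_vector \<Rightarrow> real) set"
  assumes ne: "C \<noteq> {}" and sub: "\<And>p. p \<in> C \<Longrightarrow> sublinear p" and dom: "\<And>p v. p \<in> C \<Longrightarrow> p v \<le> q v"
    and chain: "\<And>p p'. p \<in> C \<Longrightarrow> p' \<in> C \<Longrightarrow> (\<forall>v. p v \<le> p' v) \<or> (\<forall>v. p' v \<le> p v)"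
  shows "sublinear (\<lambda>v. INF p\<in>C. p v) \<and> (\<forall>p\<in>C. \<forall>v. (INF p\<in>C. p v) \<le> p v)"
proof -
  define u where "u v = (INF p\<in>C. p v)" for v
  have bdd: "bdd_below ((\<lambda>p. p v) ` C)" for v
  proof (rule bdd_belowI2)
    fix p assume "p \<in> C"
    show "- q (- v) \<le> p v"
      using sublinear_minus[OF sub[OF \<open>p \<in> C\<close>], of v] dom[OF \<open>p \<in> C\<close>, of "-v"] by linarith
  qed
  have le: "u v \<le> p v" if "p \<in> C" for p v
    unfolding u_def using bdd that by (rule cINF_lower)
  have add: "u (v + w) \<le> u v + u w" for v w
  proof -
    have *: "u (v + w) \<le> p v + p' w" if "p \<in> C" "p' \<in> C" for p p'
    proof -
      obtain p'' where "p'' \<in> C" "p'' v \<le> p v" "p'' w \<le> p' w"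
        using chain[OF \<open>p \<in> C\<close> \<open>p' \<in> C\<close>] \<open>p \<in> C\<close> \<open>p' \<in> C\<close> by blast
      then show ?thesis
        using le[of p'' "v+w"] sublinear_add[OF sub, of p'' v w] by linarith
    qed
    have "u (v + w) - p' w \<le> u v" if "p' \<in> C" for p'
      unfolding u_def[of v] using *[OF _ that] by (intro cINF_greatest[OF ne]) (simp add: le_diff_eq diff_le_eq)
    then have "u (v + w) - u v \<le> u w"
      unfolding u_def[of w] by (intro cINF_greatest[OF ne]) (simp add: algebra_simps)
    then show ?thesis by simp
  qed
  have scale_le: "u (c *\<^sub>R v) \<le> c * u v" if "0 < c" for c v
  proof -
    have "u (c *\<^sub>R v) / c \<le> u v"
      unfolding u_def[of v]
    proof (rule cINF_greatest[OF ne])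
      fix p assume "p \<in> C"
      then show "u (c *\<^sub>R v) / c \<le> p v"
        using le[of p "c *\<^sub>R v"] sublinear_scale[OF sub, of p c v] that by (simp add: field_simps)
    qed
    then show ?thesis using that by (simp add: field_simps)
  qed
  have "u 0 = (INF p\<in>C. 0)"
    unfolding u_def using sublinear_zero[OF sub] by (intro INF_cong) auto
  then have "u 0 = 0" using ne by simp
  with add scale_le have "sublinear u" by (rule sublinearI)
  then show ?thesis using le unfolding u_def by blast
qed

text \<open>
  Minimal sublinear functions are linear.  For fixed \<open>v\<close> the function
  \<open>w \<mapsto> INF s\<ge>0. p (w + s v) - s p v\<close> is again sublinear and below \<open>p\<close>, hence equal to \<open>p\<close> by minimality;
  the term for \<open>s = 1\<close> gives \<open>p w \<le> p (w + v) - p v\<close>, the converse of subadditivity.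
\<close>

lemma minimal_sublinear_additive:
  fixes p :: "'v::real_vector \<Rightarrow> real"
  assumes p: "sublinear p" and min: "\<And>p'. sublinear p' \<Longrightarrow> (\<And>v. p' v \<le> p v) \<Longrightarrow> p' = p"
  shows "p (v + w) = p v + p w"
proof -
  define r where "r x = (INF s\<in>{0..}. p (x + s *\<^sub>R v) - s * p v)" for x
  have lower: "- p (- x) \<le> p (x + s *\<^sub>R v) - s * p v" if "0 \<le> s" for s x
    using sublinear_add[OF p, of "x + s *\<^sub>R v" "- x"] sublinear_scale[OF p that, of v] by simp
  have bdd: "bdd_below ((\<lambda>s. p (x + s *\<^sub>R v) - s * p v) ` {0..})" for x
    by (rule bdd_belowI2[of _ "- p (- x)"]) (use lower in auto)
  have le: "r x \<le> p (x + s *\<^sub>R v) - s * p v" if "0 \<le> s" for x s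
    unfolding r_def using bdd that by (intro cINF_lower) auto
  have add: "r (x + y) \<le> r x + r y" for x y
  proof -
    have *: "r (x + y) \<le> (p (x + s *\<^sub>R v) - s * p v) + (p (y + t *\<^sub>R v) - t * p v)" if "0 \<le> s" "0 \<le> t" for s t
    proof -
      have "p (x + y + (s + t) *\<^sub>R v) \<le> p (x + s *\<^sub>R v) + p (y + t *\<^sub>R v)"
        using sublinear_add[OF p, of "x + s *\<^sub>R v" "y + t *\<^sub>R v"] by (simp add: algebra_simps)
      then show ?thesis using le[of "s + t" "x + y"] that by (simp add: algebra_simps)
    qed
    have "r (x + y) - (p (y + t *\<^sub>R v) - t * p v) \<le> r x" if "0 \<le> t" for t
      unfolding r_def[of x] using *[OF _ that] by (intro cINF_greatest) (auto simp: algebra_simps)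
    then have "r (x + y) - r x \<le> r y"
      unfolding r_def[of y] by (intro cINF_greatest) (auto simp: algebra_simps)
    then show ?thesis by simp
  qed
  have scale_le: "r (c *\<^sub>R x) \<le> c * r x" if "0 < c" for c x
  proof -
    have "r (c *\<^sub>R x) / c \<le> r x"
      unfolding r_def[of x]
    proof (rule cINF_greatest)
      fix s :: real assume "s \<in> {0..}"
      then have "r (c *\<^sub>R x) \<le> p (c *\<^sub>R (x + s *\<^sub>R v)) - (c * s) * p v"
        using le[of "c * s" "c *\<^sub>R x"] that by (simp add: algebra_simps)
      also have "\<dots> = c * (p (x + s *\<^sub>R v) - s * p v)"
        using sublinear_scale[OF p, of c "x + s *\<^sub>R v"] that by (simp add: right_diff_distrib del: scaleR_add_right)
      finally show "r (c *\<^sub>R x) / c \<le> p (x + s *\<^sub>R v) - s * p v"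
        using that by (simp add: field_simps)
    qed simp
    then show ?thesis using that by (simp add: field_simps)
  qed
  have r0: "r 0 = 0"
  proof -
    have "r 0 = (INF s\<in>{0::real..}. 0::real)"
      unfolding r_def using sublinear_scale[OF p, of _ v] by (intro INF_cong) auto
    then show ?thesis by simp
  qed
  have "sublinear r" by (rule sublinearI[OF add scale_le r0])
  moreover have "r x \<le> p x" for x using le[of 0 x] by simp
  ultimately have "r = p" by (rule min)
  then have "p w \<le> p (w + v) - p v" using le[of 1 w] by simp
  with sublinear_add[OF p, of v w] show ?thesis by (simp add: add.commute)
qed

theorem Hahn_Banach_sublinear:
  fixes q :: "'v::real_vector \<Rightarrow> real"
  assumes q: "sublinear q"
  shows "\<exists>L. linear L \<and> (\<forall>v. L v \<le> q v)"
proof -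
  define A where "A = {p. sublinear p \<and> (\<forall>v. p v \<le> q v)}"
  define P where "P p p' \<longleftrightarrow> (\<forall>v. p' v \<le> p v)" for p p' :: "'v \<Rightarrow> real"
  have "\<exists>m\<in>A. \<forall>a\<in>A. P m a \<longrightarrow> a = m"
  proof (rule predicate_Zorn)
    show "partial_order_on A (relation_of P A)"
      unfolding P_def by (rule partial_order_on_relation_ofI) (blast intro: order.trans, blast intro: order.trans, simp add: fun_eq_iff order.eq_iff)
    fix C assume C: "C \<in> Chains (relation_of P A)"
    have CA: "C \<subseteq> A" using C by (auto simp: Chains_def relation_of_def)
    show "\<exists>u\<in>A. \<forall>a\<in>C. P a u"
    proof (cases "C = {}")
      case True then show ?thesis using q by (auto simp: A_def)
    next
      case False
      define u where "u = (\<lambda>v. INF p\<in>C. p v)"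
      have u: "sublinear u \<and> (\<forall>p\<in>C. \<forall>v. u v \<le> p v)"
        unfolding u_def using C CA False by (intro sublinear_chain_Inf[where q = q]) (auto simp: A_def Chains_def relation_of_def P_def)
      obtain p where "p \<in> C" using False by blast
      have "u v \<le> q v" for v
      proof -
        have "u v \<le> p v" using u \<open>p \<in> C\<close> by blast
        also have "p v \<le> q v" using CA \<open>p \<in> C\<close> by (auto simp: A_def)
        finally show ?thesis .
      qed
      with u have "u \<in> A" by (simp add: A_def)
      with u show ?thesis unfolding P_def by blast
    qed
  qed
  then obtain p where p: "sublinear p" "\<And>v. p v \<le> q v"
    and min: "\<And>p'. sublinear p' \<Longrightarrow> (\<And>v. p' v \<le> p v) \<Longrightarrow> p' = p"
  proof -
    from \<open>\<exists>m\<in>A. \<forall>a\<in>A. P m a \<longrightarrow> a = m\<close> obtain m where m: "m \<in> A" "\<forall>a\<in>A. P m a \<longrightarrow> a = m" by blast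
    show ?thesis
    proof (rule that[of m])
      show "sublinear m" "m v \<le> q v" for v using m by (auto simp: A_def)
      fix p' assume p': "sublinear p'" "\<And>v. p' v \<le> m v"
      have "p' v \<le> q v" for v using p'(2)[of v] m(1) by (auto simp: A_def intro: order.trans)
      then show "p' = m" using m p' by (auto simp: A_def P_def)
    qed
  qed
  have add: "p (v + w) = p v + p w" for v w
    by (rule minimal_sublinear_additive[OF p(1) min])
  have neg: "p (- v) = - p v" for v
    using add[of v "-v"] sublinear_zero[OF p(1)] by simp
  have "p (c *\<^sub>R v) = c * p v" for c v
  proof (cases "0 \<le> c")
    case True then show ?thesis by (rule sublinear_scale[OF p(1)])
  next
    case False
    then have "p ((- c) *\<^sub>R v) = (- c) * p v" by (intro sublinear_scale[OF p(1)]) simp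
    then show ?thesis using neg[of "c *\<^sub>R v"] by simp
  qed
  then have "linear p" by (intro linearI) (auto simp: add)
  then show ?thesis using p(2) by blast
qed

text \<open>
  A linear \<open>u\<close> on a subspace (the range of \<open>\<iota>\<close>) that lies below a convex function extends to a linear
  function below it.  The convex function is given by its epigraph \<open>C\<close> and may take the value \<open>\<infinity>\<close>, but it
  is finite in every direction from a point \<open>\<iota> c0\<close> of the subspace.  The difference quotients
  \<open>(a - u c) / s\<close> with \<open>(\<iota> c + s w, a) \<in> C\<close> have an infimum \<open>q w\<close> that is finite by this core condition, is
  sublinear by convexity, and is at most \<open>u\<close> on the subspace; a linear function below \<open>q\<close> is the extension.
\<close>

theorem Hahn_Banach_sandwich:
  fixes C :: "('v::real_vector \<times> real) set" and \<iota> :: "'x::real_vector \<Rightarrow> 'v" and u :: "'x \<Rightarrow> real"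
  assumes C: "convex C" and \<iota>: "linear \<iota>" and u: "linear u"
    and above: "\<And>c a. (\<iota> c, a) \<in> C \<Longrightarrow> u c \<le> a"
    and core: "\<And>w. \<exists>s>0. \<exists>a. (\<iota> c0 + s *\<^sub>R w, a) \<in> C"
  shows "\<exists>L. linear L \<and> (\<forall>c. L (\<iota> c) = u c) \<and> (\<forall>w a. (w, a) \<in> C \<longrightarrow> L w \<le> a)"
proof -
  define Q where "Q w = {(a - u c) / s | a c s. s > 0 \<and> (\<iota> c + s *\<^sub>R w, a) \<in> C}" for w
  define q where "q w = Inf (Q w)" for w
  have ne: "Q w \<noteq> {}" for w using core[of w] by (auto simp: Q_def)
  have comb: "\<exists>z\<in>Q (w + w'). z = y + y'" if y: "y \<in> Q w" and y': "y' \<in> Q w'" for w w' y y'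
  proof -
    obtain a c s where 1: "y = (a - u c) / s" "s > 0" "(\<iota> c + s *\<^sub>R w, a) \<in> C" using y by (auto simp: Q_def)
    obtain a' c' s' where 2: "y' = (a' - u c') / s'" "s' > 0" "(\<iota> c' + s' *\<^sub>R w', a') \<in> C" using y' by (auto simp: Q_def)
    \<comment> \<open>The weights are chosen such that both directions get the same factor \<open>r\<close>.\<close>
    define \<theta> where "\<theta> = s' / (s + s')"
    define \<theta>' where "\<theta>' = s / (s + s')"
    define r where "r = s * s' / (s + s')"
    have th: "\<theta> \<ge> 0" "\<theta>' \<ge> 0" "\<theta> + \<theta>' = 1" "\<theta> * s = r" "\<theta>' * s' = r" "r > 0"
      using 1(2) 2(2) by (auto simp: \<theta>_def \<theta>'_def r_def add_divide_distrib[symmetric] add.commute)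
    have "\<theta> *\<^sub>R (\<iota> c + s *\<^sub>R w, a) + \<theta>' *\<^sub>R (\<iota> c' + s' *\<^sub>R w', a') \<in> C"
      using convexD[OF C 1(3) 2(3) th(1-3)] .
    also have "\<theta> *\<^sub>R (\<iota> c + s *\<^sub>R w, a) + \<theta>' *\<^sub>R (\<iota> c' + s' *\<^sub>R w', a')
      = (\<iota> (\<theta> *\<^sub>R c + \<theta>' *\<^sub>R c') + r *\<^sub>R (w + w'), \<theta> * a + \<theta>' * a')"
      by (simp add: linear_add[OF \<iota>] linear_scale[OF \<iota>] scaleR_add_right th)
    finally have "(\<theta> * a + \<theta>' * a' - u (\<theta> *\<^sub>R c + \<theta>' *\<^sub>R c')) / r \<in> Q (w + w')"
      unfolding Q_def using th(6) by blast
    moreover have "(\<theta> * a + \<theta>' * a' - u (\<theta> *\<^sub>R c + \<theta>' *\<^sub>R c')) / r = y + y'"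
    proof -
      have "\<theta> * a + \<theta>' * a' - u (\<theta> *\<^sub>R c + \<theta>' *\<^sub>R c') = \<theta> * (a - u c) + \<theta>' * (a' - u c')"
        by (simp add: linear_add[OF u] linear_scale[OF u] algebra_simps)
      moreover have "\<theta> / r = 1 / s" "\<theta>' / r = 1 / s'"
        using 1(2) 2(2) th(4-6) by (auto simp: field_simps)
      then have "\<theta> * (a - u c) / r = y" "\<theta>' * (a' - u c') / r = y'"
        using 1(1) 2(1) by (metis mult.commute mult_1 times_divide_eq_right times_divide_eq_left)+
      ultimately show ?thesis by (simp add: add_divide_distrib)
    qed
    ultimately show ?thesis by blast
  qed
  have Q0: "0 \<le> y" if "y \<in> Q 0" for y
    using that above by (auto simp: Q_def)
  have bdd: "bdd_below (Q w)" for w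
  proof -
    obtain y' where y': "y' \<in> Q (- w)" using ne by blast
    have "- y' \<le> y" if "y \<in> Q w" for y
      using comb[OF that y'] Q0 by force
    then show ?thesis by (auto simp: bdd_below_def)
  qed
  have q_le: "q w \<le> y" if "y \<in> Q w" for w y
    unfolding q_def using that bdd by (rule cInf_lower)
  have add: "q (w + w') \<le> q w + q w'" for w w'
  proof -
    have *: "q (w + w') \<le> y + y'" if "y \<in> Q w" "y' \<in> Q w'" for y y'
      using comb[OF that] q_le by blast
    have "q (w + w') - y' \<le> q w" if "y' \<in> Q w'" for y'
      unfolding q_def[of w] using *[OF _ that] by (intro cInf_greatest[OF ne]) (simp add: algebra_simps)
    then have "q (w + w') - q w \<le> q w'"
      unfolding q_def[of w'] by (intro cInf_greatest[OF ne]) (simp add: algebra_simps)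
    then show ?thesis by simp
  qed
  have Q_scale: "k * y \<in> Q (k *\<^sub>R w)" if k: "k > 0" and yQ: "y \<in> Q w" for k y w
  proof -
    obtain a c s where 1: "y = (a - u c) / s" "s > 0" "(\<iota> c + s *\<^sub>R w, a) \<in> C" using yQ by (auto simp: Q_def)
    have "k * y = (a - u c) / (s / k)" "s / k > 0" "(\<iota> c + (s / k) *\<^sub>R (k *\<^sub>R w), a) \<in> C"
      using 1 k by auto
    then show ?thesis unfolding Q_def by blast
  qed
  have scale_le: "q (k *\<^sub>R w) \<le> k * q w" if "k > 0" for k w
  proof -
    have "q (k *\<^sub>R w) / k \<le> q w"
      unfolding q_def[of w] using Q_scale[OF that] q_le that
      by (intro cInf_greatest[OF ne]) (simp add: divide_le_eq mult.commute)
    then show ?thesis using that by (simp add: field_simps)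
  qed
  have q_const: "q (\<iota> c) \<le> u c" for c
  proof -
    obtain a where a: "(\<iota> c0, a) \<in> C" using core[of 0] by auto
    \<comment> \<open>Starting from \<open>c0 - s c\<close>, a step of length \<open>s\<close> in direction \<open>c\<close> always ends at the point \<open>c0\<close> of
      finite value; \<open>s \<rightarrow> \<infinity>\<close> removes the contribution of that value.\<close>
    have *: "q (\<iota> c) - u c \<le> (a - u c0) / s" if "s > 0" for s
    proof -
      have "\<iota> (c0 - s *\<^sub>R c) + s *\<^sub>R \<iota> c = \<iota> c0"
        by (simp add: linear_diff[OF \<iota>] linear_scale[OF \<iota>])
      then have "(a - u (c0 - s *\<^sub>R c)) / s \<in> Q (\<iota> c)"
        unfolding Q_def using a that by (intro CollectI exI[of _ a] exI[of _ "c0 - s *\<^sub>R c"] exI[of _ s]) simp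
      from q_le[OF this] show ?thesis
        using that by (simp add: linear_diff[OF u] linear_scale[OF u] field_simps)
    qed
    have "((\<lambda>s. (a - u c0) / s) \<longlongrightarrow> 0) at_top"
      by (intro tendsto_divide_0[OF tendsto_const] filterlim_at_top_imp_at_infinity filterlim_ident)
    then have "q (\<iota> c) - u c \<le> 0"
      by (rule tendsto_lowerbound) (auto intro!: eventually_mono[OF eventually_gt_at_top[of 0]] *)
    then show ?thesis by simp
  qed
  have q0: "q 0 = 0"
  proof (rule antisym)
    show "q 0 \<le> 0" using q_const[of 0] linear_0[OF \<iota>] linear_0[OF u] by simp
    show "0 \<le> q 0" unfolding q_def using Q0 by (intro cInf_greatest[OF ne])
  qed
  have "sublinear q" by (rule sublinearI[OF add scale_le q0])
  then obtain L where L: "linear L" "\<And>v. L v \<le> q v" using Hahn_Banach_sublinear by blast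
  have "L (\<iota> c) = u c" for c
    using L(2)[of "\<iota> c"] L(2)[of "\<iota> (- c)"] q_const[of c] q_const[of "-c"]
    by (simp add: linear_neg[OF L(1)] linear_neg[OF \<iota>] linear_neg[OF u])
  moreover have "L w \<le> a" if "(w, a) \<in> C" for w a
  proof -
    have "(a - u 0) / 1 \<in> Q w" unfolding Q_def using that linear_0[OF \<iota>]
      by (intro CollectI exI[of _ a] exI[of _ 0] exI[of _ 1]) simp
    from q_le[OF this] show ?thesis using L(2)[of w] linear_0[OF u] by simp
  qed
  ultimately show ?thesis using L(1) by blast
qed

text \<open>
  The sandwich theorem for the space of all bounded functions, with the constants as
  subspace.  The bounded functions form a vector space type as the bounded continuous functions
  on the discrete space over the index type.
\<close>

lemma Hahn_Banach_sandwich_bounded_functions: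
  fixes C :: "(('t \<Rightarrow> 'a::real_normed_vector) \<times> real) set" and u :: "'a \<Rightarrow> real"
  assumes C: "\<And>w w' a a' s s'. (w, a) \<in> C \<Longrightarrow> (w', a') \<in> C \<Longrightarrow> 0 \<le> s \<Longrightarrow> 0 \<le> s' \<Longrightarrow> s + s' = 1 \<Longrightarrow>
      (\<lambda>t. s *\<^sub>R w t + s' *\<^sub>R w' t, s * a + s' * a') \<in> C"
    and u: "linear u"
    and above: "\<And>c a. (\<lambda>t. c, a) \<in> C \<Longrightarrow> u c \<le> a"
    and core: "\<And>w. bounded (range w) \<Longrightarrow> \<exists>s>0. \<exists>a. (\<lambda>t. c0 + s *\<^sub>R w t, a) \<in> C"
  shows "\<exists>L. (\<forall>w w'. bounded (range w) \<longrightarrow> bounded (range w') \<longrightarrow> L (\<lambda>t. w t + w' t) = L w + L w') \<and>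
    (\<forall>s w. bounded (range w) \<longrightarrow> L (\<lambda>t. s *\<^sub>R w t) = s * L w) \<and>
    (\<forall>c. L (\<lambda>t. c) = u c) \<and>
    (\<forall>w a. bounded (range w) \<longrightarrow> (w, a) \<in> C \<longrightarrow> L w \<le> a)"
proof -
  define emb :: "('t \<Rightarrow> 'a) \<Rightarrow> ('t discrete \<Rightarrow>\<^sub>C 'a)" where "emb w = Bcontfun (\<lambda>d. w (of_discrete d))" for w
  define fn :: "('t discrete \<Rightarrow>\<^sub>C 'a) \<Rightarrow> ('t \<Rightarrow> 'a)" where "fn F t = apply_bcontfun F (discrete t)" for F t
  have cont: "continuous_on UNIV (h :: 't discrete \<Rightarrow> 'a)" for h
    by (simp add: continuous_on_open_vimage open_discrete)
  have app: "apply_bcontfun (emb w) d = w (of_discrete d)" if "bounded (range w)" for w d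
  proof -
    have "range (\<lambda>d. w (of_discrete d)) \<subseteq> range w" by auto
    then have "(\<lambda>d. w (of_discrete d)) \<in> bcontfun"
      using cont bounded_subset[OF that] by (simp add: bcontfun_def)
    then show ?thesis unfolding emb_def by (simp add: Bcontfun_inverse)
  qed
  have fn_emb: "fn (emb w) = w" if "bounded (range w)" for w
    using app[OF that] by (auto simp: fn_def discrete_inverse)
  have bdd_fn: "bounded (range (fn F))" for F
  proof (rule bounded_subset)
    show "bounded (range (apply_bcontfun F))" by (rule bounded_apply_bcontfun)
  qed (auto simp: fn_def)
  define C' where "C' = {(F, a). (fn F, a) \<in> C}"
  define \<iota> :: "'a \<Rightarrow> ('t discrete \<Rightarrow>\<^sub>C 'a)" where "\<iota> c = const_bcontfun c" for c
  have fn_\<iota>: "fn (\<iota> c) = (\<lambda>t. c)" for c by (simp add: fn_def \<iota>_def fun_eq_iff)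
  have fn_lin: "fn (F + G) = (\<lambda>t. fn F t + fn G t)" "fn (s *\<^sub>R F) = (\<lambda>t. s *\<^sub>R fn F t)" for F G s
    by (auto simp: fn_def fun_eq_iff)
  have "\<exists>L. linear L \<and> (\<forall>c. L (\<iota> c) = u c) \<and> (\<forall>w a. (w, a) \<in> C' \<longrightarrow> L w \<le> a)"
  proof (rule Hahn_Banach_sandwich)
    show "convex C'"
      unfolding convex_def C'_def by (auto simp: fn_lin C)
    show "linear \<iota>"
      by (intro linearI) (auto simp: \<iota>_def intro!: bcontfun_eqI)
    show "u c \<le> a" if "(\<iota> c, a) \<in> C'" for c a
      using that above by (simp add: C'_def fn_\<iota>)
    show "\<exists>s>0. \<exists>a. (\<iota> c0 + s *\<^sub>R w, a) \<in> C'" for w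
      using core[OF bdd_fn, of w] by (simp add: C'_def fn_lin fn_\<iota>)
  qed (rule u)
  then obtain L where L: "linear L" "\<And>c. L (\<iota> c) = u c" "\<And>w a. (w, a) \<in> C' \<Longrightarrow> L w \<le> a" by blast
  have add: "emb (\<lambda>t. w t + w' t) = emb w + emb w'" if "bounded (range w)" "bounded (range w')" for w w'
    using that by (intro bcontfun_eqI) (simp add: app[OF bounded_plus_comp] app)
  have scale: "emb (\<lambda>t. s *\<^sub>R w t) = s *\<^sub>R emb w" if "bounded (range w)" for s w
    using that by (intro bcontfun_eqI) (simp add: app[OF bounded_scaleR_comp] app)
  have const: "emb (\<lambda>t. c) = \<iota> c" for c
    by (intro bcontfun_eqI) (simp add: app \<iota>_def)
  show ?thesis
  proof (intro exI[of _ "\<lambda>w. L (emb w)"] conjI allI impI)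
    show "L (emb w) \<le> a" if "bounded (range w)" "(w, a) \<in> C" for w a
      using that L(3)[of "emb w" a] by (simp add: C'_def fn_emb)
  qed (simp_all add: add scale const L(2) linear_add[OF L(1)] linear_scale[OF L(1)])
qed

section \<open>The countably additive part of a charge\<close>

locale charge = sigma_finite_measure M for M :: "'t measure" +
  fixes lam :: "'t set \<Rightarrow> real"
  assumes nonneg: "A \<in> sets M \<Longrightarrow> 0 \<le> lam A"
    and add: "A \<in> sets M \<Longrightarrow> B \<in> sets M \<Longrightarrow> A \<inter> B = {} \<Longrightarrow> lam (A \<union> B) = lam A + lam B"
    and null: "A \<in> null_sets M \<Longrightarrow> lam A = 0"
begin

lemma empty: "lam {} = 0"
  by (rule null) simp

lemma diff: assumes "A \<in> sets M" "B \<in> sets M" "A \<subseteq> B" shows "lam (B - A) = lam B - lam A"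
proof -
  have "A \<union> (B - A) = B" using assms by blast
  then show ?thesis using add[of A "B - A"] assms by auto
qed

lemma mono: "A \<in> sets M \<Longrightarrow> B \<in> sets M \<Longrightarrow> A \<subseteq> B \<Longrightarrow> lam A \<le> lam B"
  using diff[of A B] nonneg[of "B - A"] by auto

lemma split: "A \<in> sets M \<Longrightarrow> B \<in> sets M \<Longrightarrow> lam A = lam (A \<inter> B) + lam (A - B)"
  using add[of "A \<inter> B" "A - B"] by (auto simp: Int_Diff_Un)

text \<open>
  Continuity at the empty set makes the charge countably additive, and the Radon-Nikodym theorem applies.
\<close>

lemma density_if_continuous:
  assumes cont: "\<And>A. range A \<subseteq> sets M \<Longrightarrow> decseq A \<Longrightarrow> (\<Inter>i. A i) = {} \<Longrightarrow> (\<lambda>i. lam (A i)) \<longlonglongrightarrow> 0"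
  shows "\<exists>g\<in>borel_measurable M. (\<forall>t. 0 \<le> g t) \<and> integrable M g \<and>
    (\<forall>A\<in>sets M. lam A = (\<integral>t. indicator A t * g t \<partial>M))"
proof -
  define N where "N = measure_of (space M) (sets M) (\<lambda>A. ennreal (lam A))"
  have pos: "positive (sets M) (\<lambda>A. ennreal (lam A))"
    by (simp add: positive_def empty)
  have ca: "countably_additive (sets M) (\<lambda>A. ennreal (lam A))"
  proof (rule sets.empty_continuous_imp_countably_additive[OF pos])
    show "additive (sets M) (\<lambda>A. ennreal (lam A))"
      by (auto simp: additive_def add nonneg ennreal_plus[symmetric] simp del: ennreal_plus)
    show "(\<lambda>i. ennreal (lam (A i))) \<longlonglongrightarrow> 0"
      if "range A \<subseteq> sets M" "decseq A" "(\<Inter>i. A i) = {}" for A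
      using tendsto_ennrealI[OF cont[OF that]] by simp
  qed simp
  have emN: "emeasure N A = ennreal (lam A)" if "A \<in> sets M" for A
    unfolding N_def using pos ca that by (intro emeasure_measure_of_sigma) (auto intro: sets.sigma_algebra_axioms)
  have sets_N: "sets N = sets M" by (simp add: N_def sets.sets_measure_of_eq)
  have "absolutely_continuous M N"
    unfolding absolutely_continuous_def
    using emN null by (auto simp: null_sets_def sets_N)
  from Radon_Nikodym[OF this sets_N] obtain f where f[measurable]: "f \<in> borel_measurable M" and fN: "density M f = N"
    by blast
  have int_f: "(\<integral>\<^sup>+t. f t * indicator A t \<partial>M) = ennreal (lam A)" if "A \<in> sets M" for A
    using emN[OF that] that by (simp add: fN[symmetric] emeasure_density)
  have "(\<integral>\<^sup>+t. f t \<partial>M) = (\<integral>\<^sup>+t. f t * indicator (space M) t \<partial>M)"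
    by (intro nn_integral_cong) simp
  then have tot: "(\<integral>\<^sup>+t. f t \<partial>M) = ennreal (lam (space M))" using int_f[of "space M"] by simp
  then have fin: "AE t in M. f t \<noteq> \<infinity>"
    by (intro nn_integral_PInf_AE) auto
  define g where "g t = enn2real (f t)" for t
  have [measurable]: "g \<in> borel_measurable M" unfolding g_def by measurable
  have g0: "0 \<le> g t" for t by (simp add: g_def)
  have fg: "AE t in M. f t = ennreal (g t)"
    using fin by eventually_elim (simp add: g_def top.not_eq_extremum)
  have int_g: "(\<integral>\<^sup>+t. ennreal (indicator A t * g t) \<partial>M) = ennreal (lam A)" if A: "A \<in> sets M" for A
  proof -
    have "(\<integral>\<^sup>+t. ennreal (indicator A t * g t) \<partial>M) = (\<integral>\<^sup>+t. f t * indicator A t \<partial>M)"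
      using fg by (intro nn_integral_cong_AE, eventually_elim) (auto split: split_indicator)
    then show ?thesis using int_f[OF A] by simp
  qed
  have 1: "integrable M (\<lambda>t. indicator A t * g t)" if A: "A \<in> sets M" for A
  proof (rule integrableI_nonneg)
    show "(\<integral>\<^sup>+t. ennreal (indicator A t * g t) \<partial>M) < \<infinity>" using int_g[OF A] by simp
  qed (use A g0 in auto)
  have "integrable M (\<lambda>t. indicator (space M) t * g t)" by (rule 1) simp
  then have "integrable M g"
    by (simp cong: Bochner_Integration.integrable_cong)
  moreover have "lam A = (\<integral>t. indicator A t * g t \<partial>M)" if "A \<in> sets M" for A
    using nn_integral_eq_integral[OF 1[OF that]] int_g[OF that] g0 nonneg[OF that]
    by (simp add: integral_nonneg)
  ultimately show ?thesis using g0 by (intro bexI[of _ g]) auto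
qed

end

text \<open>
  The purely finitely additive part of a charge lives on sets of arbitrarily small measure.  Let \<open>r n\<close> be
  the infimum of the charge over the sets whose complement has measure below \<open>2\<^sup>-\<^sup>n\<close>, and \<open>R\<close> the supremum of
  these infima, which is the mass of the countably additive part.  Intersections \<open>G N\<close> of almost optimal sets
  have charge at most \<open>R\<close>.  If there were subsets of \<open>G N\<close> of small measure and charge at least \<open>e\<close>,
  then removing them from later \<open>G i\<close> would leave sets with almost full measure and charge at most \<open>R - e\<close>,
  which contradicts the choice of \<open>R\<close>.
\<close>

lemma (in charge) exhaustion_uniformly_continuous:
  assumes m: "finite_measure m" and sm[simp]: "sets m = sets M" 
  shows "\<exists>G :: nat \<Rightarrow> 't set. range G \<subseteq> sets M \<and> incseq G \<and> (AE t in m. t \<in> (\<Union>n. G n)) \<and>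
    (\<forall>N. \<forall>e>0. \<exists>d>0. \<forall>A\<in>sets M. A \<subseteq> G N \<longrightarrow> measure m A < d \<longrightarrow> lam A < e)"
proof -
  interpret m: finite_measure m by fact
  define \<Omega> where "\<Omega> = space M"
  have sp: "space m = \<Omega>" using sets_eq_imp_space_eq[OF sm] by (simp add: \<Omega>_def)
  define S where "S n = {lam E | E. E \<in> sets M \<and> measure m (\<Omega> - E) < (1/2)^n}" for n :: nat
  define r where "r n = Inf (S n)" for n
  have O: "\<Omega> \<in> sets M" by (simp add: \<Omega>_def)
  have S\<Omega>: "lam \<Omega> \<in> S n" for n unfolding S_def using O by (auto intro!: exI[of _ \<Omega>])
  have bdd: "bdd_below (S n)" for n
    by (rule bdd_belowI[of _ 0]) (auto simp: S_def nonneg)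
  have r_le: "r n \<le> lam E" if "E \<in> sets M" "measure m (\<Omega> - E) < (1/2)^n" for n E
    unfolding r_def using that by (intro cInf_lower bdd) (auto simp: S_def)
  have r_bound: "r n \<le> lam \<Omega>" for n using r_le[OF O] by simp
  define R where "R = (SUP n. r n)"
  have bddr: "bdd_above (range r)" using r_bound by (auto simp: bdd_above_def)
  have rR: "r n \<le> R" for n unfolding R_def using bddr by (intro cSUP_upper) auto
  have "\<exists>E. E \<in> sets M \<and> measure m (\<Omega> - E) < (1/2)^n \<and> lam E < r n + (1/2)^n" for n
  proof -
    have "Inf (S n) < r n + (1/2)^n" by (simp add: r_def)
    then obtain x where "x \<in> S n" "x < r n + (1/2)^n"
      using cInf_lessD[of "S n"] S\<Omega> by (metis empty_iff)
    then show ?thesis by (auto simp: S_def)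
  qed
  then obtain E where E[simp]: "\<And>n. E n \<in> sets M" and Em: "\<And>n. measure m (\<Omega> - E n) < (1/2)^n"
    and El: "\<And>n. lam (E n) < r n + (1/2)^n" by metis
  define G where "G N = (\<Inter>n\<in>{N..}. E n)" for N
  have G[simp]: "G N \<in> sets M" for N unfolding G_def by (intro sets.countable_INT') auto
  have Gm: "measure m (\<Omega> - G N) \<le> 2 * (1/2)^N" for N
  proof -
    have Em': "measure m (\<Omega> - E (n + N)) \<le> (1/2)^(n + N)" for n
      using Em[of "n + N"] by (rule less_imp_le)
    have geo: "(\<lambda>n. (1/2::real)^(n + N)) sums (2 * (1/2)^N)"
      using sums_mult2[OF geometric_sums[of "1/2::real"], of "(1/2)^N"] by (simp add: power_add)
    have sum: "summable (\<lambda>n. measure m (\<Omega> - E (n + N)))"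
      by (rule summable_comparison_test'[OF sums_summable[OF geo], of 0]) (use Em' in simp)
    have "\<Omega> - G N \<subseteq> (\<Union>n. \<Omega> - E (n + N))"
    proof
      fix t assume "t \<in> \<Omega> - G N"
      then obtain n where "N \<le> n" "t \<in> \<Omega> - E n" by (auto simp: G_def)
      then show "t \<in> (\<Union>n. \<Omega> - E (n + N))" by (intro UN_I[of "n - N"]) auto
    qed
    then have "measure m (\<Omega> - G N) \<le> measure m (\<Union>n. \<Omega> - E (n + N))"
      using O by (intro m.finite_measure_mono) (auto simp del: UN_simps intro!: sets.countable_UN)
    also have "\<dots> \<le> (\<Sum>n. measure m (\<Omega> - E (n + N)))"
      using O by (intro m.finite_measure_subadditive_countably[OF _ sum]) auto
    also have "\<dots> \<le> (\<Sum>n. (1/2::real)^(n+N))"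
      by (rule suminf_le[OF Em' sum sums_summable[OF geo]])
    also have "\<dots> = 2 * (1/2)^N"
      using geo by (rule sums_unique[symmetric])
    finally show ?thesis .
  qed
  have lamG: "lam (G N) \<le> R" for N
  proof (rule LIMSEQ_le_const)
    show "(\<lambda>n. R + (1/2)^n) \<longlonglongrightarrow> R"
      by (auto intro!: tendsto_eq_intros LIMSEQ_realpow_zero)
    have "lam (G N) \<le> R + (1/2)^n" if "n \<ge> N" for n
    proof -
      have "lam (G N) \<le> lam (E n)" using that by (intro mono) (auto simp: G_def)
      then show ?thesis using El[of n] rR[of n] by linarith
    qed
    then show "\<exists>N'. \<forall>n\<ge>N'. lam (G N) \<le> R + (1/2)^n" by blast
  qed
  have "incseq G" by (auto simp: incseq_def G_def)
  have ae: "AE t in m. t \<in> (\<Union>n. G n)"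
  proof (rule AE_I)
    have "measure m (\<Omega> - (\<Union>n. G n)) \<le> 2 * (1/2)^N" for N
    proof -
      have "measure m (\<Omega> - (\<Union>n. G n)) \<le> measure m (\<Omega> - G N)"
        using O by (intro m.finite_measure_mono) auto
      then show ?thesis using Gm[of N] by linarith
    qed
    moreover have "(\<lambda>N. 2 * (1/2::real)^N) \<longlonglongrightarrow> 0"
      by (auto intro!: tendsto_eq_intros LIMSEQ_realpow_zero)
    ultimately have "measure m (\<Omega> - (\<Union>n. G n)) \<le> 0"
      using LIMSEQ_le_const by blast
    then show "emeasure m (\<Omega> - (\<Union>n. G n)) = 0"
      by (simp add: m.emeasure_eq_measure measure_le_0_iff)
    have "(\<Union>n. G n) \<in> sets M" by (intro sets.countable_UN) auto
    then show "\<Omega> - (\<Union>n. G n) \<in> sets m" using O by auto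
  qed (use sp in auto)
  have uc: "\<exists>d>0. \<forall>A\<in>sets M. A \<subseteq> G N \<longrightarrow> measure m A < d \<longrightarrow> lam A < e" if "e > 0" for N e
  proof (rule ccontr)
    assume neg: "\<not> ?thesis"
    obtain n where n: "R - e < r n"
    proof -
      have "R - e < (SUP n. r n)" using \<open>e > 0\<close> by (simp add: R_def)
      then show ?thesis using that less_cSUP_iff[OF _ bddr] by auto
    qed
    define i where "i = max N (n + 2)"
    have i: "2 * (1/2::real)^i \<le> (1/2)^n / 2"
    proof -
      have "(1/2::real)^i \<le> (1/2)^(n+2)" unfolding i_def by (intro power_decreasing) auto
      then show ?thesis by (simp add: power_add)
    qed
    have "\<not> (\<forall>A\<in>sets M. A \<subseteq> G N \<longrightarrow> measure m A < (1/2)^n/2 \<longrightarrow> lam A < e)"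
      using neg by (metis half_gt_zero zero_less_power zero_less_divide_1_iff zero_less_numeral)
    then obtain A where A: "A \<in> sets M" "A \<subseteq> G N" "measure m A < (1/2)^n/2" "e \<le> lam A"
      by (auto simp: not_less)
    have "G N \<subseteq> G i" by (rule incseqD[OF \<open>incseq G\<close>]) (simp add: i_def)
    then have AG: "A \<subseteq> G i" using A(2) by blast
    have "measure m (\<Omega> - (G i - A)) \<le> measure m ((\<Omega> - G i) \<union> A)"
      using A(1) O G[of i] by (intro m.finite_measure_mono) (blast, simp add: sets.Un sets.Diff)
    also have "\<dots> \<le> measure m (\<Omega> - G i) + measure m A"
      using A(1) O G[of i] by (intro measure_Un_le) (simp_all add: sets.Diff)
    also have "\<dots> < (1/2)^n" using Gm[of i] i A(3) by linarith
    finally have "r n \<le> lam (G i - A)" using A(1) by (intro r_le) auto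
    also have "\<dots> = lam (G i) - lam A" using A(1) AG by (intro diff) auto
    also have "\<dots> \<le> R - e" using lamG[of i] A(4) by linarith
    finally show False using n by linarith
  qed
  show ?thesis using \<open>incseq G\<close> ae uc by (intro exI[of _ G]) auto
qed

text \<open>
  On the exhausting sets the charge is continuous with respect to a finite measure that has the same null
  sets.  The limit \<open>mu A\<close> of the charges of \<open>A \<inter> G N\<close> inherits the continuity, because \<open>mu\<close> of
  the complement of \<open>G N\<close> tends to zero; its density is the desired \<open>g\<close>.
\<close>

theorem (in charge) Yosida_Hewitt_density:
  "\<exists>(G :: nat \<Rightarrow> 't set) g. range G \<subseteq> sets M \<and> incseq G \<and> (AE t in M. t \<in> (\<Union>n. G n)) \<and>
    g \<in> borel_measurable M \<and> (\<forall>t. 0 \<le> g t) \<and> integrable M g \<and>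
    (\<forall>N. \<forall>A\<in>sets M. A \<subseteq> G N \<longrightarrow> lam A = (\<integral>t. indicator A t * g t \<partial>M))"
proof -
  obtain h :: "'t \<Rightarrow> real" where h[measurable]: "h \<in> borel_measurable M" and h0: "\<And>t. h t > 0" and hi: "integrable M h"
    using obtain_positive_integrable_function by metis
  define m where "m = density M h"
  have sm[simp]: "sets m = sets M" by (simp add: m_def)
  have m: "finite_measure m"
  proof
    have "emeasure m (space m) = (\<integral>\<^sup>+t. ennreal (h t) \<partial>M)"
      by (simp add: m_def emeasure_density cong: nn_integral_cong)
    also have "\<dots> = ennreal (\<integral>t. h t \<partial>M)"
      using hi h0 by (intro nn_integral_eq_integral) (auto intro: less_imp_le)
    finally show "emeasure m (space m) \<noteq> \<infinity>" by simp
  qed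
  interpret m: finite_measure m by fact
  obtain G where G: "\<And>n. G n \<in> sets M" "incseq G" and aeG: "AE t in m. t \<in> (\<Union>n. G n)"
    and uc: "\<And>N e. e > 0 \<Longrightarrow> \<exists>d>0. \<forall>A\<in>sets M. A \<subseteq> G N \<longrightarrow> measure m A < d \<longrightarrow> lam A < e"
  proof -
    from exhaustion_uniformly_continuous[OF m sm] obtain G where *:
      "range G \<subseteq> sets M" "incseq G" "AE t in m. t \<in> (\<Union>n. G n)"
      "\<forall>N. \<forall>e>0. \<exists>d>0. \<forall>A\<in>sets M. A \<subseteq> G N \<longrightarrow> measure m A < d \<longrightarrow> lam A < e"
      by (elim exE conjE)
    show ?thesis by (rule that[OF _ *(2,3)]) (use *(1,4) in auto)
  qed
  have ae: "AE t in M. t \<in> (\<Union>n. G n)"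
    using aeG h0 unfolding m_def by (subst (asm) AE_density) auto
  have cont_G: "(\<lambda>i. lam (A i \<inter> G N)) \<longlonglongrightarrow> 0"
    if A: "range A \<subseteq> sets M" "decseq A" "(\<Inter>i. A i) = {}" for A N
  proof (rule LIMSEQ_I)
    fix e :: real assume "e > 0"
    from uc[OF this, of N] obtain d where d: "d > 0" "\<forall>B\<in>sets M. B \<subseteq> G N \<longrightarrow> measure m B < d \<longrightarrow> lam B < e"
      by (elim exE conjE)
    have "(\<lambda>i. measure m (A i)) \<longlonglongrightarrow> measure m (\<Inter>i. A i)"
      using A by (intro m.finite_Lim_measure_decseq) auto
    then have "(\<lambda>i. measure m (A i)) \<longlonglongrightarrow> 0" using A by simp
    then have "eventually (\<lambda>i. measure m (A i) < d) sequentially"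
      using d(1) by (rule order_tendstoD)
    then have "eventually (\<lambda>i. norm (lam (A i \<inter> G N) - 0) < e) sequentially"
    proof eventually_elim
      case (elim i)
      have Ai: "A i \<in> sets M" using A by auto
      have "measure m (A i \<inter> G N) \<le> measure m (A i)"
        using Ai by (intro m.finite_measure_mono) auto
      then have "lam (A i \<inter> G N) < e" using elim Ai G d(2) by (meson inf_le2 order.strict_trans1 sets.Int)
      then show ?case using nonneg[of "A i \<inter> G N"] Ai G by auto
    qed
    then show "\<exists>no. \<forall>i\<ge>no. norm (lam (A i \<inter> G N) - 0) < e" by (simp add: eventually_sequentially)
  qed
  define mu where "mu A = (SUP N. lam (A \<inter> G N))" for A
  have bdd: "bdd_above (range (\<lambda>N. lam (A \<inter> G N)))" if "A \<in> sets M" for A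
    by (rule bdd_aboveI2[of _ _ "lam A"]) (use that G in \<open>auto intro!: mono\<close>)
  have inc: "incseq (\<lambda>N. lam (A \<inter> G N))" if "A \<in> sets M" for A
    unfolding incseq_def
  proof (intro allI impI mono)
    fix m n :: nat assume "m \<le> n"
    then show "A \<inter> G m \<subseteq> A \<inter> G n" using G(2) by (auto simp: incseq_def)
  qed (use that G in auto)
  have lim: "(\<lambda>N. lam (A \<inter> G N)) \<longlonglongrightarrow> mu A" if "A \<in> sets M" for A
    unfolding mu_def using bdd[OF that] inc[OF that] by (intro LIMSEQ_incseq_SUP)
  have le: "lam (A \<inter> G N) \<le> mu A" if "A \<in> sets M" for A N
    unfolding mu_def using bdd[OF that] by (intro cSUP_upper) auto
  have mu: "charge M mu"
  proof
    show nn: "0 \<le> mu A" if "A \<in> sets M" for A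
      using le[OF that, of 0] nonneg[of "A \<inter> G 0"] that G by (auto intro: order.trans)
    show "mu (A \<union> B) = mu A + mu B" if "A \<in> sets M" "B \<in> sets M" "A \<inter> B = {}" for A B
    proof (rule LIMSEQ_unique)
      show "(\<lambda>N. lam ((A \<union> B) \<inter> G N)) \<longlonglongrightarrow> mu (A \<union> B)" using that by (intro lim) auto
      have "lam ((A \<union> B) \<inter> G N) = lam (A \<inter> G N) + lam (B \<inter> G N)" for N
        using add[of "A \<inter> G N" "B \<inter> G N"] that G by (auto simp: Int_Un_distrib2)
      then show "(\<lambda>N. lam ((A \<union> B) \<inter> G N)) \<longlonglongrightarrow> mu A + mu B"
        using tendsto_add[OF lim lim, of A B] that by simp
    qed
    show "mu A = 0" if "A \<in> null_sets M" for A
    proof -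
      have "lam (A \<inter> G N) = 0" for N
        using that G by (intro null null_set_Int2) auto
      then show ?thesis by (simp add: mu_def)
    qed
  qed
  interpret mu: charge M mu by (rule mu)
  have mu_cont: "(\<lambda>i. mu (A i)) \<longlonglongrightarrow> 0"
    if A: "range A \<subseteq> sets M" "decseq A" "(\<Inter>i. A i) = {}" for A
  proof (rule LIMSEQ_I)
    fix e :: real assume "e > 0"
    have A': "A i \<in> sets M" for i using A by auto
    have sp: "space M \<in> sets M" by simp
    have "eventually (\<lambda>N. mu (space M) - e/2 < lam (space M \<inter> G N)) sequentially"
      using \<open>e > 0\<close> by (intro order_tendstoD(1)[OF lim[OF sp]]) auto
    then obtain N where N: "mu (space M) - e/2 < lam (space M \<inter> G N)"
      by (auto simp: eventually_sequentially)
    have muG: "mu (B \<inter> G N) = lam (B \<inter> G N)" if B: "B \<in> sets M" for B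
    proof (rule LIMSEQ_unique[OF lim])
      have "eventually (\<lambda>n. lam (B \<inter> G N \<inter> G n) = lam (B \<inter> G N)) sequentially"
      proof (rule eventually_mono[OF eventually_ge_at_top[of N]])
        fix n assume "N \<le> n"
        then have "G N \<subseteq> G n" using G(2) by (auto simp: incseq_def)
        then have "B \<inter> G N \<inter> G n = B \<inter> G N" by blast
        then show "lam (B \<inter> G N \<inter> G n) = lam (B \<inter> G N)" by simp
      qed
      then show "(\<lambda>n. lam (B \<inter> G N \<inter> G n)) \<longlonglongrightarrow> lam (B \<inter> G N)"
        by (rule tendsto_eventually)
    qed (use B G in auto)
    have "eventually (\<lambda>i. lam (A i \<inter> G N) < e/2) sequentially"
      using \<open>e > 0\<close> by (intro order_tendstoD(2)[OF cont_G[OF A]]) auto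
    then have "eventually (\<lambda>i. norm (mu (A i) - 0) < e) sequentially"
    proof eventually_elim
      case (elim i)
      have "mu (A i) = mu (A i \<inter> G N) + mu (A i - G N)" using A' G by (intro mu.split)
      also have "mu (A i - G N) \<le> mu (space M - G N)"
        using A' G sets.sets_into_space[OF A'] by (intro mu.mono) blast+
      also have "mu (space M - G N) = mu (space M) - mu (space M \<inter> G N)"
        using mu.split[of "space M" "G N"] G by simp
      also have "mu (A i \<inter> G N) = lam (A i \<inter> G N)" by (rule muG[OF A'])
      finally show ?case using N elim muG[OF sp] mu.nonneg[OF A'[of i]] by auto
    qed
    then show "\<exists>no. \<forall>i\<ge>no. norm (mu (A i) - 0) < e" by (simp add: eventually_sequentially)
  qed
  obtain g where g: "g \<in> borel_measurable M" "\<And>t. 0 \<le> g t" "integrable M g"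
    "\<And>A. A \<in> sets M \<Longrightarrow> mu A = (\<integral>t. indicator A t * g t \<partial>M)"
    using mu.density_if_continuous[OF mu_cont] by blast
  have "lam A = (\<integral>t. indicator A t * g t \<partial>M)" if A: "A \<in> sets M" "A \<subseteq> G N" for A N
  proof -
    have "eventually (\<lambda>n. lam (A \<inter> G n) = lam A) sequentially"
    proof (rule eventually_mono[OF eventually_ge_at_top[of N]])
      fix n assume "N \<le> n"
      then have "A \<inter> G n = A" using G(2) A by (auto simp: incseq_def)
      then show "lam (A \<inter> G n) = lam A" by simp
    qed
    then have "mu A = lam A"
      using LIMSEQ_unique[OF lim[OF A(1)] tendsto_eventually] by blast
    then show ?thesis using g(4)[OF A(1)] by simp
  qed
  then show ?thesis using g(1-3) G ae by (intro exI[of _ G] exI[of _ g]) auto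
qed

section \<open>The Radon-Nikodym property of the dual of an Asplund space\<close>

text \<open>
  Exhaustion: among the countable unions of sets with property \<open>P\<close> there is one of maximal measure, and
  its complement is null because it contains no \<open>P\<close>-set of positive measure.  Heredity makes the union
  disjoint, and finitely many of its members reach all but \<open>e\<close> of the measure.
\<close>

lemma (in finite_measure) hereditary_exhaustion:
  assumes her: "\<And>A B. P A \<Longrightarrow> B \<subseteq> A \<Longrightarrow> B \<in> sets M \<Longrightarrow> P B" and P0: "P {}"
    and ex: "\<And>A. A \<in> sets M \<Longrightarrow> 0 < measure M A \<Longrightarrow> \<exists>B\<in>sets M. B \<subseteq> A \<and> P B \<and> 0 < measure M B"
    and e: "0 < e"
  shows "\<exists>(D :: nat \<Rightarrow> 'a set) (K :: nat). disjoint_family D \<and> (\<forall>i. D i \<in> sets M \<and> P (D i)) \<and>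
    measure M (space M - (\<Union>i<K. D i)) < e"
proof -
  define \<B> where "\<B> = {B :: nat \<Rightarrow> 'a set. \<forall>i. B i \<in> sets M \<and> P (B i)}"
  define S where "S = (\<lambda>B. measure M (\<Union>i. B i)) ` \<B>"
  have ne: "\<B> \<noteq> {}" using P0 by (auto simp: \<B>_def intro!: exI[of _ "\<lambda>_. {}"])
  have bdd: "bdd_above S" unfolding S_def by (rule bdd_aboveI2[of _ _ "measure M (space M)"]) (rule bounded_measure)
  define s where "s = Sup S"
  have le_s: "measure M (\<Union>i. B i) \<le> s" if "B \<in> \<B>" for B
    unfolding s_def using that bdd by (intro cSup_upper) (auto simp: S_def)
  have "\<exists>B\<in>\<B>. s - 1 / Suc n < measure M (\<Union>i. B i)" for n
  proof -
    have "s - 1 / Suc n < Sup S" unfolding s_def by simp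
    then show ?thesis using less_cSup_iff[OF _ bdd] ne unfolding S_def by auto
  qed
  then obtain B where B: "\<And>n. B n \<in> \<B>" and Bs: "\<And>n. s - 1 / Suc n < measure M (\<Union>i. B n i)" by metis
  define B' where "B' k = B (fst (prod_decode k)) (snd (prod_decode k))" for k
  have B': "B' \<in> \<B>" using B by (auto simp: \<B>_def B'_def)
  then have B'_sets[simp]: "B' i \<in> sets M" and B'_P: "P (B' i)" for i by (auto simp: \<B>_def)
  define U where "U = (\<Union>i. B' i)"
  have U: "U \<in> sets M" unfolding U_def by (intro sets.countable_UN) auto
  have "s \<le> measure M U"
  proof (rule LIMSEQ_le_const2)
    show "(\<lambda>n. s - 1 / Suc n) \<longlonglongrightarrow> s"
      using tendsto_diff[OF tendsto_const LIMSEQ_inverse_real_of_nat, of s] by (simp add: inverse_eq_divide)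
    have "s - 1 / Suc n \<le> measure M U" for n
    proof -
      have "(\<Union>i. B n i) \<subseteq> U"
        unfolding U_def B'_def by (auto intro!: exI[of _ "prod_encode (n, _)"])
      then have "measure M (\<Union>i. B n i) \<le> measure M U" using U by (intro finite_measure_mono)
      then show ?thesis using Bs[of n] by linarith
    qed
    then show "\<exists>N. \<forall>n\<ge>N. s - 1 / Suc n \<le> measure M U" by blast
  qed
  have null: "measure M (space M - U) = 0"
  proof (rule ccontr)
    assume "measure M (space M - U) \<noteq> 0"
    then have "0 < measure M (space M - U)" by (simp add: zero_less_measure_iff)
    then obtain C where C: "C \<in> sets M" "C \<subseteq> space M - U" "P C" "0 < measure M C" using ex[of "space M - U"] U by blast
    define B'' where "B'' i = (case i of 0 \<Rightarrow> C | Suc j \<Rightarrow> B' j)" for i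
    have "B'' \<in> \<B>" using C B'_P by (auto simp: \<B>_def B''_def split: nat.split)
    moreover have "(\<Union>i. B'' i) = C \<union> U"
      unfolding U_def B''_def by (auto split: nat.splits)
    ultimately have "measure M (C \<union> U) \<le> s" using le_s by metis
    moreover have "measure M (C \<union> U) = measure M C + measure M U"
      using C U by (intro finite_measure_Union) auto
    ultimately show False using C \<open>s \<le> measure M U\<close> by linarith
  qed
  define D where "D = disjointed B'"
  have D_sets[simp]: "D i \<in> sets M" for i
  proof -
    have "range (disjointed B') \<subseteq> sets M" by (rule sets.range_disjointed_sets) auto
    then show ?thesis by (auto simp: D_def)
  qed
  have UD: "(\<Union>i. D i) = U" unfolding D_def U_def by (rule UN_disjointed_eq)
  have "(\<lambda>K. measure M (\<Union>i<K. D i)) \<longlonglongrightarrow> measure M (\<Union>K. \<Union>i<K. D i)"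
  proof (rule finite_Lim_measure_incseq)
    show "incseq (\<lambda>K. \<Union>i<K. D i)" by (intro monoI UN_mono) auto
  qed (auto intro!: sets.finite_UN)
  moreover have "(\<Union>K. \<Union>i<K. D i) = U" unfolding UD[symmetric] by auto
  ultimately have "eventually (\<lambda>K. measure M U - e < measure M (\<Union>i<K. D i)) sequentially"
    using e by (intro order_tendstoD(1)) auto
  then obtain K where K: "measure M U - e < measure M (\<Union>i<K. D i)" by (auto simp: eventually_sequentially)
  have "measure M (space M - (\<Union>i<K. D i)) = measure M (space M) - measure M (\<Union>i<K. D i)"
    by (intro finite_measure_compl sets.finite_UN) auto
  moreover have "measure M (space M - U) = measure M (space M) - measure M U"
    using U by (intro finite_measure_compl)
  ultimately have "measure M (space M - (\<Union>i<K. D i)) < e" using K null by linarith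
  moreover have "P (D i)" for i
    using her[OF B'_P[of i], of "D i"] disjointed_subset[of B' i] by (simp add: D_def[symmetric])
  ultimately show ?thesis
    using disjoint_family_disjointed[of B'] by (intro exI[of _ D] exI[of _ K]) (auto simp: D_def[symmetric])
qed

text \<open>
  The support function \<open>\<sigma>\<close> of \<open>K\<close> is convex and Lipschitz on the whole space, hence Frechet differentiable
  by the Asplund property at some \<open>y\<close>, with derivative \<open>d\<close> say.  If \<open>\<xi> \<in> K\<close> almost attains \<open>\<sigma> y\<close>, then
  \<open>\<xi> v \<le> \<sigma> (y + v) - \<sigma> y + small \<le> d v + small\<close> uniformly on a sphere of small radius, so \<open>\<xi>\<close> is close to \<open>d\<close> in
  norm (Smulian's criterion).
\<close>

lemma asplund_small_slice:
  fixes K :: "('a::banach \<Rightarrow>\<^sub>L real) set"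
  assumes asp: "asplund_space TYPE('a)" and ne: "K \<noteq> {}" and K: "\<And>\<xi>. \<xi> \<in> K \<Longrightarrow> norm \<xi> \<le> 1" and e: "0 < e"
  shows "\<exists>y d \<alpha>. (\<exists>\<xi>\<in>K. \<alpha> < blinfun_apply \<xi> y) \<and> (\<forall>\<xi>\<in>K. \<alpha> \<le> blinfun_apply \<xi> y \<longrightarrow> norm (\<xi> - d) \<le> e)"
proof -
  define \<sigma> where "\<sigma> y = (SUP \<xi>\<in>K. blinfun_apply \<xi> y)" for y
  have app: "\<bar>blinfun_apply \<xi> y\<bar> \<le> norm y" if "\<xi> \<in> K" for \<xi> y
    using norm_blinfun[of \<xi> y] mult_right_mono[OF K[OF that] norm_ge_zero, of y] by simp
  have bdd: "bdd_above ((\<lambda>\<xi>. blinfun_apply \<xi> y) ` K)" for y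
    by (rule bdd_aboveI2[of _ _ "norm y"]) (use app in \<open>force simp: abs_le_iff\<close>)
  have le: "blinfun_apply \<xi> y \<le> \<sigma> y" if "\<xi> \<in> K" for \<xi> y
    unfolding \<sigma>_def using that bdd by (intro cSUP_upper)
  have lip: "\<sigma> x - \<sigma> y \<le> norm (x - y)" for x y
  proof -
    have "\<sigma> x \<le> \<sigma> y + norm (x - y)"
      unfolding \<sigma>_def[of x]
    proof (rule cSUP_least[OF ne])
      fix \<xi> assume "\<xi> \<in> K"
      then show "blinfun_apply \<xi> x \<le> \<sigma> y + norm (x - y)"
        using le[of \<xi> y] app[of \<xi> "x - y"] by (simp add: blinfun.diff_right abs_le_iff)
    qed
    then show ?thesis by simp
  qed
  have "continuous_on UNIV \<sigma>"
  proof (rule continuous_on_iff[THEN iffD2], intro ballI allI impI)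
    fix x :: 'a and e :: real assume "e > 0"
    have "dist (\<sigma> x') (\<sigma> x) \<le> dist x' x" for x'
      using lip[of x' x] lip[of x x'] by (simp add: dist_real_def dist_norm norm_minus_commute abs_le_iff)
    then show "\<exists>d>0. \<forall>x'\<in>UNIV. dist x' x < d \<longrightarrow> dist (\<sigma> x') (\<sigma> x) < e"
      using \<open>e > 0\<close> by (intro exI[of _ e]) (auto intro: order.strict_trans1)
  qed
  moreover have "convex_on UNIV \<sigma>"
  proof (rule convex_onI)
    fix t :: real and x y :: 'a assume t: "0 < t" "t < 1"
    show "\<sigma> ((1 - t) *\<^sub>R x + t *\<^sub>R y) \<le> (1 - t) * \<sigma> x + t * \<sigma> y"
      unfolding \<sigma>_def[of "(1 - t) *\<^sub>R x + t *\<^sub>R y"]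
    proof (rule cSUP_least[OF ne])
      fix \<xi> assume "\<xi> \<in> K"
      then show "blinfun_apply \<xi> ((1 - t) *\<^sub>R x + t *\<^sub>R y) \<le> (1 - t) * \<sigma> x + t * \<sigma> y"
        using t le[of \<xi> x] le[of \<xi> y]
        by (simp add: blinfun.add_right blinfun.scaleR_right add_mono mult_left_mono)
    qed
  qed simp
  ultimately have "\<exists>G. gdelta_in euclidean G \<and> G \<subseteq> UNIV \<and> (UNIV::'a set) \<subseteq> closure G \<and> (\<forall>x\<in>G. \<sigma> differentiable (at x))"
    using asp[unfolded asplund_space_def, rule_format, of UNIV \<sigma>] by simp
  then obtain G where "(UNIV::'a set) \<subseteq> closure G" "\<forall>x\<in>G. \<sigma> differentiable (at x)" by blast
  moreover from this have "G \<noteq> {}" by auto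
  ultimately obtain y where "\<sigma> differentiable (at y)" by blast
  then obtain d' where d': "(\<sigma> has_derivative d') (at y)" by (auto simp: differentiable_def)
  define d where "d = Blinfun d'"
  have d: "blinfun_apply d = d'"
    unfolding d_def using has_derivative_bounded_linear[OF d'] by (rule bounded_linear_Blinfun_apply)
  from d' e have "\<exists>c>0. \<forall>z. norm (z - y) < c \<longrightarrow> norm (\<sigma> z - \<sigma> y - d' (z - y)) \<le> e/2 * norm (z - y)"
    unfolding has_derivative_at_alt by (meson half_gt_zero)
  then obtain c where c: "c > 0" "\<And>z. norm (z - y) < c \<Longrightarrow> norm (\<sigma> z - \<sigma> y - d' (z - y)) \<le> e/2 * norm (z - y)" by blast
  \<comment> \<open>The radius \<open>r\<close> of the sphere and the depth \<open>e/2 * r\<close> of the slice match: after division by \<open>r\<close>, the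
    error of differentiability and the depth contribute \<open>e/2\<close> each.\<close>
  define r where "r = c / 2"
  have r: "0 < r" "r < c" using c by (auto simp: r_def)
  define \<alpha> where "\<alpha> = \<sigma> y - e/2 * r"
  have "\<alpha> < (SUP \<xi>\<in>K. blinfun_apply \<xi> y)" using e r by (simp add: \<alpha>_def \<sigma>_def[symmetric])
  then have "\<exists>\<xi>\<in>K. \<alpha> < blinfun_apply \<xi> y" using less_cSUP_iff[OF ne bdd] by blast
  moreover have "norm (\<xi> - d) \<le> e" if \<xi>: "\<xi> \<in> K" "\<alpha> \<le> blinfun_apply \<xi> y" for \<xi>
  proof (rule norm_blinfun_bound)
    have small: "blinfun_apply (\<xi> - d) v \<le> e * r" if v: "norm v = r" for v
    proof -
      have "\<sigma> (y + v) - \<sigma> y - d' v \<le> e/2 * r"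
        using c(2)[of "y + v"] v r abs_ge_self[of "\<sigma> (y + v) - \<sigma> y - d' v"] by simp
      then show ?thesis
        using le[OF \<xi>(1), of "y + v"] \<xi>(2)
        by (simp add: \<alpha>_def d[symmetric] blinfun.diff_left blinfun.add_right)
    qed
    have bound: "blinfun_apply (\<xi> - d) v \<le> e * norm v" for v
    proof (cases "v = 0")
      case False
      then have "blinfun_apply (\<xi> - d) ((r / norm v) *\<^sub>R v) \<le> e * r" using r by (intro small) simp
      then have "r * (blinfun_apply (\<xi> - d) v / norm v) \<le> r * e" by (simp add: blinfun.scaleR_right mult.commute)
      then show ?thesis using False r by (simp add: divide_le_eq)
    qed simp
    show "norm (blinfun_apply (\<xi> - d) v) \<le> e * norm v" for v
      using bound[of v] bound[of "-v"] by (simp add: blinfun.minus_right abs_le_iff)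
  qed (use e in simp)
  ultimately show ?thesis by blast
qed

text \<open>
  Additivity and domination by a finite measure already force countable additivity in norm.
\<close>

locale dominated_vector_charge = finite_measure m for m :: "'t measure" +
  fixes nu :: "'t set \<Rightarrow> ('a::banach \<Rightarrow>\<^sub>L real)"
  assumes nu_add: "A \<in> sets m \<Longrightarrow> B \<in> sets m \<Longrightarrow> A \<inter> B = {} \<Longrightarrow> nu (A \<union> B) = nu A + nu B"
    and nu_bound: "A \<in> sets m \<Longrightarrow> norm (nu A) \<le> measure m A"
begin

text \<open>
  The averages of \<open>nu\<close> over the nonnull subsets of \<open>B\<close> stay within \<open>e\<close> of \<open>\<xi>\<close>, stated without
  division.  The norm bound holds automatically on nonnull sets if \<open>e \<le> 1\<close>; demanding it makes the
  approximating step functions uniformly bounded also where null pieces occur.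
\<close>

definition near_constant :: "real \<Rightarrow> ('a \<Rightarrow>\<^sub>L real) \<Rightarrow> 't set \<Rightarrow> bool" where
  "near_constant e \<xi> B \<longleftrightarrow> norm \<xi> \<le> 2 \<and>
     (\<forall>C\<in>sets m. C \<subseteq> B \<longrightarrow> norm (nu C - measure m C *\<^sub>R \<xi>) \<le> e * measure m C)"

lemma near_constant_subset: "near_constant e \<xi> A \<Longrightarrow> B \<subseteq> A \<Longrightarrow> near_constant e \<xi> B"
  by (auto simp: near_constant_def)

text \<open>
  A slice of small diameter of the average range is given by a point \<open>y\<close> and a level \<open>\<alpha>\<close>.  The scalar
  charge \<open>\<langle>nu, y\<rangle>\<close> has a density; where this density is at least \<open>\<alpha>\<close>, all averages belong to the
  slice.  The set is not null because one average exceeds \<open>\<alpha>\<close>.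
\<close>

lemma near_constant_exists:
  assumes asp: "asplund_space TYPE('a)" and e: "0 < e" "e \<le> 1" and A: "A \<in> sets m" "0 < measure m A"
  shows "\<exists>B\<in>sets m. B \<subseteq> A \<and> (\<exists>\<xi>. near_constant e \<xi> B) \<and> 0 < measure m B"
proof -
  define K where "K = {nu C /\<^sub>R measure m C | C. C \<in> sets m \<and> C \<subseteq> A \<and> 0 < measure m C}"
  have K1: "norm \<xi> \<le> 1" if "\<xi> \<in> K" for \<xi>
    using that nu_bound by (auto simp: K_def divide_simps)
  have "K \<noteq> {}" using A by (auto simp: K_def)
  from asplund_small_slice[OF asp this K1 e(1)] obtain y d \<alpha> where
    \<alpha>: "\<exists>\<xi>\<in>K. \<alpha> < blinfun_apply \<xi> y" and slice: "\<And>\<xi>. \<xi> \<in> K \<Longrightarrow> \<alpha> \<le> blinfun_apply \<xi> y \<Longrightarrow> norm (\<xi> - d) \<le> e"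
    by blast
  then obtain C where C: "C \<in> sets m" "C \<subseteq> A" "0 < measure m C" and C\<alpha>: "\<alpha> < blinfun_apply (nu C /\<^sub>R measure m C) y"
    by (auto simp: K_def)
  then have nuC: "\<alpha> * measure m C < blinfun_apply (nu C) y"
    by (simp add: blinfun.scaleR_left field_simps)
  \<comment> \<open>Adding a multiple of \<open>m\<close> makes the scalar charge nonnegative, at the price of shifting its density.\<close>
  define lam where "lam C = blinfun_apply (nu C) y + norm y * measure m C" for C
  have nu_y: "\<bar>blinfun_apply (nu C) y\<bar> \<le> norm y * measure m C" if "C \<in> sets m" for C
    using norm_blinfun[of "nu C" y] mult_right_mono[OF nu_bound[OF that] norm_ge_zero[of y]] by (simp add: mult.commute)
  have lam_le: "lam C \<le> 2 * norm y * measure m C" if "C \<in> sets m" for C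
    using nu_y[OF that] by (simp add: lam_def abs_le_iff)
  interpret lam: charge m lam
  proof
    show "0 \<le> lam A" if "A \<in> sets m" for A using nu_y[OF that] by (simp add: lam_def abs_le_iff)
    then show "lam A = 0" if "A \<in> null_sets m" for A
      using that lam_le[of A] by (force simp: null_sets_def measure_def)
    show "lam (A \<union> B) = lam A + lam B" if "A \<in> sets m" "B \<in> sets m" "A \<inter> B = {}" for A B
      using that by (simp add: lam_def nu_add finite_measure_Union blinfun.add_left algebra_simps)
  qed
  have cont: "(\<lambda>i. lam (F i)) \<longlonglongrightarrow> 0"
    if F: "range F \<subseteq> sets m" "decseq F" "(\<Inter>i. F i) = {}" for F
  proof (rule tendsto_sandwich[OF _ _ tendsto_const])
    have "(\<lambda>i. measure m (F i)) \<longlonglongrightarrow> measure m (\<Inter>i. F i)"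
      using F by (intro finite_Lim_measure_decseq) auto
    then show "(\<lambda>i. 2 * norm y * measure m (F i)) \<longlonglongrightarrow> 0"
      using F(3) tendsto_mult_right_zero by force
  qed (use F lam_le lam.nonneg in \<open>auto intro!: always_eventually\<close>)
  obtain \<phi> where \<phi>[measurable]: "\<phi> \<in> borel_measurable m" and \<phi>i: "integrable m \<phi>"
    and \<phi>: "\<And>A. A \<in> sets m \<Longrightarrow> lam A = (\<integral>t. indicator A t * \<phi> t \<partial>m)"
    using lam.density_if_continuous[OF cont] by blast
  define c where "c = \<alpha> + norm y"
  define B where "B = {t \<in> C. c \<le> \<phi> t}"
  have B_eq: "B = C \<inter> {t \<in> space m. c \<le> \<phi> t}"
    using sets.sets_into_space[OF C(1)] by (auto simp: B_def)
  have B[measurable]: "B \<in> sets m" unfolding B_eq using C(1) by measurable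
  have int: "integrable m (\<lambda>t. indicator E t * \<phi> t)" if "E \<in> sets m" for E
    using integrable_mult_indicator[OF that \<phi>i] by simp
  have intc: "integrable m (\<lambda>t. indicator E t * c)" "(\<integral>t. indicator E t * c \<partial>m) = c * measure m E" if "E \<in> sets m" for E
    using that by (auto simp: mult.commute intro!: integrable_mult_left integrable_real_indicator simp: less_top[symmetric])
  have mB: "0 < measure m B"
  proof (rule ccontr)
    assume "\<not> 0 < measure m B"
    then have "emeasure m B = 0" by (simp add: emeasure_eq_measure zero_less_measure_iff)
    then have "AE t in m. t \<notin> B" using B by (intro AE_not_in) (auto simp: null_sets_def)
    then have "lam C \<le> (\<integral>t. indicator C t * c \<partial>m)"
      unfolding \<phi>[OF C(1)] using C(1)
      by (intro integral_mono_AE int intc) (auto elim!: eventually_mono simp: B_def split: split_indicator)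
    then show False using nuC intc(2)[OF C(1)] by (simp add: lam_def c_def algebra_simps)
  qed
  have key: "\<alpha> * measure m E \<le> blinfun_apply (nu E) y" if E: "E \<in> sets m" "E \<subseteq> B" for E
  proof -
    have "(\<integral>t. indicator E t * c \<partial>m) \<le> lam E"
      unfolding \<phi>[OF E(1)] using E
      by (intro integral_mono int intc) (auto simp: B_def split: split_indicator)
    then show ?thesis using intc(2)[OF E(1)] by (simp add: lam_def c_def algebra_simps)
  qed
  have near: "norm (nu E - measure m E *\<^sub>R d) \<le> e * measure m E" if E: "E \<in> sets m" "E \<subseteq> B" for E
  proof (cases "measure m E = 0")
    case True
    then show ?thesis using nu_bound[OF E(1)] by simp
  next
    case False
    then have pos: "0 < measure m E" by (simp add: zero_less_measure_iff)
    have "E \<subseteq> A" using E C by (auto simp: B_def)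
    then have "nu E /\<^sub>R measure m E \<in> K" using E pos by (auto simp: K_def)
    moreover have "\<alpha> \<le> blinfun_apply (nu E /\<^sub>R measure m E) y"
      using key[OF E] pos by (simp add: blinfun.scaleR_left field_simps)
    ultimately have "norm (nu E /\<^sub>R measure m E - d) \<le> e" by (rule slice)
    moreover have "nu E - measure m E *\<^sub>R d = measure m E *\<^sub>R (nu E /\<^sub>R measure m E - d)"
      using pos by (simp add: scaleR_diff_right)
    ultimately show ?thesis using pos by (simp add: mult.commute)
  qed
  have "norm d \<le> 2"
  proof -
    have "norm (measure m B *\<^sub>R d) \<le> norm (nu B) + norm (nu B - measure m B *\<^sub>R d)"
      using norm_triangle_ineq4[of "nu B" "nu B - measure m B *\<^sub>R d"] by simp
    also have "\<dots> \<le> measure m B + e * measure m B" using nu_bound[OF B] near[OF B] by simp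
    also have "\<dots> \<le> 2 * measure m B" using e mB by simp
    finally show ?thesis using mB by simp
  qed
  with near have "near_constant e d B" by (simp add: near_constant_def)
  moreover have "B \<subseteq> A" using C by (auto simp: B_def)
  ultimately show ?thesis using B mB by blast
qed

lemma near_constant_overlap:
  assumes "near_constant e \<xi> A" "near_constant e' \<xi>' B" "A \<in> sets m" "B \<in> sets m"
  shows "AE t in m. t \<in> A \<inter> B \<longrightarrow> norm (\<xi> - \<xi>') \<le> e + e'"
proof (cases "measure m (A \<inter> B) = 0")
  case True
  then have "A \<inter> B \<in> null_sets m" using assms by (auto simp: null_sets_def emeasure_eq_measure)
  then have "AE t in m. t \<notin> A \<inter> B" by (rule AE_not_in)
  then show ?thesis by (rule eventually_mono) blast
next
  case False
  define c where "c = measure m (A \<inter> B)"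
  have c: "0 < c" using False by (simp add: c_def zero_less_measure_iff)
  have "norm (nu (A \<inter> B) - c *\<^sub>R \<xi>) \<le> e * c" "norm (nu (A \<inter> B) - c *\<^sub>R \<xi>') \<le> e' * c"
    using assms by (auto simp: near_constant_def c_def)
  then have "norm (c *\<^sub>R (\<xi> - \<xi>')) \<le> e * c + e' * c"
    using norm_triangle_ineq4[of "nu (A \<inter> B) - c *\<^sub>R \<xi>'" "nu (A \<inter> B) - c *\<^sub>R \<xi>"]
    by (simp add: scaleR_diff_right algebra_simps)
  moreover have "norm (c *\<^sub>R (\<xi> - \<xi>')) = c * norm (\<xi> - \<xi>')" using c by simp
  ultimately have "c * norm (\<xi> - \<xi>') \<le> c * (e + e')" by (simp add: algebra_simps)
  then have "norm (\<xi> - \<xi>') \<le> e + e'" using c by simp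
  then show ?thesis by simp
qed

lemma sum_pieces:
  fixes D :: "nat \<Rightarrow> 't set"
  assumes "\<And>i. D i \<in> sets m" "disjoint_family D" "A \<in> sets m"
  shows "nu A = (\<Sum>i<K. nu (A \<inter> D i)) + nu (A - (\<Union>i<K. D i))"
    and "measure m A = (\<Sum>i<K. measure m (A \<inter> D i)) + measure m (A - (\<Union>i<K. D i))"
proof -
  have *: "A - (\<Union>i<K. D i) = (A \<inter> D K) \<union> (A - (\<Union>i<Suc K. D i))" for K
  proof -
    define X where "X = (\<Union>i<K. D i)"
    have "D i \<inter> D K = {}" if "i < K" for i
      using assms(2) that by (auto simp: disjoint_family_on_def)
    then have "X \<inter> D K = {}" unfolding X_def by blast
    moreover have "(\<Union>i<Suc K. D i) = D K \<union> X" by (simp add: X_def lessThan_Suc)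
    ultimately show ?thesis unfolding X_def[symmetric] by auto
  qed
  have s: "A - (\<Union>i<K. D i) \<in> sets m" "A \<inter> D K \<in> sets m" for K using assms by auto
  show "nu A = (\<Sum>i<K. nu (A \<inter> D i)) + nu (A - (\<Union>i<K. D i))"
  proof (induction K)
    case (Suc K)
    have "nu (A - (\<Union>i<K. D i)) = nu (A \<inter> D K) + nu (A - (\<Union>i<Suc K. D i))"
      by (subst *, intro nu_add s) (auto simp: lessThan_Suc)
    then show ?case using Suc by (simp add: add.assoc)
  qed simp
  show "measure m A = (\<Sum>i<K. measure m (A \<inter> D i)) + measure m (A - (\<Union>i<K. D i))"
  proof (induction K)
    case (Suc K)
    have "measure m (A - (\<Union>i<K. D i)) = measure m (A \<inter> D K) + measure m (A - (\<Union>i<Suc K. D i))"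
      by (subst *, intro finite_measure_Union s) (auto simp: lessThan_Suc)
    then show ?case using Suc by (simp add: add.assoc)
  qed simp
qed

text \<open>
  For each \<open>n\<close> all but \<open>2\<^sup>-\<^sup>n\<close> of the measure is covered by finitely many disjoint sets on which the averages
  are constant up to \<open>2\<^sup>-\<^sup>n\<close>; let \<open>s n\<close> be the step function with these constants as values.  Pieces of
  different step functions with nonnull intersection share an average, which makes the sequence Cauchy
  almost everywhere.  The density is its limit; setting the step functions to zero on the exceptional null
  set lets them converge everywhere.
\<close>

theorem Radon_Nikodym_asplund:
  assumes asp: "asplund_space TYPE('a)"
  shows "\<exists>s h. (\<forall>n. simple_function m (s n)) \<and> (\<forall>n t. norm (s n t) \<le> 2) \<and>
    (\<forall>t\<in>space m. (\<lambda>n. s n t) \<longlonglongrightarrow> h t) \<and>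
    (\<forall>A\<in>sets m. \<forall>y. blinfun_apply (nu A) y = (\<integral>t. indicator A t * blinfun_apply (h t) y \<partial>m))"
proof -
  define e :: "nat \<Rightarrow> real" where "e n = (1/2)^n" for n
  have e: "0 < e n" "e n \<le> 1" for n by (auto simp: e_def power_le_one)
  have e0: "e \<longlonglongrightarrow> 0" unfolding e_def by (rule LIMSEQ_realpow_zero) auto
  define Q where "Q n D k \<longleftrightarrow> disjoint_family D \<and> (\<forall>i. D i \<in> sets m \<and> (\<exists>\<xi>. near_constant (e n) \<xi> (D i))) \<and>
      measure m (space m - (\<Union>i<k. D i)) < e n" for n and D :: "nat \<Rightarrow> 't set" and k :: nat
  have "\<exists>D k. Q n D k" for n
    unfolding Q_def
  proof (rule hereditary_exhaustion)
    show "\<exists>\<xi>. near_constant (e n) \<xi> {}"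
      using nu_bound[of "{}"] by (auto intro!: exI[of _ 0] simp: near_constant_def)
    show "\<exists>B\<in>sets m. B \<subseteq> A \<and> (\<exists>\<xi>. near_constant (e n) \<xi> B) \<and> 0 < measure m B"
      if "A \<in> sets m" "0 < measure m A" for A
      by (rule near_constant_exists[OF asp e that])
  qed (use e near_constant_subset in blast)+
  then obtain D where "\<forall>n. \<exists>k. Q n (D n) k" using choice[of "\<lambda>n D. \<exists>k. Q n D k"] by blast
  then obtain K where Q: "\<And>n. Q n (D n) (K n)" by metis
  have disj: "disjoint_family (D n)" and D[measurable]: "D n i \<in> sets m"
    and ex: "\<exists>\<xi>. near_constant (e n) \<xi> (D n i)"
    and rest: "measure m (space m - (\<Union>i<K n. D n i)) < e n" for n i
    using Q[of n] by (auto simp: Q_def)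
  from ex obtain \<xi> where near: "\<And>n i. near_constant (e n) (\<xi> n i) (D n i)" by metis
  have \<xi>2: "norm (\<xi> n i) \<le> 2" for n i using near by (auto simp: near_constant_def)
  define U where "U n = (\<Union>i<K n. D n i)" for n
  have U[measurable]: "U n \<in> sets m" for n unfolding U_def by (intro sets.finite_UN) auto
  define s where "s n t = (\<Sum>i<K n. indicator (D n i) t *\<^sub>R \<xi> n i)" for n t
  have s_in: "s n t = \<xi> n i" if "i < K n" "t \<in> D n i" for n i t
  proof -
    have "t \<notin> D n j" if "j \<noteq> i" for j
      using disj[of n] that \<open>t \<in> D n i\<close> by (auto simp: disjoint_family_on_def)
    then have "s n t = (\<Sum>j<K n. if j = i then \<xi> n i else 0)"
      unfolding s_def using that by (intro sum.cong) (auto split: split_indicator)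
    then show ?thesis using that by simp
  qed
  have s_out: "s n t = 0" if "t \<notin> U n" for n t
    unfolding s_def using that by (intro sum.neutral) (auto simp: U_def split: split_indicator)
  have s2: "norm (s n t) \<le> 2" for n t
  proof (cases "t \<in> U n")
    case True
    then show ?thesis using s_in \<xi>2 by (auto simp: U_def)
  qed (simp add: s_out)
  have s_simple: "simple_function m (s n)" for n
    unfolding s_def by (intro simple_function_sum simple_function_compose1[where g = "\<lambda>c. c *\<^sub>R _"] simple_function_indicator D)
  have overlap: "AE t in m. \<forall>n i n' i'. t \<in> D n i \<inter> D n' i' \<longrightarrow> norm (\<xi> n i - \<xi> n' i') \<le> e n + e n'"
    unfolding AE_all_countable using near_constant_overlap[OF near near D D] by blast
  have "AE t in m. eventually (\<lambda>n. t \<in> space m - (space m - U n)) sequentially"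
  proof (rule borel_cantelli_AE1)
    show "summable (\<lambda>n. measure m (space m - U n))"
    proof (rule summable_comparison_test'[of e 0])
      show "summable e" unfolding e_def by (rule summable_geometric) simp
      show "norm (measure m (space m - U n)) \<le> e n" for n
        using rest[of n] by (simp add: U_def less_imp_le)
    qed
  qed (auto simp: emeasure_eq_measure)
  with overlap have "AE t in m. convergent (\<lambda>n. s n t)"
  proof eventually_elim
    case (elim t)
    from elim(2) obtain n0 where "\<forall>n\<ge>n0. t \<in> space m - (space m - U n)"
      unfolding eventually_sequentially by blast
    then have n0: "t \<in> U n" if "n \<ge> n0" for n using that by blast
    have *: "norm (s n t - s n' t) \<le> e n + e n'" if "n \<ge> n0" "n' \<ge> n0" for n n'
    proof -
      have "t \<in> U n" "t \<in> U n'" using n0 that by auto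
      then obtain i i' where i: "i < K n" "t \<in> D n i" "i' < K n'" "t \<in> D n' i'"
        by (auto simp: U_def)
      then show ?thesis using elim(1) by (simp add: s_in)
    qed
    have "Cauchy (\<lambda>n. s n t)"
    proof (rule CauchyI)
      fix d :: real assume "0 < d"
      then have "eventually (\<lambda>n. e n < d/2) sequentially" by (intro order_tendstoD(2)[OF e0]) simp
      then obtain n1 where n1: "\<And>n. n \<ge> n1 \<Longrightarrow> e n < d/2" by (auto simp: eventually_sequentially)
      show "\<exists>M. \<forall>p\<ge>M. \<forall>n\<ge>M. norm (s p t - s n t) < d"
      proof (intro exI[of _ "max n0 n1"] allI impI)
        fix p n assume "max n0 n1 \<le> p" "max n0 n1 \<le> n"
        then show "norm (s p t - s n t) < d" using *[of p n] n1[of p] n1[of n] by simp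
      qed
    qed
    then show ?case by (rule Cauchy_convergent)
  qed
  then obtain N where N: "N \<in> null_sets m" and conv: "\<And>t. t \<in> space m - N \<Longrightarrow> convergent (\<lambda>n. s n t)"
    by (auto elim!: AE_E simp: null_sets_def)
  define s' where "s' n t = indicator (space m - N) t *\<^sub>R s n t" for n t
  define h where "h t = lim (\<lambda>n. s' n t)" for t
  have s'2: "norm (s' n t) \<le> 2" for n t using s2 by (auto simp: s'_def split: split_indicator)
  have s'_simple: "simple_function m (s' n)" for n
    unfolding s'_def using N s_simple by (intro simple_function_compose2[where h = "(*\<^sub>R)"] simple_function_indicator) auto
  have h: "(\<lambda>n. s' n t) \<longlonglongrightarrow> h t" if "t \<in> space m" for t
  proof -
    have "convergent (\<lambda>n. s' n t)"
      using conv[of t] that by (cases "t \<in> N") (auto simp: s'_def convergent_const)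
    then show ?thesis by (simp add: h_def convergent_LIMSEQ_iff)
  qed
  have app_meas[measurable]: "(\<lambda>t. blinfun_apply (s' n t) y) \<in> borel_measurable m" for n y
    by (intro borel_measurable_simple_function simple_function_compose1[OF s'_simple])
  have "blinfun_apply (nu A) y = (\<integral>t. indicator A t * blinfun_apply (h t) y \<partial>m)" if A[measurable]: "A \<in> sets m" for A y
  proof (rule LIMSEQ_unique)
    have app_le: "\<bar>indicator A t * blinfun_apply (s' n t) y\<bar> \<le> 2 * norm y" for n t
      using norm_blinfun[of "s' n t" y] mult_right_mono[OF s'2[of n t] norm_ge_zero, of y]
      by (auto split: split_indicator)
    show "(\<lambda>n. \<integral>t. indicator A t * blinfun_apply (s' n t) y \<partial>m) \<longlonglongrightarrow> (\<integral>t. indicator A t * blinfun_apply (h t) y \<partial>m)"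
    proof (rule integral_dominated_convergence[where w = "\<lambda>_. 2 * norm y"])
      show lim: "AE t in m. (\<lambda>n. indicator A t * blinfun_apply (s' n t) y) \<longlonglongrightarrow> indicator A t * blinfun_apply (h t) y"
        using h by (intro AE_I2 tendsto_intros)
      show "(\<lambda>t. indicator A t * blinfun_apply (h t) y) \<in> borel_measurable m"
        by (rule borel_measurable_LIMSEQ_real[where u = "\<lambda>n t. indicator A t * blinfun_apply (s' n t) y"])
          (auto intro!: tendsto_intros h)
    qed (use app_le in auto)
    have eq: "(\<integral>t. indicator A t * blinfun_apply (s' n t) y \<partial>m) = (\<Sum>i<K n. measure m (A \<inter> D n i) * blinfun_apply (\<xi> n i) y)" for n
    proof -
      have "(\<integral>t. indicator A t * blinfun_apply (s' n t) y \<partial>m)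
        = (\<integral>t. (\<Sum>i<K n. indicator (A \<inter> D n i) t * blinfun_apply (\<xi> n i) y) \<partial>m)"
      proof (rule integral_cong_AE)
        show "AE t in m. indicator A t * blinfun_apply (s' n t) y = (\<Sum>i<K n. indicator (A \<inter> D n i) t * blinfun_apply (\<xi> n i) y)"
          using AE_not_in[OF N] AE_space
        proof eventually_elim
          case (elim t)
          then have "blinfun_apply (s' n t) y = (\<Sum>i<K n. indicator (D n i) t * blinfun_apply (\<xi> n i) y)"
            by (simp add: s'_def s_def blinfun.sum_left blinfun.scaleR_left)
          then show ?case
            by (simp only: sum_distrib_left indicator_inter_arith mult.assoc)
        qed
      qed measurable
      also have "\<dots> = (\<Sum>i<K n. \<integral>t. indicator (A \<inter> D n i) t * blinfun_apply (\<xi> n i) y \<partial>m)"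
        by (intro Bochner_Integration.integral_sum) (auto simp: emeasure_eq_measure)
      also have "\<dots> = (\<Sum>i<K n. measure m (A \<inter> D n i) * blinfun_apply (\<xi> n i) y)"
        by (intro sum.cong) (auto simp: Int_absorb1 sets.sets_into_space)
      finally show ?thesis .
    qed
    \<comment> \<open>The step function misses \<open>nu A\<close> by at most \<open>e n\<close> times the measure on the pieces, and by the
      measure of the uncovered rest.\<close>
    have "norm ((\<Sum>i<K n. measure m (A \<inter> D n i) * blinfun_apply (\<xi> n i) y) - blinfun_apply (nu A) y)
      \<le> (e n * measure m (space m) + e n) * norm y" for n
    proof -
      have "norm ((\<Sum>i<K n. measure m (A \<inter> D n i) *\<^sub>R \<xi> n i) - nu A)
        = norm ((\<Sum>i<K n. nu (A \<inter> D n i) - measure m (A \<inter> D n i) *\<^sub>R \<xi> n i) + nu (A - U n))"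
        unfolding sum_pieces(1)[OF D disj A, of n "K n"] U_def sum_subtractf
        by (subst norm_minus_commute) (simp add: algebra_simps)
      also have "\<dots> \<le> (\<Sum>i<K n. norm (nu (A \<inter> D n i) - measure m (A \<inter> D n i) *\<^sub>R \<xi> n i)) + norm (nu (A - U n))"
        by (intro norm_triangle_le add_right_mono norm_sum)
      also have "\<dots> \<le> (\<Sum>i<K n. e n * measure m (A \<inter> D n i)) + measure m (space m - U n)"
      proof (intro add_mono sum_mono)
        show "norm (nu (A \<inter> D n i) - measure m (A \<inter> D n i) *\<^sub>R \<xi> n i) \<le> e n * measure m (A \<inter> D n i)" for i
          using near[of n i] by (auto simp: near_constant_def)
        have "norm (nu (A - U n)) \<le> measure m (A - U n)" by (intro nu_bound) auto
        also have "\<dots> \<le> measure m (space m - U n)"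
          using sets.sets_into_space[OF A] by (intro finite_measure_mono) auto
        finally show "norm (nu (A - U n)) \<le> measure m (space m - U n)" .
      qed
      also have "\<dots> \<le> e n * measure m (space m) + e n"
      proof (intro add_mono)
        have "(\<Sum>i<K n. measure m (A \<inter> D n i)) \<le> measure m A"
          using sum_pieces(2)[OF D disj A, of n "K n"] by simp
        also have "\<dots> \<le> measure m (space m)" by (rule bounded_measure)
        finally show "(\<Sum>i<K n. e n * measure m (A \<inter> D n i)) \<le> e n * measure m (space m)"
          using e(1)[of n] by (simp add: sum_distrib_left[symmetric])
        show "measure m (space m - U n) \<le> e n" using rest[of n] by (simp add: U_def)
      qed
      finally have "norm ((\<Sum>i<K n. measure m (A \<inter> D n i) *\<^sub>R \<xi> n i) - nu A) * norm y \<le> (e n * measure m (space m) + e n) * norm y"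
        by (rule mult_right_mono) simp
      moreover have "(\<Sum>i<K n. measure m (A \<inter> D n i) * blinfun_apply (\<xi> n i) y) - blinfun_apply (nu A) y
        = blinfun_apply ((\<Sum>i<K n. measure m (A \<inter> D n i) *\<^sub>R \<xi> n i) - nu A) y"
        by (simp add: blinfun.diff_left blinfun.sum_left blinfun.scaleR_left)
      ultimately show ?thesis
        by (simp only: order.trans[OF norm_blinfun])
    qed
    then have "eventually (\<lambda>n. norm ((\<Sum>i<K n. measure m (A \<inter> D n i) * blinfun_apply (\<xi> n i) y) - blinfun_apply (nu A) y)
      \<le> (e n * measure m (space m) + e n) * norm y) sequentially"
      by (rule always_eventually[OF allI])
    moreover have "(\<lambda>n. (e n * measure m (space m) + e n) * norm y) \<longlonglongrightarrow> 0"
      by (auto intro!: tendsto_eq_intros e0)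
    ultimately show "(\<lambda>n. \<integral>t. indicator A t * blinfun_apply (s' n t) y \<partial>m) \<longlonglongrightarrow> blinfun_apply (nu A) y"
      unfolding eq by (rule LIM_zero_cancel[OF Lim_null_comparison])
  qed
  then show ?thesis using s'_simple s'2 h by (intro exI[of _ s'] exI[of _ h]) blast
qed

end

section \<open>Functionals on bounded vector-valued functions\<close>

definition cut :: "'t set \<Rightarrow> ('t \<Rightarrow> 'a::real_vector) \<Rightarrow> 't \<Rightarrow> 'a" where
  "cut A w t = (if t \<in> A then w t else 0)"

lemma bounded_rangeI: "(\<And>t. norm (w t) \<le> r) \<Longrightarrow> bounded (range w)"
  by (auto simp: bounded_iff)

lemma bounded_cut:
  fixes w :: "'t \<Rightarrow> 'a::real_normed_vector"
  assumes "bounded (range w)"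
  shows "bounded (range (cut A w))"
proof (rule bounded_subset)
  show "bounded (insert 0 (range w))" using assms by simp
qed (auto simp: cut_def)

text \<open>
  The functionals on \<^emph>\<open>all\<close> bounded functions, measurable or not, that are bounded for the
  supremum norm and depend only on the class modulo null functions.
\<close>

locale bounded_functional = sigma_finite_measure M for M :: "'t measure" +
  fixes L :: "('t \<Rightarrow> 'a::banach) \<Rightarrow> real" and C :: real
  assumes L_add: "bounded (range w) \<Longrightarrow> bounded (range w') \<Longrightarrow> L (\<lambda>t. w t + w' t) = L w + L w'"
    and L_scale: "bounded (range w) \<Longrightarrow> L (\<lambda>t. c *\<^sub>R w t) = c * L w"
    and L_bound: "(\<And>t. norm (w t) \<le> r) \<Longrightarrow> L w \<le> C * r"
    and L_null: "bounded (range w) \<Longrightarrow> AE t in M. w t = 0 \<Longrightarrow> L w = 0"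
begin

text \<open>
  The total variation of the vector charge \<open>A \<mapsto> L (1\<^sub>A \<cdot>)\<close>, with a supremum over all functions supported in
  \<open>A\<close> in place of the step functions.
\<close>

definition lam :: "'t set \<Rightarrow> real" where
  "lam A = Sup {L w | w. (\<forall>t. norm (w t) \<le> 1) \<and> (\<forall>t. t \<notin> A \<longrightarrow> w t = 0)}"

lemma lam_bdd: "bdd_above {L w | w. (\<forall>t. norm (w t) \<le> 1) \<and> (\<forall>t. t \<notin> A \<longrightarrow> w t = 0)}"
  using L_bound[of _ 1] by (auto simp: bdd_above_def)

lemma L_le_lam: "(\<And>t. norm (w t) \<le> 1) \<Longrightarrow> (\<And>t. t \<notin> A \<Longrightarrow> w t = 0) \<Longrightarrow> L w \<le> lam A"
  unfolding lam_def by (rule cSup_upper[OF _ lam_bdd]) auto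

lemma lam_le: "(\<And>w. (\<And>t. norm (w t) \<le> 1) \<Longrightarrow> (\<And>t. t \<notin> A \<Longrightarrow> w t = 0) \<Longrightarrow> L w \<le> b) \<Longrightarrow> lam A \<le> b"
  unfolding lam_def by (rule cSup_least) (auto intro!: exI[of _ "\<lambda>_. 0"])

lemma L_zero: "L (\<lambda>t. 0) = 0"
  using L_null[of "\<lambda>t. 0"] by simp

lemma abs_L_le_lam:
  assumes w: "\<And>t. norm (w t) \<le> r" and supp: "\<And>t. t \<notin> A \<Longrightarrow> w t = 0"
  shows "\<bar>L w\<bar> \<le> r * lam A"
proof -
  have bdd: "bounded (range w)" by (rule bounded_rangeI[OF w])
  have r: "0 \<le> r" using order.trans[OF norm_ge_zero w] .
  show ?thesis
  proof (cases "r = 0")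
    case True
    then have "w = (\<lambda>t. 0)" using w by auto
    then show ?thesis using L_zero True by simp
  next
    case False
    then have "0 < r" using r by simp
    have *: "L (\<lambda>t. c *\<^sub>R w t) \<le> lam A" if "\<bar>c\<bar> = 1 / r" for c
      by (rule L_le_lam) (use that w \<open>0 < r\<close> in \<open>auto simp: supp divide_le_eq\<close>)
    have "L w / r \<le> lam A" "- L w / r \<le> lam A"
      using *[of "1/r", unfolded L_scale[OF bdd]] *[of "-1/r", unfolded L_scale[OF bdd]] \<open>0 < r\<close> by auto
    then show ?thesis using \<open>0 < r\<close> by (simp add: field_simps abs_le_iff)
  qed
qed

text \<open>
  A function on a disjoint union is the sum of its two restrictions, and conversely functions of norm at most
  one with disjoint supports add up to such a function.
\<close>

lemma charge_lam: "charge M lam"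
proof
  show "0 \<le> lam A" for A
    using L_le_lam[of "\<lambda>_. 0" A] by (simp add: L_zero)
  show "lam (A \<union> B) = lam A + lam B" if AB: "A \<inter> B = {}" for A B
  proof (rule antisym)
    show "lam (A \<union> B) \<le> lam A + lam B"
    proof (rule lam_le)
      fix w :: "'t \<Rightarrow> 'a" assume w: "\<And>t. norm (w t) \<le> 1" "\<And>t. t \<notin> A \<union> B \<Longrightarrow> w t = 0"
      have bdd: "bounded (range w)" by (rule bounded_rangeI[OF w(1)])
      have "w = (\<lambda>t. cut A w t + cut B w t)"
        using w(2) AB by (auto simp: cut_def fun_eq_iff)
      then have "L w = L (cut A w) + L (cut B w)"
        using L_add[OF bounded_cut[OF bdd] bounded_cut[OF bdd], of A B] by simp
      moreover have "L (cut A w) \<le> lam A" "L (cut B w) \<le> lam B"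
        using w(1) by (auto intro!: L_le_lam simp: cut_def)
      ultimately show "L w \<le> lam A + lam B" by simp
    qed
    have *: "L w + L w' \<le> lam (A \<union> B)"
      if "\<And>t. norm (w t) \<le> 1" "\<And>t. t \<notin> A \<Longrightarrow> w t = 0" "\<And>t. norm (w' t) \<le> 1" "\<And>t. t \<notin> B \<Longrightarrow> w' t = 0" for w w'
    proof -
      have "norm (w t + w' t) \<le> 1" for t
      proof -
        have "t \<notin> A \<or> t \<notin> B" using AB by blast
        then show ?thesis using that(1)[of t] that(3)[of t] that(2,4)[of t] by auto
      qed
      then have "L (\<lambda>t. w t + w' t) \<le> lam (A \<union> B)" using that by (intro L_le_lam) auto
      then show ?thesis
        using L_add[OF bounded_rangeI[OF that(1)] bounded_rangeI[OF that(3)]] by simp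
    qed
    have "L w \<le> lam (A \<union> B) - lam B" if w: "\<And>t. norm (w t) \<le> 1" "\<And>t. t \<notin> A \<Longrightarrow> w t = 0" for w
    proof -
      have "lam B \<le> lam (A \<union> B) - L w"
        by (rule lam_le) (use *[OF w] in \<open>force simp: algebra_simps\<close>)
      then show ?thesis by simp
    qed
    then have "lam A \<le> lam (A \<union> B) - lam B" by (rule lam_le)
    then show "lam A + lam B \<le> lam (A \<union> B)" by simp
  qed
  show "lam A = 0" if "A \<in> null_sets M" for A
  proof (rule antisym)
    show "lam A \<le> 0"
    proof (rule lam_le)
      fix w :: "'t \<Rightarrow> 'a" assume w: "\<And>t. norm (w t) \<le> 1" "\<And>t. t \<notin> A \<Longrightarrow> w t = 0"
      have "AE t in M. w t = 0" using AE_not_in[OF that] by eventually_elim (rule w(2))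
      then show "L w \<le> 0" using L_null[OF bounded_rangeI[OF w(1)]] by simp
    qed
    show "0 \<le> lam A" using L_le_lam[of "\<lambda>_. 0" A] by (simp add: L_zero)
  qed
qed

text \<open>
  The total variation has a density \<open>g\<close> on the sets \<open>G N\<close>.  The vector charge on \<open>G N\<close> is dominated by the
  measure with density \<open>g\<close> and extends to all measurable \<open>A\<close> as the limit of its values on \<open>A \<inter> G N\<close>, so the
  Radon-Nikodym theorem for Asplund spaces applies with that measure; multiplication by \<open>g\<close> turns its
  bounded density into an integrable one with respect to \<open>M\<close>.
\<close>

theorem absolutely_continuous_part:
  assumes asp: "asplund_space TYPE('a)"
  shows "\<exists>(G :: nat \<Rightarrow> 't set) g s H. range G \<subseteq> sets M \<and> incseq G \<and> (AE t in M. t \<in> (\<Union>n. G n)) \<and>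
    integrable M g \<and> (\<forall>t. 0 \<le> g t) \<and>
    (\<forall>n. simple_function M (s n)) \<and> (\<forall>t\<in>space M. (\<lambda>n. s n t) \<longlonglongrightarrow> H t) \<and>
    (\<forall>t\<in>space M. norm (H t) \<le> 2 * g t) \<and>
    (\<forall>N. \<forall>A\<in>sets M. A \<subseteq> G N \<longrightarrow>
      (\<forall>y. L (cut A (\<lambda>t. y)) = (\<integral>t. indicator A t * blinfun_apply (H t) y \<partial>M)) \<and>
      (\<forall>w r. (\<forall>t. norm (w t) \<le> r) \<longrightarrow> (\<forall>t. t \<notin> A \<longrightarrow> w t = 0) \<longrightarrow> \<bar>L w\<bar> \<le> r * (\<integral>t. indicator A t * g t \<partial>M)))"
proof -
  interpret lam: charge M lam by (rule charge_lam)
  from lam.Yosida_Hewitt_density obtain G g where YH: "range G \<subseteq> sets M" "incseq G" "AE t in M. t \<in> (\<Union>n. G n)"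
    "g \<in> borel_measurable M" "\<forall>t. 0 \<le> g t" "integrable M g"
    "\<forall>N. \<forall>A\<in>sets M. A \<subseteq> G N \<longrightarrow> lam A = (\<integral>t. indicator A t * g t \<partial>M)"
    by (elim exE conjE)
  note G_inc = YH(2) and aeG = YH(3) and gi = YH(6) and [measurable] = YH(4)
  have g0: "0 \<le> g t" for t using YH(5) by simp
  have G[measurable]: "G n \<in> sets M" for n using YH(1) by auto
  have lam_g: "lam A = (\<integral>t. indicator A t * g t \<partial>M)" if "A \<in> sets M" "A \<subseteq> G N" for N A
    using YH(7) that by blast
  define m where "m = density M g"
  have sets_m[simp]: "sets m = sets M" and space_m[simp]: "space m = space M" by (auto simp: m_def)
  have em: "emeasure m A = ennreal (\<integral>t. indicator A t * g t \<partial>M)" if A: "A \<in> sets M" for A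
  proof -
    have "emeasure m A = (\<integral>\<^sup>+t. ennreal (indicator A t * g t) \<partial>M)"
      unfolding m_def using A by (subst emeasure_density) (auto intro!: nn_integral_cong split: split_indicator)
    also have "\<dots> = ennreal (\<integral>t. indicator A t * g t \<partial>M)"
      using integrable_mult_indicator[OF A gi] g0 by (intro nn_integral_eq_integral) auto
    finally show ?thesis .
  qed
  interpret m: finite_measure m
    by standard (use em[of "space M"] in simp)
  have mm: "measure m A = (\<integral>t. indicator A t * g t \<partial>M)" if A: "A \<in> sets M" for A
    using em[OF A] g0 by (simp add: measure_def)
  have lam_m: "lam A = measure m A" if "A \<in> sets M" "A \<subseteq> G N" for A N
    using lam_g[OF that] mm[OF that(1)] by simp
  have L_cut: "L (cut A (\<lambda>t. y + y')) = L (cut A (\<lambda>t. y)) + L (cut A (\<lambda>t. y'))"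
    "L (cut A (\<lambda>t. c *\<^sub>R y)) = c * L (cut A (\<lambda>t. y))" for A y y' c
  proof -
    have b: "bounded (range (cut A (\<lambda>t. y)))" for y :: 'a by (rule bounded_cut, rule bounded_rangeI, rule order_refl)
    have "cut A (\<lambda>t. y + y') = (\<lambda>t. cut A (\<lambda>t. y) t + cut A (\<lambda>t. y') t)"
      "cut A (\<lambda>t. c *\<^sub>R y) = (\<lambda>t. c *\<^sub>R cut A (\<lambda>t. y) t)" by (auto simp: cut_def)
    then show "L (cut A (\<lambda>t. y + y')) = L (cut A (\<lambda>t. y)) + L (cut A (\<lambda>t. y'))"
      "L (cut A (\<lambda>t. c *\<^sub>R y)) = c * L (cut A (\<lambda>t. y))" using L_add[OF b b] L_scale[OF b] by simp_all
  qed
  have L_cut_le: "\<bar>L (cut A (\<lambda>t. y))\<bar> \<le> norm y * lam A" for A y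
    by (rule abs_L_le_lam) (auto simp: cut_def)
  define V where "V A = Blinfun (\<lambda>y. L (cut A (\<lambda>t. y)))" for A
  have V: "blinfun_apply (V A) y = L (cut A (\<lambda>t. y))" for A y
    unfolding V_def using L_cut L_cut_le
    by (subst bounded_linear_Blinfun_apply) (auto intro!: bounded_linear_intro[where K = "lam A"])
  have V_norm: "norm (V A) \<le> measure m A" if "A \<in> sets M" "A \<subseteq> G N" for A N
    unfolding lam_m[OF that, symmetric]
    by (rule norm_blinfun_bound) (use L_cut_le[of A] that lam.nonneg in \<open>auto simp: V mult.commute\<close>)
  have V_add: "V (A \<union> B) = V A + V B" if "A \<inter> B = {}" for A B
  proof (rule blinfun_eqI)
    fix y :: 'a
    have b: "bounded (range (cut A (\<lambda>t. y)))" for A :: "'t set" by (rule bounded_cut, rule bounded_rangeI, rule order_refl)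
    have "cut (A \<union> B) (\<lambda>t. y) = (\<lambda>t. cut A (\<lambda>t. y) t + cut B (\<lambda>t. y) t)" using that by (auto simp: cut_def fun_eq_iff)
    then show "blinfun_apply (V (A \<union> B)) y = blinfun_apply (V A + V B) y"
      using L_add[OF b b, of A B] by (simp add: V blinfun.add_left)
  qed
  have conv: "convergent (\<lambda>N. V (A \<inter> G N))" if A[measurable]: "A \<in> sets M" for A
  proof -
    define a where "a N = measure m (A \<inter> G N)" for N
    have "a \<longlonglongrightarrow> measure m (\<Union>N. A \<inter> G N)"
      unfolding a_def by (rule m.finite_Lim_measure_incseq) (use G_inc in \<open>auto simp: incseq_def\<close>)
    then have Ca: "Cauchy a" by (rule LIMSEQ_imp_Cauchy)
    have *: "dist (V (A \<inter> G N)) (V (A \<inter> G N')) \<le> dist (a N) (a N')" if "N \<le> N'" for N N'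
    proof -
      have sub: "A \<inter> G N \<subseteq> A \<inter> G N'" using incseqD[OF G_inc that] by auto
      then have un: "A \<inter> G N' = (A \<inter> G N) \<union> (A \<inter> G N' - A \<inter> G N)" by auto
      have "V (A \<inter> G N') = V (A \<inter> G N) + V (A \<inter> G N' - A \<inter> G N)"
        by (subst un, rule V_add) auto
      then have "dist (V (A \<inter> G N)) (V (A \<inter> G N')) = norm (V (A \<inter> G N' - A \<inter> G N))"
        by (simp add: dist_norm)
      also have "\<dots> \<le> measure m (A \<inter> G N' - A \<inter> G N)"
        by (rule V_norm[of _ N']) auto
      also have "\<dots> = a N' - a N" unfolding a_def using sub by (intro m.finite_measure_Diff) auto
      finally show ?thesis by (simp add: dist_real_def)
    qed
    then have **: "dist (V (A \<inter> G N)) (V (A \<inter> G N')) \<le> dist (a N) (a N')" for N N'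
      using *[of N N'] *[of N' N] by (cases "N \<le> N'") (auto simp: dist_commute)
    have "Cauchy (\<lambda>N. V (A \<inter> G N))"
      unfolding Cauchy_def using Ca[unfolded Cauchy_def] by (meson ** order.strict_trans1)
    then show ?thesis by (rule Cauchy_convergent)
  qed
  define nu where "nu A = lim (\<lambda>N. V (A \<inter> G N))" for A
  have nu: "(\<lambda>N. V (A \<inter> G N)) \<longlonglongrightarrow> nu A" if "A \<in> sets M" for A
    using conv[OF that] by (simp add: nu_def convergent_LIMSEQ_iff)
  have nu_V: "nu A = V A" if "A \<in> sets M" "A \<subseteq> G N" for A N
  proof -
    have "eventually (\<lambda>n. V (A \<inter> G n) = V A) sequentially"
    proof (rule eventually_mono[OF eventually_ge_at_top[of N]])
      fix n assume "N \<le> n"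
      then have "A \<inter> G n = A" using incseqD[OF G_inc, of N n] that by auto
      then show "V (A \<inter> G n) = V A" by simp
    qed
    then show ?thesis using LIMSEQ_unique[OF nu[OF that(1)] tendsto_eventually] by blast
  qed
  interpret rn: dominated_vector_charge m nu
  proof
    show "nu (A \<union> B) = nu A + nu B" if "A \<in> sets m" "B \<in> sets m" "A \<inter> B = {}" for A B
    proof (rule LIMSEQ_unique[OF nu])
      have "V ((A \<union> B) \<inter> G N) = V (A \<inter> G N) + V (B \<inter> G N)" for N
        using V_add[of "A \<inter> G N" "B \<inter> G N"] that(3) by (auto simp: Int_Un_distrib2)
      then show "(\<lambda>N. V ((A \<union> B) \<inter> G N)) \<longlonglongrightarrow> nu A + nu B"
        using tendsto_add[OF nu nu, of A B] that by simp
    qed (use that in auto)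
    show "norm (nu A) \<le> measure m A" if "A \<in> sets m" for A
    proof (rule Lim_bounded[OF tendsto_norm[OF nu]])
      show "\<forall>n\<ge>0. norm (V (A \<inter> G n)) \<le> measure m A"
      proof (intro allI impI)
        fix n
        have "norm (V (A \<inter> G n)) \<le> measure m (A \<inter> G n)" using that by (intro V_norm[of _ n]) auto
        also have "\<dots> \<le> measure m A" using that by (intro m.finite_measure_mono) auto
        finally show "norm (V (A \<inter> G n)) \<le> measure m A" .
      qed
    qed (use that in auto)
  qed
  from rn.Radon_Nikodym_asplund[OF asp] obtain s h where RN: "\<forall>n. simple_function m (s n)" "\<forall>n t. norm (s n t) \<le> 2"
    "\<forall>t\<in>space m. (\<lambda>n. s n t) \<longlonglongrightarrow> h t"
    "\<forall>A\<in>sets m. \<forall>y. blinfun_apply (nu A) y = (\<integral>t. indicator A t * blinfun_apply (h t) y \<partial>m)"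
    by (elim exE conjE)
  have s: "simple_function m (s n)" and s2: "norm (s n t) \<le> 2" for n t using RN(1,2) by auto
  have h: "(\<lambda>n. s n t) \<longlonglongrightarrow> h t" if "t \<in> space M" for t using RN(3) that by simp
  have nu_h: "blinfun_apply (nu A) y = (\<integral>t. indicator A t * blinfun_apply (h t) y \<partial>m)" if "A \<in> sets M" for A y
    using RN(4) that by simp
  have sM: "simple_function M (s n)" for n
    using s[of n] by (simp add: simple_function_def)
  obtain gs :: "nat \<Rightarrow> 't \<Rightarrow> real" where gs: "\<And>n. simple_function M (gs n)" "\<And>t. t \<in> space M \<Longrightarrow> (\<lambda>n. gs n t) \<longlonglongrightarrow> g t"
    using borel_measurable_implies_sequence_metric[of g M 0] by auto
  define H where "H t = g t *\<^sub>R h t" for t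
  have h_meas[measurable]: "(\<lambda>t. blinfun_apply (h t) y) \<in> borel_measurable M" for y
    by (rule borel_measurable_LIMSEQ_real[where u = "\<lambda>n t. blinfun_apply (s n t) y"])
      (auto intro!: tendsto_intros h borel_measurable_simple_function simple_function_compose1[OF sM])
  have 1: "simple_function M (\<lambda>t. gs n t *\<^sub>R s n t)" for n
    by (rule simple_function_compose2[OF gs(1) sM])
  have 2: "(\<lambda>n. gs n t *\<^sub>R s n t) \<longlonglongrightarrow> H t" if "t \<in> space M" for t
    unfolding H_def using that by (intro tendsto_scaleR gs h)
  have 3: "norm (H t) \<le> 2 * g t" if "t \<in> space M" for t
  proof -
    have h2: "norm (h t) \<le> 2" by (rule Lim_bounded[OF tendsto_norm[OF h[OF that]]]) (use s2 in auto)
    show ?thesis using mult_left_mono[OF h2 g0[of t]] g0[of t] by (simp add: H_def mult.commute)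
  qed
  have 4: "L (cut A (\<lambda>t. y)) = (\<integral>t. indicator A t * blinfun_apply (H t) y \<partial>M)"
    if A[measurable]: "A \<in> sets M" and "A \<subseteq> G N" for A N y
  proof -
    have "L (cut A (\<lambda>t. y)) = (\<integral>t. indicator A t * blinfun_apply (h t) y \<partial>m)"
      using nu_h[OF A, of y] nu_V[OF that] by (simp add: V)
    also have "\<dots> = (\<integral>t. g t *\<^sub>R (indicator A t * blinfun_apply (h t) y) \<partial>M)"
      unfolding m_def by (rule integral_density) (use g0 in auto)
    finally show ?thesis by (simp add: H_def blinfun.scaleR_left mult.left_commute)
  qed
  have 5: "\<bar>L w\<bar> \<le> r * (\<integral>t. indicator A t * g t \<partial>M)"
    if "A \<in> sets M" "A \<subseteq> G N" "\<forall>t. norm (w t) \<le> r" "\<forall>t. t \<notin> A \<longrightarrow> w t = 0" for A N w r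
    using abs_L_le_lam[of w r A] that lam_g[OF that(1,2)] by simp
  have r: "range G \<subseteq> sets M" using G by auto
  show ?thesis
    by (rule exI[of _ G], rule exI[of _ g], rule exI[of _ "\<lambda>n t. gs n t *\<^sub>R s n t"], rule exI[of _ H])
      (intro conjI ballI allI impI r G_inc aeG gi g0 1 2 3 4 5, (assumption | blast)+)
qed

end

section \<open>Lusin integrands\<close>

lemma (in complete_measure) measurable_AE_eq:
  assumes g: "g \<in> measurable M N" and f: "f \<in> space M \<rightarrow> space N" and ae: "AE t in M. f t = g t"
  shows "f \<in> measurable M N"
proof (rule measurableI)
  fix A assume A: "A \<in> sets N"
  show "f -` A \<inter> space M \<in> sets M"
  proof (rule in_sets_AE)
    show "AE t in M. t \<in> g -` A \<inter> space M \<longleftrightarrow> t \<in> f -` A \<inter> space M"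
      using ae by eventually_elim auto
    show "g -` A \<inter> space M \<in> sets M" using g A by (rule measurable_sets)
  qed auto
qed (use f in auto)

lemma (in complete_measure) continuous_strongly_measurable:
  fixes h :: "'a \<Rightarrow> 'b::real_normed_vector" and \<phi> :: "'b \<Rightarrow> real"
  assumes h: "strongly_measurable M h" and \<phi>: "continuous_on UNIV \<phi>"
  shows "(\<lambda>t. \<phi> (h t)) \<in> borel_measurable M"
proof -
  obtain s where s: "\<And>n. simple_function M (s n)" and lim: "AE t in M. (\<lambda>n. s n t) \<longlonglongrightarrow> h t"
    using h by (auto simp: strongly_measurable_def)
  have m: "(\<lambda>t. \<phi> (s n t)) \<in> borel_measurable M" for n
    by (intro borel_measurable_simple_function simple_function_compose1[OF s])
  show ?thesis
  proof (rule measurable_AE_eq)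
    show "(\<lambda>t. lim (\<lambda>n. \<phi> (s n t))) \<in> borel_measurable M"
      using m by (rule borel_measurable_lim_metric)
    show "AE t in M. \<phi> (h t) = lim (\<lambda>n. \<phi> (s n t))"
      using lim
    proof eventually_elim
      case (elim t)
      have "(\<lambda>n. \<phi> (s n t)) \<longlonglongrightarrow> \<phi> (h t)"
        using \<phi> elim by (intro isCont_tendsto_compose[of _ \<phi>]) (auto simp: continuous_on_eq_continuous_at)
      then show ?case by (rule limI[symmetric])
    qed
  qed auto
qed

text \<open>
  A relatively open subset of a compact metric space is a countable union of compact sets, namely
  of the points with distance at least \<open>1/n\<close> from the complement.
\<close>

lemma countable_subcover_compact:
  fixes B :: "'t::metric_space set"
  assumes B: "compact B" and W: "\<And>i. i \<in> I \<Longrightarrow> open (W i)"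
  shows "\<exists>J. countable J \<and> J \<subseteq> I \<and> B \<inter> (\<Union>i\<in>I. W i) \<subseteq> (\<Union>i\<in>J. W i)"
proof -
  define F where "F = B - (\<Union>i\<in>I. W i)"
  define K where "K n = B - (\<Union>b\<in>F. ball b (1 / Suc n))" for n :: nat
  have "\<exists>J. finite J \<and> J \<subseteq> I \<and> K n \<subseteq> (\<Union>i\<in>J. W i)" for n
  proof -
    have "compact (K n)" unfolding K_def using B by (intro compact_diff open_UN) auto
    moreover have "K n \<subseteq> (\<Union>i\<in>I. W i)"
      by (force simp: K_def F_def)
    ultimately obtain J where "J \<subseteq> I" "finite J" "K n \<subseteq> (\<Union>i\<in>J. W i)"
      using compactE_image[of "K n" I W] W by metis
    then show ?thesis by blast
  qed
  then obtain J where J: "\<And>n. finite (J n)" "\<And>n. J n \<subseteq> I" "\<And>n. K n \<subseteq> (\<Union>i\<in>J n. W i)" by metis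
  have "B \<inter> (\<Union>i\<in>I. W i) \<subseteq> (\<Union>n. K n)"
  proof
    fix t assume t: "t \<in> B \<inter> (\<Union>i\<in>I. W i)"
    have "open (\<Union>i\<in>I. W i)" using W by auto
    then obtain e where e: "e > 0" "ball t e \<subseteq> (\<Union>i\<in>I. W i)" using t by (auto elim!: openE)
    obtain n where n: "1 / Suc n < e" using nat_approx_posE[OF e(1)] by blast
    have "t \<notin> ball b (1 / Suc n)" if "b \<in> F" for b
    proof
      assume "t \<in> ball b (1 / Suc n)"
      then have "b \<in> ball t e" using n by (simp add: dist_commute)
      then show False using e(2) that by (auto simp: F_def)
    qed
    then have "t \<in> K n" using t by (auto simp: K_def)
    then show "t \<in> (\<Union>n. K n)" by blast
  qed
  also have "\<dots> \<subseteq> (\<Union>i\<in>(\<Union>n. J n). W i)" using J(3) by blast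
  finally show ?thesis
    using J(1,2) by (intro exI[of _ "\<Union>n. J n"] conjI countable_UN UN_least) (auto intro: countable_finite)
qed

definition ball_inf :: "('a::metric_space \<Rightarrow> ereal) \<Rightarrow> 'a \<Rightarrow> real \<Rightarrow> ereal" where
  "ball_inf \<phi> y r = (INF z\<in>ball y r. \<phi> z)"

lemma ball_inf_less_iff: "ball_inf \<phi> y r < a \<longleftrightarrow> (\<exists>z\<in>ball y r. \<phi> z < a)"
  by (simp add: ball_inf_def INF_less_iff)

lemma ball_inf_le: "z \<in> ball y r \<Longrightarrow> ball_inf \<phi> y r \<le> \<phi> z"
  unfolding ball_inf_def by (rule INF_lower)

lemma lsc_fun_eq_SUP_ball_inf:
  assumes "lsc_fun \<phi>"
  shows "\<phi> y = (SUP n::nat. ball_inf \<phi> y (1 / Suc n))"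
proof (rule antisym)
  show "(SUP n::nat. ball_inf \<phi> y (1 / Suc n)) \<le> \<phi> y"
    by (intro SUP_least ball_inf_le) auto
  show "\<phi> y \<le> (SUP n::nat. ball_inf \<phi> y (1 / Suc n))"
  proof (rule dense_le)
    fix a assume "a < \<phi> y"
    then have "\<forall>\<^sub>F z in nhds y. a < \<phi> z" using assms by (auto simp: lsc_fun_def)
    then obtain d where d: "d > 0" "\<And>z. dist z y < d \<Longrightarrow> a < \<phi> z" by (auto simp: eventually_nhds_metric)
    obtain n where n: "1 / Suc n < d" using nat_approx_posE[OF d(1)] by blast
    have "a \<le> ball_inf \<phi> y (1 / Suc n)"
      unfolding ball_inf_def
    proof (rule INF_greatest)
      fix z assume "z \<in> ball y (1 / Suc n)"
      then have "dist z y < d" using n by (simp add: dist_commute)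
      then show "a \<le> \<phi> z" using d(2) by (simp add: less_imp_le)
    qed
    then show "a \<le> (SUP n::nat. ball_inf \<phi> y (1 / Suc n))" by (rule SUP_upper2[OF UNIV_I])
  qed
qed

text \<open>
  The infimum over a ball is below \<open>a\<close> exactly if the epigraph meets the open set \<open>ball \<times> (-\<infinity>, a)\<close>.  This is
  how the lower semicontinuity of the epigraphs enters all arguments.
\<close>

lemma lsc_multifun_ball_inf_open:
  assumes "lsc_multifun_on B (\<lambda>t. epi (f t))"
  shows "\<exists>U. open U \<and> {t \<in> B. ball_inf (f t) y r < a} = U \<inter> B"
proof -
  define V where "V = ball y r \<times> {\<alpha>. ereal \<alpha> < a}"
  have "open {\<alpha>. ereal \<alpha> < a}"
    by (intro open_Collect_less continuous_intros)
  then have V: "open V" unfolding V_def by (intro open_Times) auto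
  have iff: "ball_inf (f t) y r < a \<longleftrightarrow> epi (f t) \<inter> V \<noteq> {}" for t
  proof
    assume "ball_inf (f t) y r < a"
    then obtain z where z: "z \<in> ball y r" "f t z < a" by (auto simp: ball_inf_less_iff)
    then obtain \<alpha> where "f t z < ereal \<alpha>" "ereal \<alpha> < a" using ereal_dense2 by blast
    with z have "(z, \<alpha>) \<in> epi (f t) \<inter> V" by (auto simp: epi_def V_def)
    then show "epi (f t) \<inter> V \<noteq> {}" by blast
  next
    assume "epi (f t) \<inter> V \<noteq> {}"
    then show "ball_inf (f t) y r < a" unfolding ball_inf_less_iff
      by (auto simp: epi_def V_def intro: order.strict_trans1)
  qed
  have "\<exists>U. open U \<and> t \<in> U \<and> (\<forall>s\<in>U \<inter> B. ball_inf (f s) y r < a)" if "t \<in> B" "ball_inf (f t) y r < a" for t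
    using assms that V unfolding lsc_multifun_on_def iff by blast
  then obtain U where U: "\<And>t. t \<in> B \<Longrightarrow> ball_inf (f t) y r < a \<Longrightarrow>
      open (U t) \<and> t \<in> U t \<and> (\<forall>s\<in>U t \<inter> B. ball_inf (f s) y r < a)" by metis
  have "open (\<Union>t\<in>{t \<in> B. ball_inf (f t) y r < a}. U t)" using U by auto
  moreover have "{t \<in> B. ball_inf (f t) y r < a} = (\<Union>t\<in>{t \<in> B. ball_inf (f t) y r < a}. U t) \<inter> B"
    using U by blast
  ultimately show ?thesis by blast
qed

lemma lusin_integrand_compact_cover:
  fixes M :: "'t::metric_space measure"
  assumes "sigma_finite_measure M" and borel: "sets borel \<subseteq> sets M" and lus: "lusin_integrand M f"
  shows "\<exists>B :: nat \<Rightarrow> 't set. (\<forall>k. compact (B k) \<and> lsc_multifun_on (B k) (\<lambda>t. epi (f t))) \<and> (AE t in M. t \<in> (\<Union>k. B k))"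
proof -
  interpret sigma_finite_measure M by fact
  obtain A :: "nat \<Rightarrow> 't set" where A: "range A \<subseteq> sets M" "(\<Union>i. A i) = space M" "\<And>i. emeasure M (A i) \<noteq> \<infinity>"
    using sigma_finite by auto
  have A_sets: "A i \<in> sets M" for i using A(1) by auto
  have "\<exists>B. compact B \<and> B \<subseteq> A i \<and> emeasure M (A i - B) < ennreal (1 / Suc n) \<and> lsc_multifun_on B (\<lambda>t. epi (f t))" for i n
    using lus[unfolded lusin_integrand_def, rule_format, of "1 / Suc n" "A i"] A A_sets by (simp add: less_top)
  then obtain B where B: "\<And>i n. compact (B i n)" "\<And>i n. emeasure M (A i - B i n) < ennreal (1 / Suc n)"
    "\<And>i n. lsc_multifun_on (B i n) (\<lambda>t. epi (f t))" by metis
  have B_sets: "B i n \<in> sets M" for i n using borel borel_closed[OF compact_imp_closed[OF B(1)]] by blast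
  have "AE t in M. t \<notin> A i - (\<Union>n. B i n)" for i
  proof (rule AE_not_in)
    have U: "(\<Union>n. B i n) \<in> sets M" using B_sets by auto
    have "emeasure M (A i - (\<Union>n. B i n)) \<le> ennreal (1 / Suc n)" for n
    proof -
      have "emeasure M (A i - (\<Union>n. B i n)) \<le> emeasure M (A i - B i n)"
        using A_sets B_sets by (intro emeasure_mono) auto
      then show ?thesis using B(2)[of i n] by simp
    qed
    moreover have "(\<lambda>n. ennreal (1 / Suc n)) \<longlonglongrightarrow> ennreal 0"
      using LIMSEQ_inverse_real_of_nat by (intro tendsto_ennrealI) (simp add: inverse_eq_divide)
    ultimately have "emeasure M (A i - (\<Union>n. B i n)) \<le> ennreal 0"
      by (intro LIMSEQ_le_const) auto
    then show "A i - (\<Union>n. B i n) \<in> null_sets M" using A_sets U by (auto simp: null_sets_def)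
  qed
  then have "AE t in M. \<forall>i. t \<notin> A i - (\<Union>n. B i n)" by (simp add: AE_all_countable)
  then have "AE t in M. t \<in> (\<Union>k. B (fst (prod_decode k)) (snd (prod_decode k)))"
    using AE_space
  proof eventually_elim
    case (elim t)
    then obtain i where "t \<in> A i" using A(2) by blast
    then obtain n where "t \<in> B i n" using elim by blast
    then show ?case by (intro UN_I[of "prod_encode (i, n)"]) auto
  qed
  then show ?thesis using B by (intro exI[of _ "\<lambda>k. B (fst (prod_decode k)) (snd (prod_decode k))"]) auto
qed

lemma ball_inf_measurable:
  fixes M :: "'t::metric_space measure"
  assumes "complete_measure M" "sigma_finite_measure M" and sp: "space M = UNIV"
    and borel: "sets borel \<subseteq> sets M" and lus: "lusin_integrand M f"
  shows "(\<lambda>t. ball_inf (f t) y r) \<in> borel_measurable M"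
proof (rule borel_measurableI_less)
  interpret complete_measure M by fact
  from lusin_integrand_compact_cover[OF assms(2) borel lus] obtain B where
    B': "\<forall>k. compact (B k) \<and> lsc_multifun_on (B k) (\<lambda>t. epi (f t))" and ae: "AE t in M. t \<in> (\<Union>k::nat. B k)"
    by (elim exE conjE)
  have B: "compact (B k)" "lsc_multifun_on (B k) (\<lambda>t. epi (f t))" for k using B' by auto
  fix a :: ereal
  have "\<forall>k. \<exists>U. open U \<and> {t \<in> B k. ball_inf (f t) y r < a} = U \<inter> B k"
    by (rule allI, rule lsc_multifun_ball_inf_open[OF B(2)])
  then obtain U where U: "\<And>k. open (U k)" "\<And>k. {t \<in> B k. ball_inf (f t) y r < a} = U k \<inter> B k" by metis
  have "U k \<inter> B k \<in> sets M" for k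
  proof -
    have "U k \<in> sets borel" "B k \<in> sets borel"
      using U(1)[of k] compact_imp_closed[OF B(1)[of k]] by auto
    then show ?thesis using borel by (intro sets.Int) auto
  qed
  then have UB: "(\<Union>k. U k \<inter> B k) \<in> sets M" by auto
  have AE_UB: "AE t in M. t \<in> (\<Union>k. U k \<inter> B k) \<longleftrightarrow> t \<in> {t \<in> space M. ball_inf (f t) y r < a}"
    using ae
  proof eventually_elim
    case (elim t)
    then show ?case unfolding U(2)[symmetric] sp by auto
  qed
  show "{t \<in> space M. ball_inf (f t) y r < a} \<in> sets M"
    by (rule in_sets_AE[OF AE_UB UB]) auto
qed

text \<open>
  The infima over balls are measurable by the preceding lemma, and a lower semicontinuous
  function is the supremum of the infima over balls that shrink to the point.
\<close>

lemma lusin_integrand_measurable: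
  fixes M :: "'t::metric_space measure"
  assumes "complete_measure M" "sigma_finite_measure M" "space M = UNIV"
    "sets borel \<subseteq> sets M" "lusin_integrand M f" and lsc: "\<And>t. lsc_fun (f t)"
  shows "(\<lambda>t. f t y) \<in> borel_measurable M"
proof -
  have "(\<lambda>t. SUP n::nat. ball_inf (f t) y (1 / Suc n)) \<in> borel_measurable M"
    by (rule borel_measurable_SUP) (simp_all add: ball_inf_measurable[OF assms(1-5)])
  moreover have "(\<lambda>t. f t y) = (\<lambda>t. SUP n::nat. ball_inf (f t) y (1 / Suc n))"
    by (rule ext, rule lsc_fun_eq_SUP_ball_inf, rule lsc)
  ultimately show ?thesis by simp
qed

text \<open>
  A countable set of balls that is as good as all points \<open>y\<close> for the suprema of
  \<open>\<langle>H t, y\<rangle> - f\<^sub>t y\<close>.  Fix one of the compact sets, a point \<open>\<xi>\<close> of the countable set that approximates the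
  values of \<open>H\<close>, and rational values for all other parameters.  Then the centres \<open>y\<close> with \<open>\<langle>\<xi>, y\<rangle> > \<beta>\<close> give a
  family of relatively open sets of points \<open>t\<close> at which the infimum over the ball is below \<open>\<alpha>\<close>, and
  countably many centres give the same union.  The term \<open>r * g t\<close> anticipates the price of
  replacing a centre by a point of its ball.
\<close>

lemma countable_sampling:
  fixes B :: "nat \<Rightarrow> 't::metric_space set" and f :: "'t \<Rightarrow> 'a::real_normed_vector \<Rightarrow> ereal"
    and H :: "'t \<Rightarrow> ('a \<Rightarrow>\<^sub>L real)" and g :: "'t \<Rightarrow> real"
  assumes B: "\<And>k. compact (B k)" "\<And>k. lsc_multifun_on (B k) (\<lambda>t. epi (f t))" and \<Xi>: "countable \<Xi>"
  shows "\<exists>Y. countable Y \<and> (\<forall>(y, r)\<in>Y. 0 < r \<and> r \<le> 1) \<and>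
    (\<forall>t\<in>(\<Union>k. B k). H t \<in> closure \<Xi> \<longrightarrow> 0 \<le> g t \<longrightarrow> (\<forall>y a e. f t y < ereal a \<longrightarrow> 0 < e \<longrightarrow>
      (\<exists>(y', r)\<in>Y. ball_inf (f t) y' r < ereal a \<and> blinfun_apply (H t) y - e < blinfun_apply (H t) y' - r * g t)))"
proof -
  define \<rho> :: "nat \<Rightarrow> real" where "\<rho> n = 1 / Suc n" for n
  define U where "U k y n \<alpha> = (SOME U. open U \<and> {t \<in> B k. ball_inf (f t) y (\<rho> n) < ereal (real_of_rat \<alpha>)} = U \<inter> B k)"
    for k y n \<alpha>
  have U': "open (U k y n \<alpha>) \<and> {t \<in> B k. ball_inf (f t) y (\<rho> n) < ereal (real_of_rat \<alpha>)} = U k y n \<alpha> \<inter> B k"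
    for k y n \<alpha> unfolding U_def by (rule someI_ex) (rule lsc_multifun_ball_inf_open[OF B(2)])
  have U: "open (U k y n \<alpha>)" "{t \<in> B k. ball_inf (f t) y (\<rho> n) < ereal (real_of_rat \<alpha>)} = U k y n \<alpha> \<inter> B k"
    for k y n \<alpha> by (rule U'[THEN conjunct1], rule U'[THEN conjunct2])
  \<comment> \<open>The norm bound \<open>R\<close> is needed to pass from \<open>\<xi>\<close> back to \<open>H t\<close> uniformly in the chosen centre.\<close>
  define I where "I \<xi> R \<beta> = {y :: 'a. norm y \<le> real R \<and> real_of_rat \<beta> < blinfun_apply \<xi> y}"
    for \<xi> :: "'a \<Rightarrow>\<^sub>L real" and R :: nat and \<beta> :: rat
  define J where "J k n \<alpha> \<xi> R \<beta> = (SOME J. countable J \<and> J \<subseteq> I \<xi> R \<beta> \<and>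
      B k \<inter> (\<Union>y\<in>I \<xi> R \<beta>. U k y n \<alpha>) \<subseteq> (\<Union>y\<in>J. U k y n \<alpha>))" for k n \<alpha> \<xi> R \<beta>
  have J': "countable (J k n \<alpha> \<xi> R \<beta>) \<and> J k n \<alpha> \<xi> R \<beta> \<subseteq> I \<xi> R \<beta> \<and>
      B k \<inter> (\<Union>y\<in>I \<xi> R \<beta>. U k y n \<alpha>) \<subseteq> (\<Union>y\<in>J k n \<alpha> \<xi> R \<beta>. U k y n \<alpha>)" for k n \<alpha> \<xi> R \<beta>
    unfolding J_def by (rule someI_ex) (rule countable_subcover_compact[OF B(1) U(1)])
  have J: "countable (J k n \<alpha> \<xi> R \<beta>)" "J k n \<alpha> \<xi> R \<beta> \<subseteq> I \<xi> R \<beta>"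
      "B k \<inter> (\<Union>y\<in>I \<xi> R \<beta>. U k y n \<alpha>) \<subseteq> (\<Union>y\<in>J k n \<alpha> \<xi> R \<beta>. U k y n \<alpha>)" for k n \<alpha> \<xi> R \<beta>
    by (rule J'[THEN conjunct1], rule J'[THEN conjunct2, THEN conjunct1], rule J'[THEN conjunct2, THEN conjunct2])
  define Y where "Y = (\<Union>k. \<Union>n. \<Union>\<alpha>. \<Union>\<xi>\<in>\<Xi>. \<Union>R. \<Union>\<beta>. J k n \<alpha> \<xi> R \<beta> \<times> {\<rho> n})"
  have "countable Y" 
    unfolding Y_def by (intro countable_UN countable_SIGMA) (simp_all add: J(1) \<Xi>)
  moreover have "\<forall>(y, r)\<in>Y. 0 < r \<and> r \<le> 1" by (auto simp: Y_def \<rho>_def)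
  moreover have "\<exists>(y', r)\<in>Y. ball_inf (f t) y' r < ereal a \<and> blinfun_apply (H t) y - e < blinfun_apply (H t) y' - r * g t"
    if t: "t \<in> (\<Union>k. B k)" "H t \<in> closure \<Xi>" "0 \<le> g t" and y: "f t y < ereal a" and e: "0 < e" for t y a e
  proof -
    obtain k where k: "t \<in> B k" using t by blast
    obtain R :: nat where R: "norm y < R" using reals_Archimedean2 by blast
    then have R0: "0 < real R" using norm_ge_zero[of y] by linarith
    have "0 < e / (4 * R)" using e R0 by simp
    then have "\<exists>\<xi>\<in>\<Xi>. dist \<xi> (H t) < e / (4 * R)"
      using t(2)[unfolded closure_approachable, rule_format] by simp
    then obtain \<xi> where \<xi>: "\<xi> \<in> \<Xi>" "dist \<xi> (H t) < e / (4 * R)" by blast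
    have \<xi>_app: "\<bar>blinfun_apply \<xi> z - blinfun_apply (H t) z\<bar> \<le> e / 4" if "norm z \<le> R" for z
    proof -
      have "\<bar>blinfun_apply \<xi> z - blinfun_apply (H t) z\<bar> \<le> norm (\<xi> - H t) * norm z"
        using norm_blinfun[of "\<xi> - H t" z] by (simp add: blinfun.diff_left)
      also have "\<dots> \<le> e / (4 * R) * R"
        using \<xi>(2) that R0 e by (intro mult_mono) (auto simp: dist_norm)
      finally show ?thesis using R0 by simp
    qed
    obtain n where n: "\<rho> n * g t < e / 4"
    proof -
      have "0 < e / (4 * (g t + 1))" using e t(3) by simp
      then obtain n where "1 / Suc n < e / (4 * (g t + 1))" using nat_approx_posE by blast
      then have "\<rho> n * (g t + 1) < e / 4" using t(3) by (simp add: \<rho>_def field_simps)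
      moreover have "\<rho> n * g t \<le> \<rho> n * (g t + 1)" by (intro mult_left_mono) (auto simp: \<rho>_def)
      ultimately show ?thesis by (intro that[of n]) linarith
    qed
    obtain \<beta> where \<beta>: "blinfun_apply \<xi> y - e/4 < real_of_rat \<beta>" "real_of_rat \<beta> < blinfun_apply \<xi> y"
      using of_rat_dense[of "blinfun_apply \<xi> y - e/4" "blinfun_apply \<xi> y"] e by auto
    obtain \<alpha> where \<alpha>: "f t y < ereal (real_of_rat \<alpha>)" "ereal (real_of_rat \<alpha>) < ereal a"
    proof -
      obtain b where "f t y < ereal b" "ereal b < ereal a" using ereal_dense2[OF y] by blast
      moreover from this obtain \<alpha> where "b < real_of_rat \<alpha>" "real_of_rat \<alpha> < a" using of_rat_dense[of b a] by auto
      ultimately show ?thesis by (intro that[of \<alpha>]) (auto intro: order.strict_trans)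
    qed
    have yI: "y \<in> I \<xi> R \<beta>" using R \<beta> by (simp add: I_def)
    have "ball_inf (f t) y (\<rho> n) < ereal (real_of_rat \<alpha>)"
      using ball_inf_le[of y y "\<rho> n" "f t"] \<alpha>(1) by (auto simp: \<rho>_def intro: order.strict_trans1)
    then have "t \<in> U k y n \<alpha>" using U(2)[where k = k and y = y and n = n and \<alpha> = \<alpha>] k by blast
    then have "t \<in> (\<Union>y\<in>J k n \<alpha> \<xi> R \<beta>. U k y n \<alpha>)" using J(3)[where k = k and \<xi> = \<xi> and R = R and \<beta> = \<beta> and n = n and \<alpha> = \<alpha>] k yI by blast
    then obtain y' where y': "y' \<in> J k n \<alpha> \<xi> R \<beta>" "t \<in> U k y' n \<alpha>" by blast
    then have "ball_inf (f t) y' (\<rho> n) < ereal (real_of_rat \<alpha>)" using U(2)[where k = k and y = y' and n = n and \<alpha> = \<alpha>] k by blast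
    then have "ball_inf (f t) y' (\<rho> n) < ereal a" using \<alpha>(2) by (rule order.strict_trans)
    moreover have "norm y' \<le> R" "real_of_rat \<beta> < blinfun_apply \<xi> y'" using subsetD[OF J(2) y'(1)] by (simp_all add: I_def)
    then have "blinfun_apply (H t) y - e < blinfun_apply (H t) y' - \<rho> n * g t"
      using abs_le_D1[OF \<xi>_app[of y']] abs_le_D1[OF \<xi>_app[of y]] abs_le_D2[OF \<xi>_app[of y']] abs_le_D2[OF \<xi>_app[of y]]
        R \<beta>(1) n by linarith
    moreover have "(y', \<rho> n) \<in> Y" unfolding Y_def
      by (rule UN_I[of k], simp, rule UN_I[of n], simp, rule UN_I[of \<alpha>], simp, rule UN_I[of \<xi>], rule \<xi>(1),
        rule UN_I[of R], simp, rule UN_I[of \<beta>], simp, rule SigmaI, rule y'(1), simp)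
    ultimately show ?thesis by (intro bexI[of _ "(y', \<rho> n)"]) auto
  qed
  ultimately show ?thesis by (intro exI[of _ Y]) auto
qed

section \<open>The integral functional and dominated extensions of its subgradients\<close>

lemma upper_integral_mono_AE:
  assumes "AE t in M. \<phi> t \<le> \<psi> t"
  shows "upper_integral M \<phi> \<le> upper_integral M \<psi>"
  unfolding upper_integral_def
proof (rule ereal_minus_mono)
  show "enn2ereal (\<integral>\<^sup>+t. e2ennreal (\<phi> t) \<partial>M) \<le> enn2ereal (\<integral>\<^sup>+t. e2ennreal (\<psi> t) \<partial>M)"
    unfolding less_eq_ennreal.rep_eq[symmetric]
    using assms by (intro nn_integral_mono_AE) (auto elim!: eventually_mono intro: e2ennreal_mono)
  show "enn2ereal (\<integral>\<^sup>+t. e2ennreal (- \<psi> t) \<partial>M) \<le> enn2ereal (\<integral>\<^sup>+t. e2ennreal (- \<phi> t) \<partial>M)"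
    unfolding less_eq_ennreal.rep_eq[symmetric]
    using assms by (intro nn_integral_mono_AE) (auto elim!: eventually_mono intro: e2ennreal_mono)
qed

lemma upper_integral_cong_AE:
  assumes "AE t in M. \<phi> t = \<psi> t"
  shows "upper_integral M \<phi> = upper_integral M \<psi>"
  using assms by (intro antisym upper_integral_mono_AE) (auto elim: eventually_mono)

lemma upper_integral_ereal:
  assumes "integrable M \<phi>"
  shows "upper_integral M (\<lambda>t. ereal (\<phi> t)) = ereal (\<integral>t. \<phi> t \<partial>M)"
proof -
  have 1: "(\<integral>\<^sup>+t. ennreal (\<phi> t) \<partial>M) < \<infinity>" "(\<integral>\<^sup>+t. ennreal (- \<phi> t) \<partial>M) < \<infinity>"
    using assms by (auto simp: real_integrable_def less_top)
  have *: "enn2ereal a = ereal (enn2real a)" if "a < \<infinity>" for a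
    using that by (cases a) (auto simp: enn2ereal_ennreal)
  show ?thesis
    unfolding upper_integral_def real_lebesgue_integral_def[OF assms]
    using *[OF 1(1)] *[OF 1(2)] by simp
qed

lemma upper_integral_finiteD:
  assumes \<phi>[measurable]: "\<phi> \<in> borel_measurable M" and fin: "\<bar>upper_integral M \<phi>\<bar> < \<infinity>"
  shows "AE t in M. \<phi> t = ereal (real_of_ereal (\<phi> t))"
    and "integrable M (\<lambda>t. real_of_ereal (\<phi> t))"
    and "upper_integral M \<phi> = ereal (\<integral>t. real_of_ereal (\<phi> t) \<partial>M)"
proof -
  define a where "a = (\<integral>\<^sup>+t. e2ennreal (\<phi> t) \<partial>M)"
  define b where "b = (\<integral>\<^sup>+t. e2ennreal (- \<phi> t) \<partial>M)"
  have ab: "a \<noteq> \<infinity>" "b \<noteq> \<infinity>"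
    using fin unfolding upper_integral_def a_def[symmetric] b_def[symmetric]
    by (cases a; cases b; simp add: enn2ereal_ennreal)+
  have "AE t in M. e2ennreal (\<phi> t) \<noteq> \<infinity>" "AE t in M. e2ennreal (- \<phi> t) \<noteq> \<infinity>"
    using ab unfolding a_def b_def by (intro nn_integral_PInf_AE; simp)+
  then show ae: "AE t in M. \<phi> t = ereal (real_of_ereal (\<phi> t))"
  proof eventually_elim
    case (elim t)
    then show ?case by (cases "\<phi> t") (auto simp: e2ennreal_infty)
  qed
  have "(\<integral>\<^sup>+t. ennreal (real_of_ereal (\<phi> t)) \<partial>M) = a"
    unfolding a_def using ae by (intro nn_integral_cong_AE, eventually_elim) (metis e2ennreal_ereal)
  moreover have "(\<integral>\<^sup>+t. ennreal (- real_of_ereal (\<phi> t)) \<partial>M) = b"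
    unfolding b_def using ae by (intro nn_integral_cong_AE, eventually_elim) (metis e2ennreal_ereal uminus_ereal.simps(1))
  ultimately show int: "integrable M (\<lambda>t. real_of_ereal (\<phi> t))"
    using ab by (simp add: real_integrable_def)
  have "upper_integral M \<phi> = upper_integral M (\<lambda>t. ereal (real_of_ereal (\<phi> t)))"
    by (rule upper_integral_cong_AE[OF ae])
  then show "upper_integral M \<phi> = ereal (\<integral>t. real_of_ereal (\<phi> t) \<partial>M)"
    using upper_integral_ereal[OF int] by simp
qed

locale lusin_functional =
  fixes M :: "'t::metric_space measure" and f :: "'t \<Rightarrow> 'a::banach \<Rightarrow> ereal"
    and x0 :: 'a and k :: "'t \<Rightarrow> real" and \<eta> :: real
  assumes complete: "complete_measure M" and sigma_fin: "sigma_finite_measure M"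
    and space_UNIV: "space M = UNIV" and borel: "sets borel \<subseteq> sets M"
    and lusin: "lusin_integrand M f" and Gamma0: "\<And>t. f t \<in> Gamma0"
    and finite_x0: "\<bar>integral_functional M f x0\<bar> < \<infinity>"
    and k: "integrable M k" and \<eta>: "0 < \<eta>"
    and le_k: "\<And>t x. x \<in> cball x0 \<eta> \<Longrightarrow> f t x \<le> ereal (k t)"
begin

abbreviation E where "E \<equiv> integral_functional M f"

lemma f_measurable[measurable]: "(\<lambda>t. f t y) \<in> borel_measurable M"
  by (rule lusin_integrand_measurable[OF complete sigma_fin space_UNIV borel lusin])
    (use Gamma0 in \<open>auto simp: Gamma0_def\<close>)

lemma ball_inf_f_measurable[measurable]: "(\<lambda>t. ball_inf (f t) y r) \<in> borel_measurable M"
  by (rule ball_inf_measurable[OF complete sigma_fin space_UNIV borel lusin])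

lemma f_not_MInf: "f t y \<noteq> -\<infinity>"
  using Gamma0[of t] by (simp add: Gamma0_def proper_fun_def)

lemma f_convex:
  assumes "f t y \<le> ereal a" "f t y' \<le> ereal a'" "0 \<le> s" "0 \<le> s'" "s + s' = 1"
  shows "f t (s *\<^sub>R y + s' *\<^sub>R y') \<le> ereal (s * a + s' * a')"
proof -
  have c: "convex (epi (f t))" using Gamma0[of t] by (simp add: Gamma0_def)
  have "(y, a) \<in> epi (f t)" "(y', a') \<in> epi (f t)" using assms by (auto simp: epi_def)
  from convexD[OF c this assms(3-5)] show ?thesis by (simp add: epi_def)
qed

definition F0 where "F0 t = real_of_ereal (f t x0)"

lemma f_x0: "f t x0 = ereal (F0 t)"
  using le_k[of x0 t] \<eta> f_not_MInf[of t x0] by (cases "f t x0") (auto simp: F0_def)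

lemma F0: "integrable M F0"
  using upper_integral_finiteD(2)[OF f_measurable, of x0] finite_x0
  by (simp add: integral_functional_def F0_def[abs_def])

text \<open>
  If \<open>y\<close> has distance at most \<open>R\<close> from \<open>x0\<close>, then \<open>x0\<close> is a convex combination of \<open>y\<close> and of the point
  \<open>z = x0 + s (x0 - y)\<close> of the ball of radius \<open>\<eta>\<close>, where \<open>s = \<eta> / R\<close>.  Solving
  \<open>(1 + s) f\<^sub>t x0 \<le> f\<^sub>t z + s f\<^sub>t y \<le> k t + s f\<^sub>t y\<close> for \<open>f\<^sub>t y\<close> gives this integrable lower bound.
\<close>

definition minorant :: "real \<Rightarrow> 't \<Rightarrow> real" where
  "minorant R t = ((1 + \<eta> / R) * F0 t - k t) / (\<eta> / R)"

lemma minorant_integrable: "integrable M (minorant R)"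
  unfolding minorant_def[abs_def] by (intro integrable_divide_zero Bochner_Integration.integrable_diff integrable_mult_right F0 k)

lemma minorant_le:
  assumes y: "dist x0 y \<le> R" and R: "0 < R"
  shows "ereal (minorant R t) \<le> f t y"
proof (rule ccontr)
  assume "\<not> ?thesis"
  then have "f t y < ereal (minorant R t)" by simp
  from ereal_dense2[OF this] obtain \<beta> where \<beta>: "f t y < ereal \<beta>" "\<beta> < minorant R t" by auto
  define s where "s = \<eta> / R"
  have s: "0 < s" using \<eta> R by (simp add: s_def)
  define z where "z = x0 + s *\<^sub>R (x0 - y)"
  have "norm (s *\<^sub>R (x0 - y)) \<le> s * R"
    using s y by (simp add: dist_norm)
  then have "z \<in> cball x0 \<eta>" using R by (simp add: z_def dist_norm s_def)
  then have z: "f t z \<le> ereal (k t)" by (rule le_k)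
  have s1: "0 \<le> 1 / (1 + s)" "0 \<le> s / (1 + s)" "1 / (1 + s) + s / (1 + s) = 1"
    using s by (auto simp: add_divide_distrib[symmetric])
  have "(1 / (1 + s)) *\<^sub>R z + (s / (1 + s)) *\<^sub>R y = (1 / (1 + s)) *\<^sub>R ((1 + s) *\<^sub>R x0)"
    by (simp add: z_def algebra_simps)
  also have "\<dots> = x0" using s by simp
  finally have "f t x0 \<le> ereal (1 / (1 + s) * k t + s / (1 + s) * \<beta>)"
    using f_convex[OF z less_imp_le[OF \<beta>(1)] s1] by simp
  then have "F0 t \<le> (k t + s * \<beta>) / (1 + s)" by (simp add: f_x0 add_divide_distrib)
  then have "((1 + s) * F0 t - k t) / s \<le> \<beta>" using s by (simp add: field_simps)
  then show False using \<beta>(2) by (simp add: minorant_def s_def)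
qed

text \<open>
  The minorant excludes the value \<open>-\<infinity>\<close>, so on its domain the functional is an ordinary integral of an
  almost everywhere finite integrand.
\<close>

lemma E_dom:
  assumes "z \<in> edom E"
  shows "AE t in M. f t z = ereal (real_of_ereal (f t z))"
    and "integrable M (\<lambda>t. real_of_ereal (f t z))"
    and "E z = ereal (\<integral>t. real_of_ereal (f t z) \<partial>M)"
proof -
  define R where "R = dist x0 z + 1"
  have "AE t in M. ereal (minorant R t) \<le> f t z"
    by (intro AE_I2 minorant_le) (auto simp: R_def intro: add_nonneg_pos)
  from upper_integral_mono_AE[OF this] have "ereal (\<integral>t. minorant R t \<partial>M) \<le> E z"
    by (simp add: integral_functional_def upper_integral_ereal[OF minorant_integrable])
  then have "\<bar>E z\<bar> < \<infinity>" using assms by (cases "E z") (auto simp: edom_def)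
  then have fin: "\<bar>upper_integral M (\<lambda>t. f t z)\<bar> < \<infinity>" by (simp add: integral_functional_def)
  show "AE t in M. f t z = ereal (real_of_ereal (f t z))"
    "integrable M (\<lambda>t. real_of_ereal (f t z))"
    "E z = ereal (\<integral>t. real_of_ereal (f t z) \<partial>M)"
    using upper_integral_finiteD[OF f_measurable fin] by (auto simp: integral_functional_def)
qed

text \<open>
  Integration of the pointwise subgradient inequality.
\<close>

lemma eps_subdiff_sum_subset:
  assumes x: "x \<in> edom E" and \<epsilon>: "\<epsilon>1 + \<epsilon>2 \<le> \<epsilon>" and l: "l \<in> Zset M \<epsilon>1"
    and u: "u \<in> integral_eps_subdiff M l f x" and v: "v \<in> eps_normal \<epsilon>2 (edom E) x"
  shows "u + v \<in> eps_subdiff \<epsilon> E x"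
proof -
  interpret complete_measure M by (rule complete)
  obtain h where h: "h \<in> L1_Bochner M" and sub: "AE t in M. h t \<in> eps_subdiff (l t) (f t) x"
    and uh: "\<And>v. blinfun_apply u v = (\<integral>t. blinfun_apply (h t) v \<partial>M)"
    using u by (auto simp: integral_eps_subdiff_def)
  have l_int: "integrable M l" and l_le: "(\<integral>t. l t \<partial>M) \<le> \<epsilon>1" using l by (auto simp: Zset_def)
  have h_int: "integrable M (\<lambda>t. blinfun_apply (h t) y)" for y
  proof (rule Bochner_Integration.integrable_bound)
    show "integrable M (\<lambda>t. norm (h t) * norm y)"
      using h by (intro integrable_mult_left) (simp add: L1_Bochner_def)
    show "(\<lambda>t. blinfun_apply (h t) y) \<in> borel_measurable M"
      using h by (intro continuous_strongly_measurable[where \<phi> = "\<lambda>\<xi>. blinfun_apply \<xi> y"])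
        (auto simp: L1_Bochner_def intro!: continuous_intros)
    show "AE t in M. norm (blinfun_apply (h t) y) \<le> norm (norm (h t) * norm y)"
    proof (rule AE_I2)
      show "norm (blinfun_apply (h t) y) \<le> norm (norm (h t) * norm y)" for t
        using norm_blinfun[of "h t" y] by simp
    qed
  qed
  have "ereal (blinfun_apply (u + v) (y - x)) \<le> E y - E x + ereal \<epsilon>" for y
  proof (cases "y \<in> edom E")
    case False
    then have "E y = \<infinity>" by (simp add: edom_def)
    then show ?thesis using E_dom(3)[OF x] by simp
  next
    case True
    define Fx where "Fx t = real_of_ereal (f t x)" for t
    define Fy where "Fy t = real_of_ereal (f t y)" for t
    have ix: "integrable M Fx" and iy: "integrable M Fy"
      using E_dom(2)[OF x] E_dom(2)[OF True] by (simp_all add: Fx_def[abs_def] Fy_def[abs_def])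
    have "(\<integral>t. blinfun_apply (h t) (y - x) \<partial>M) \<le> (\<integral>t. Fy t - Fx t + l t \<partial>M)"
    proof (rule integral_mono_AE)
      show "AE t in M. blinfun_apply (h t) (y - x) \<le> Fy t - Fx t + l t"
        using sub E_dom(1)[OF x, folded Fx_def] E_dom(1)[OF True, folded Fy_def]
      proof eventually_elim
        case (elim t)
        have "ereal (blinfun_apply (h t) (y - x)) \<le> f t y - f t x + ereal (l t)"
          using elim(1) by (auto simp: eps_subdiff_def split: if_splits)
        then show ?case unfolding elim(2) elim(3) by simp
      qed
    qed (use h_int ix iy l_int in auto)
    also have "\<dots> = (\<integral>t. Fy t \<partial>M) - (\<integral>t. Fx t \<partial>M) + (\<integral>t. l t \<partial>M)"
      using ix iy l_int by simp
    finally have "blinfun_apply u (y - x) \<le> (\<integral>t. Fy t \<partial>M) - (\<integral>t. Fx t \<partial>M) + \<epsilon>1"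
      using l_le uh[of "y - x"] by linarith
    moreover have "ereal (blinfun_apply v (y - x)) \<le> ereal \<epsilon>2"
      using v True x by (auto simp: eps_normal_def eps_subdiff_def indicator_fun_def split: if_splits dest!: spec[of _ y])
    ultimately have "blinfun_apply (u + v) (y - x) \<le> (\<integral>t. Fy t \<partial>M) - (\<integral>t. Fx t \<partial>M) + \<epsilon>"
      using \<epsilon> by (simp add: blinfun.add_left)
    then show ?thesis unfolding E_dom(3)[OF x] E_dom(3)[OF True] Fx_def Fy_def by simp
  qed
  then show ?thesis using E_dom(3)[OF x] by (simp add: eps_subdiff_def)
qed

text \<open>
  The sandwich theorem for the convex function that maps \<open>w\<close> to the infimum of the integrals of
  the integrable majorants of \<open>f\<^sub>t (x + w t)\<close>.  The core condition holds at the constant \<open>x0 - x\<close>,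
  where \<open>k\<close> is a majorant on a whole ball; this also bounds the extension.  The majorants are insensitive to
  changes of \<open>w\<close> on null sets, so every multiple of a null function has \<open>L\<close>-value at most
  \<open>\<epsilon>\<close>, hence \<open>L\<close> vanishes there.
\<close>

lemma exists_dominated_extension:
  assumes x: "x \<in> edom E" and u: "u \<in> eps_subdiff \<epsilon> E x"
  shows "\<exists>L C. bounded_functional M L C \<and> (\<forall>c. L (\<lambda>t. c) = blinfun_apply u c) \<and>
    (\<forall>w G. bounded (range w) \<longrightarrow> integrable M G \<longrightarrow> (AE t in M. f t (x + w t) \<le> ereal (G t)) \<longrightarrow>
      L w \<le> (\<integral>t. G t \<partial>M) - (\<integral>t. real_of_ereal (f t x) \<partial>M) + \<epsilon>)"
proof -
  define Fx where "Fx t = real_of_ereal (f t x)" for t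
  define Ex where "Ex = (\<integral>t. Fx t \<partial>M)"
  have Ex: "E x = ereal Ex" and Fx: "AE t in M. f t x = ereal (Fx t)" "integrable M Fx"
    using E_dom[OF x] by (simp_all add: Ex_def Fx_def[abs_def])
  have u_le: "ereal (blinfun_apply u (y - x)) \<le> E y - ereal Ex + ereal \<epsilon>" for y
    using u by (auto simp: eps_subdiff_def Ex)
  define C where "C = {(w, a). \<exists>G. integrable M G \<and> (AE t in M. f t (x + w t) \<le> ereal (G t)) \<and> (\<integral>t. G t \<partial>M) - Ex + \<epsilon> \<le> a}"
  define c0 where "c0 = x0 - x"
  define K where "K = (\<integral>t. k t \<partial>M) - Ex + \<epsilon>"
  have inC: "(w, (\<integral>t. G t \<partial>M) - Ex + \<epsilon>) \<in> C" if "integrable M G" "AE t in M. f t (x + w t) \<le> ereal (G t)" for w G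
    using that by (auto simp: C_def)
  have ball: "(\<lambda>t. c0 + w t, K) \<in> C" if "\<And>t. norm (w t) \<le> \<eta>" for w
    unfolding K_def using that by (intro inC[OF k] AE_I2 le_k) (simp add: c0_def dist_norm)
  have "\<exists>L. (\<forall>w w'. bounded (range w) \<longrightarrow> bounded (range w') \<longrightarrow> L (\<lambda>t. w t + w' t) = L w + L w') \<and>
    (\<forall>s w. bounded (range w) \<longrightarrow> L (\<lambda>t. s *\<^sub>R w t) = s * L w) \<and>
    (\<forall>c. L (\<lambda>t. c) = blinfun_apply u c) \<and>
    (\<forall>w a. bounded (range w) \<longrightarrow> (w, a) \<in> C \<longrightarrow> L w \<le> a)"
  proof (rule Hahn_Banach_sandwich_bounded_functions)
    fix w w' a a' and s s' :: real assume "(w, a) \<in> C" "(w', a') \<in> C" and s: "0 \<le> s" "0 \<le> s'" "s + s' = 1"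
    then obtain G G' where G: "integrable M G" "AE t in M. f t (x + w t) \<le> ereal (G t)" "(\<integral>t. G t \<partial>M) - Ex + \<epsilon> \<le> a"
      and G': "integrable M G'" "AE t in M. f t (x + w' t) \<le> ereal (G' t)" "(\<integral>t. G' t \<partial>M) - Ex + \<epsilon> \<le> a'"
      by (auto simp: C_def)
    have ae: "AE t in M. f t (x + (s *\<^sub>R w t + s' *\<^sub>R w' t)) \<le> ereal (s * G t + s' * G' t)"
      using G(2) G'(2)
    proof eventually_elim
      case (elim t)
      have "s *\<^sub>R (x + w t) + s' *\<^sub>R (x + w' t) = (s + s') *\<^sub>R x + (s *\<^sub>R w t + s' *\<^sub>R w' t)"
        by (simp add: algebra_simps)
      then show ?case using f_convex[OF elim s] s(3) by simp
    qed
    have "(\<integral>t. s * G t + s' * G' t \<partial>M) - Ex + \<epsilon> = s * ((\<integral>t. G t \<partial>M) - Ex + \<epsilon>) + s' * ((\<integral>t. G' t \<partial>M) - Ex + \<epsilon>)"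
    proof -
      have "Ex = s * Ex + s' * Ex" "\<epsilon> = s * \<epsilon> + s' * \<epsilon>"
        using s(3) by (simp_all add: distrib_right[symmetric])
      then show ?thesis using G(1) G'(1) by (simp add: algebra_simps)
    qed
    also have "\<dots> \<le> s * a + s' * a'" using G(3) G'(3) s by (intro add_mono mult_left_mono)
    finally show "(\<lambda>t. s *\<^sub>R w t + s' *\<^sub>R w' t, s * a + s' * a') \<in> C"
      unfolding C_def using ae G(1) G'(1) by (auto intro!: exI[of _ "\<lambda>t. s * G t + s' * G' t"])
  next
    fix c a assume "(\<lambda>t. c, a) \<in> C"
    then obtain G where G: "integrable M G" "AE t in M. f t (x + c) \<le> ereal (G t)" "(\<integral>t. G t \<partial>M) - Ex + \<epsilon> \<le> a"
      by (auto simp: C_def)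
    have "E (x + c) \<le> ereal (\<integral>t. G t \<partial>M)"
      using upper_integral_mono_AE[OF G(2)] by (simp add: integral_functional_def upper_integral_ereal[OF G(1)])
    then have "E (x + c) - ereal Ex + ereal \<epsilon> \<le> ereal (\<integral>t. G t \<partial>M) - ereal Ex + ereal \<epsilon>"
      by (intro add_right_mono ereal_minus_mono) auto
    moreover have "ereal (blinfun_apply u c) \<le> E (x + c) - ereal Ex + ereal \<epsilon>"
      using u_le[of "x + c"] by simp
    ultimately have "ereal (blinfun_apply u c) \<le> ereal (\<integral>t. G t \<partial>M) - ereal Ex + ereal \<epsilon>"
      by (rule order.trans[rotated])
    then show "blinfun_apply u c \<le> a" using G(3) by simp
  next
    fix w :: "'t \<Rightarrow> 'a" assume "bounded (range w)"
    then obtain B where B: "B > 0" "\<And>t. norm (w t) \<le> B" by (auto simp: bounded_pos)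
    have wB: "norm ((\<eta> / B) *\<^sub>R w t) \<le> \<eta>" for t
      using B(1) \<eta> mult_left_mono[OF B(2)[of t], of "\<eta> / B"] by simp
    from ball[of "\<lambda>t. (\<eta> / B) *\<^sub>R w t", OF wB] show "\<exists>s>0. \<exists>a. (\<lambda>t. c0 + s *\<^sub>R w t, a) \<in> C"
      using B(1) \<eta> by (intro exI[of _ "\<eta> / B"] conjI exI[of _ K]) simp_all
  qed (rule bounded_linear.linear, rule blinfun.bounded_linear_right)
  then obtain L where L:
    "\<forall>w w'. bounded (range w) \<longrightarrow> bounded (range w') \<longrightarrow> L (\<lambda>t. w t + w' t) = L w + L w'"
    "\<forall>s w. bounded (range w) \<longrightarrow> L (\<lambda>t. s *\<^sub>R w t) = s * L w"
    "\<forall>c. L (\<lambda>t. c) = blinfun_apply u c"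
    "\<forall>w a. bounded (range w) \<longrightarrow> (w, a) \<in> C \<longrightarrow> L w \<le> a"
    by (elim exE conjE)
  note L_add = L(1)[rule_format] and L_scale = L(2)[rule_format] and L_const = L(3)[rule_format] and L_le = L(4)[rule_format]
  have bf: "bounded_functional M L ((K - blinfun_apply u c0) / \<eta>)"
  proof (rule bounded_functional.intro[OF sigma_fin], unfold_locales)
    show "L w \<le> (K - blinfun_apply u c0) / \<eta> * r" if w: "\<And>t. norm (w t) \<le> r" for w r
    proof (cases "r = 0")
      case True
      then have "w = (\<lambda>t. 0)" using w by auto
      then show ?thesis using L_const[of 0] True by simp
    next
      case False
      have r: "0 < r" using False order.trans[OF norm_ge_zero w] by (simp add: order.strict_iff_order)
      have bw: "bounded (range w)" by (rule bounded_rangeI[OF w])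
      have w': "norm ((\<eta> / r) *\<^sub>R w t) \<le> \<eta>" for t
        using r \<eta> mult_left_mono[OF w[of t], of "\<eta> / r"] by simp
      have b: "bounded (range (\<lambda>t. (\<eta> / r) *\<^sub>R w t))" "bounded (range (\<lambda>t::'t. c0))"
        by (rule bounded_rangeI[OF w'], rule bounded_rangeI[OF order_refl])
      have "bounded (range (\<lambda>t. c0 + (\<eta> / r) *\<^sub>R w t))" by (rule bounded_plus_comp[OF b(2,1)])
      from L_le[OF this ball[of "\<lambda>t. (\<eta> / r) *\<^sub>R w t", OF w']] have "blinfun_apply u c0 + (\<eta> / r) * L w \<le> K"
        using L_add[OF b(2,1)] L_scale[OF bw] L_const by simp
      then show ?thesis using r \<eta> by (simp add: field_simps)
    qed
    show "L w = 0" if w: "bounded (range w)" "AE t in M. w t = 0" for w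
    proof -
      have *: "s * L w \<le> \<epsilon>" for s
      proof -
        have "AE t in M. f t (x + s *\<^sub>R w t) \<le> ereal (Fx t)"
          using w(2) Fx(1) by eventually_elim simp
        from inC[OF Fx(2) this] have "(\<lambda>t. s *\<^sub>R w t, \<epsilon>) \<in> C" by (simp add: Ex_def)
        from L_le[OF _ this] show ?thesis using w(1) by (simp add: L_scale bounded_scaleR_comp)
      qed
      show ?thesis
      proof (rule ccontr)
        assume "L w \<noteq> 0"
        then show False using *[of "(\<epsilon> + 1) / L w"] by simp
      qed
    qed
  qed (use L_add L_scale in auto)
  show ?thesis
  proof (intro exI conjI allI impI)
    show "L w \<le> (\<integral>t. G t \<partial>M) - (\<integral>t. real_of_ereal (f t x) \<partial>M) + \<epsilon>"
      if "bounded (range w)" "integrable M G" "AE t in M. f t (x + w t) \<le> ereal (G t)" for w G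
      using L_le[OF that(1) inC[OF that(2,3)]] by (simp add: Ex_def Fx_def)
  qed (rule bf, rule L_const)
qed

end

section \<open>Integrating the conjugate functions\<close>

lemma integrable_finite_switch:
  fixes \<phi> :: "nat \<Rightarrow> 't \<Rightarrow> real"
  assumes \<phi>: "\<And>i. i \<le> n \<Longrightarrow> integrable M (\<phi> i)" and j[measurable]: "j \<in> measurable M (count_space UNIV)" and jn: "\<And>t. j t \<le> n"
  shows "integrable M (\<lambda>t. \<phi> (j t) t)"
    and "(\<lambda>t. \<phi> (j t) t) = (\<lambda>t. \<Sum>i\<le>n. indicator {t. j t = i} t * \<phi> i t)"
proof -
  show eq: "(\<lambda>t. \<phi> (j t) t) = (\<lambda>t. \<Sum>i\<le>n. indicator {t. j t = i} t * \<phi> i t)"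
  proof
    fix t
    have "(\<Sum>i\<le>n. indicator {t. j t = i} t * \<phi> i t) = (\<Sum>i\<le>n. if i = j t then \<phi> i t else 0)"
      by (intro sum.cong) (auto split: split_indicator)
    then show "\<phi> (j t) t = (\<Sum>i\<le>n. indicator {t. j t = i} t * \<phi> i t)" using jn[of t] by simp
  qed
  have "integrable M (\<lambda>t. indicator {t \<in> space M. j t = i} t *\<^sub>R \<phi> i t)" if "i \<le> n" for i
    by (rule integrable_mult_indicator[OF _ \<phi>[OF that]]) measurable
  moreover have "integrable M (\<lambda>t. indicator {t \<in> space M. j t = i} t *\<^sub>R \<phi> i t) \<longleftrightarrow> integrable M (\<lambda>t. indicator {t. j t = i} t * \<phi> i t)" for i
    by (rule Bochner_Integration.integrable_cong) (auto split: split_indicator)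
  ultimately show "integrable M (\<lambda>t. \<phi> (j t) t)"
    unfolding eq by (intro Bochner_Integration.integrable_sum) auto
qed

text \<open>
  The data produced by \<open>exists_dominated_extension\<close> and \<open>absolutely_continuous_part\<close> for a fixed
  \<open>\<epsilon>\<close>-subgradient \<open>u\<close> at \<open>x\<close>.
\<close>

locale represented_extension = lusin_functional M f x0 k \<eta> + bounded_functional M L C
  for M :: "'t::metric_space measure" and f :: "'t \<Rightarrow> 'a::banach \<Rightarrow> ereal" and x0 k \<eta>
    and L :: "('t \<Rightarrow> 'a) \<Rightarrow> real" and C +
  fixes x :: 'a and u :: "'a \<Rightarrow>\<^sub>L real" and \<epsilon> :: real
    and G :: "nat \<Rightarrow> 't set" and g :: "'t \<Rightarrow> real" and s :: "nat \<Rightarrow> 't \<Rightarrow> ('a \<Rightarrow>\<^sub>L real)" and H :: "'t \<Rightarrow> ('a \<Rightarrow>\<^sub>L real)"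
  assumes x: "x \<in> edom E"
    and L_const: "L (\<lambda>t. c) = u c"
    and L_le: "bounded (range w) \<Longrightarrow> integrable M F \<Longrightarrow> AE t in M. f t (x + w t) \<le> ereal (F t) \<Longrightarrow>
      L w \<le> (\<integral>t. F t \<partial>M) - (\<integral>t. real_of_ereal (f t x) \<partial>M) + \<epsilon>"
    and G[measurable]: "G n \<in> sets M" and G_inc: "incseq G" and AE_G: "AE t in M. t \<in> (\<Union>n. G n)"
    and g_int: "integrable M g" and g0: "0 \<le> g t"
    and s_simple: "simple_function M (s n)" and s_lim: "(\<lambda>n. s n t) \<longlonglongrightarrow> H t"
    and H_le: "norm (H t) \<le> 2 * g t"
    and L_cut: "A \<in> sets M \<Longrightarrow> A \<subseteq> G N \<Longrightarrow> L (cut A (\<lambda>t. y)) = (\<integral>t. indicator A t * H t y \<partial>M)"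
    and L_abs: "A \<in> sets M \<Longrightarrow> A \<subseteq> G N \<Longrightarrow> (\<And>t. norm (w t) \<le> r) \<Longrightarrow> (\<And>t. t \<notin> A \<Longrightarrow> w t = 0) \<Longrightarrow>
      \<bar>L w\<bar> \<le> r * (\<integral>t. indicator A t * g t \<partial>M)"
begin

lemma H_Bochner: "H \<in> L1_Bochner M"
proof -
  interpret complete_measure M by (rule complete)
  have sm: "strongly_measurable M H" using s_simple s_lim by (auto simp: strongly_measurable_def)
  have "integrable M (\<lambda>t. norm (H t))"
  proof (rule Bochner_Integration.integrable_bound)
    show "integrable M (\<lambda>t. 2 * g t)" using g_int by simp
    show "(\<lambda>t. norm (H t)) \<in> borel_measurable M"
      by (rule continuous_strongly_measurable[OF sm]) (intro continuous_intros)
    show "AE t in M. norm (norm (H t)) \<le> norm (2 * g t)" using H_le g0 by (intro AE_I2) simp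
  qed
  with sm show ?thesis by (simp add: L1_Bochner_def)
qed

lemma H_app_measurable[measurable]: "(\<lambda>t. H t y) \<in> borel_measurable M"
  by (rule borel_measurable_LIMSEQ_real[where u = "\<lambda>n t. blinfun_apply (s n t) y"])
    (auto intro!: tendsto_intros s_lim borel_measurable_simple_function simple_function_compose1[OF s_simple])

lemma H_int: "integrable M (\<lambda>t. H t y)"
proof (rule Bochner_Integration.integrable_bound)
  show "integrable M (\<lambda>t. norm (H t) * norm y)"
    using H_Bochner by (intro integrable_mult_left) (simp add: L1_Bochner_def)
  show "AE t in M. norm (H t y) \<le> norm (norm (H t) * norm y)"
  proof (rule AE_I2)
    show "norm (H t y) \<le> norm (norm (H t) * norm y)" for t
      using norm_blinfun[of "H t" y] by simp
  qed
qed measurable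

lemma int_ind: "integrable M \<phi> \<Longrightarrow> A \<in> sets M \<Longrightarrow> integrable M (\<lambda>t. indicator A t * \<phi> t)" for \<phi> :: "'t \<Rightarrow> real"
  using integrable_mult_indicator[of A M \<phi>] by simp

lemma L_sum:
  assumes "\<And>i. i \<in> I \<Longrightarrow> bounded (range (w i))" "finite I"
  shows "L (\<lambda>t. \<Sum>i\<in>I. w i t) = (\<Sum>i\<in>I. L (w i)) \<and> bounded (range (\<lambda>t. \<Sum>i\<in>I. w i t))"
  using assms(2,1)
proof (induction I rule: finite_induct)
  case empty
  then show ?case by (simp add: L_zero)
next
  case (insert i I)
  then have "bounded (range (w i))" "bounded (range (\<lambda>t. \<Sum>i\<in>I. w i t))" by auto
  from L_add[OF this] bounded_plus_comp[OF this] insert show ?case by simp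
qed

text \<open>
  The part of \<open>\<epsilon>\<close> that the candidate \<open>u - \<integral> H\<close> for the normal part leaves over at \<open>z\<close>.
\<close>

abbreviation slack where "slack z \<equiv> \<epsilon> - (u (z - x) - (\<integral>t. H t (z - x) \<partial>M))"

definition Fx where "Fx t = real_of_ereal (f t x)"

lemma f_x: "AE t in M. f t x = ereal (Fx t)"
  and Fx: "integrable M Fx"
  using E_dom(1,2)[OF x] by (simp_all add: Fx_def[abs_def])

lemma L_le': "bounded (range w) \<Longrightarrow> integrable M F \<Longrightarrow> AE t in M. f t (x + w t) \<le> ereal (F t) \<Longrightarrow>
      L w \<le> (\<integral>t. F t \<partial>M) - (\<integral>t. Fx t \<partial>M) + \<epsilon>"
  unfolding Fx_def by (rule L_le)

text \<open>
  \<open>L\<close> is known on step functions supported in \<open>G N\<close>.  A function \<open>\<sigma>\<close>, possibly nonmeasurable, that stays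
  within \<open>r i\<close> of the constant \<open>Y i\<close> on each piece differs from a step function by an error that the total variation
  controls.  So approximate selections suffice and need not be measurable.
\<close>

lemma L_cut_ge:
  fixes j :: "'t \<Rightarrow> nat"
  assumes j[measurable]: "j \<in> measurable M (count_space UNIV)" and jn: "\<And>t. j t \<le> n"
    and \<sigma>: "\<And>t. norm (\<sigma> t - Y (j t)) \<le> r (j t)"
  shows "(\<integral>t. indicator (G N) t * (H t (Y (j t) - x) - r (j t) * g t) \<partial>M) \<le> L (cut (G N) (\<lambda>t. \<sigma> t - x))"
    and "bounded (range (\<lambda>t. \<sigma> t - x))"
proof -
  define A where "A i = {t \<in> G N. j t = i}" for i
  have A[measurable]: "A i \<in> sets M" for i
  proof -
    have "A i = G N \<inter> {t \<in> space M. j t = i}" by (auto simp: A_def space_UNIV)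
    then show ?thesis by simp
  qed
  have AG: "A i \<subseteq> G N" for i by (auto simp: A_def)
  have "norm (\<sigma> t - x) \<le> (\<Sum>i\<le>n. norm (Y i - x) + \<bar>r i\<bar>)" for t
  proof -
    have "norm (\<sigma> t - x) \<le> norm (\<sigma> t - Y (j t)) + norm (Y (j t) - x)"
      using norm_triangle_ineq[of "\<sigma> t - Y (j t)" "Y (j t) - x"] by simp
    also have "\<dots> \<le> norm (Y (j t) - x) + \<bar>r (j t)\<bar>" using \<sigma>[of t] by simp
    also have "\<dots> \<le> (\<Sum>i\<le>n. norm (Y i - x) + \<bar>r i\<bar>)"
      using jn[of t] by (intro member_le_sum) auto
    finally show ?thesis .
  qed
  then show bdd: "bounded (range (\<lambda>t. \<sigma> t - x))" by (rule bounded_rangeI)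
  have "cut (G N) (\<lambda>t. \<sigma> t - x) = (\<lambda>t. \<Sum>i\<le>n. cut (A i) (\<lambda>t. \<sigma> t - x) t)"
  proof
    fix t
    have "(\<Sum>i\<le>n. cut (A i) (\<lambda>t. \<sigma> t - x) t) = (\<Sum>i\<le>n. if i = j t then cut (G N) (\<lambda>t. \<sigma> t - x) t else 0)"
      by (intro sum.cong) (auto simp: cut_def A_def)
    then show "cut (G N) (\<lambda>t. \<sigma> t - x) t = (\<Sum>i\<le>n. cut (A i) (\<lambda>t. \<sigma> t - x) t)" using jn[of t] by simp
  qed
  then have L_eq: "L (cut (G N) (\<lambda>t. \<sigma> t - x)) = (\<Sum>i\<le>n. L (cut (A i) (\<lambda>t. \<sigma> t - x)))"
    using L_sum[of "{..n}" "\<lambda>i. cut (A i) (\<lambda>t. \<sigma> t - x)"] bounded_cut[OF bdd] by simp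
  have piece: "(\<integral>t. indicator (A i) t * (H t (Y i - x) - r i * g t) \<partial>M) \<le> L (cut (A i) (\<lambda>t. \<sigma> t - x))" for i
  proof -
    define d where "d = cut (A i) (\<lambda>t. \<sigma> t - Y i)"
    show ?thesis
    proof (cases "A i = {}")
      case True
      have "cut (A i) (\<lambda>t. \<sigma> t - x) = (\<lambda>t. 0)" by (simp add: cut_def True fun_eq_iff)
      then show ?thesis by (simp add: True L_zero)
    next
      case False
      then obtain t0 where "j t0 = i" by (auto simp: A_def)
      then have r: "0 \<le> r i" using order.trans[OF norm_ge_zero \<sigma>[of t0]] by simp
      have d: "norm (d t) \<le> r i" for t
        using \<sigma>[of t] r by (auto simp: d_def cut_def A_def)
      have b: "bounded (range (cut (A i) (\<lambda>t. Y i - x)))"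
        by (rule bounded_cut, rule bounded_rangeI, rule order_refl)
      have "cut (A i) (\<lambda>t. \<sigma> t - x) = (\<lambda>t. cut (A i) (\<lambda>t. Y i - x) t + d t)"
        by (auto simp: d_def cut_def)
      then have "L (cut (A i) (\<lambda>t. \<sigma> t - x)) = L (cut (A i) (\<lambda>t. Y i - x)) + L d"
        using L_add[OF b bounded_rangeI[OF d]] by simp
      moreover have "\<bar>L d\<bar> \<le> r i * (\<integral>t. indicator (A i) t * g t \<partial>M)"
        by (rule L_abs[OF A AG d]) (simp add: d_def cut_def)
      moreover have "(\<integral>t. indicator (A i) t * (H t (Y i - x) - r i * g t) \<partial>M)
        = (\<integral>t. indicator (A i) t * H t (Y i - x) \<partial>M) - r i * (\<integral>t. indicator (A i) t * g t \<partial>M)"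
        using int_ind[OF H_int A[of i]] int_ind[OF g_int A[of i]]
        by (simp add: right_diff_distrib mult.left_commute[of _ "r i"])
      ultimately show ?thesis using L_cut[OF A AG, of i "Y i - x"] by linarith
    qed
  qed
  have "(\<integral>t. indicator (G N) t * (H t (Y (j t) - x) - r (j t) * g t) \<partial>M)
    = (\<integral>t. (\<Sum>i\<le>n. indicator (A i) t * (H t (Y i - x) - r i * g t)) \<partial>M)"
  proof (rule Bochner_Integration.integral_cong[OF refl])
    fix t
    have "(\<Sum>i\<le>n. indicator (A i) t * (H t (Y i - x) - r i * g t))
      = (\<Sum>i\<le>n. if i = j t then indicator (G N) t * (H t (Y i - x) - r i * g t) else 0)"
      by (intro sum.cong) (auto simp: A_def split: split_indicator)
    then show "indicator (G N) t * (H t (Y (j t) - x) - r (j t) * g t)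
      = (\<Sum>i\<le>n. indicator (A i) t * (H t (Y i - x) - r i * g t))" using jn[of t] by simp
  qed
  also have "\<dots> = (\<Sum>i\<le>n. \<integral>t. indicator (A i) t * (H t (Y i - x) - r i * g t) \<partial>M)"
    by (intro Bochner_Integration.integral_sum int_ind Bochner_Integration.integrable_diff H_int integrable_mult_right g_int A)
  also have "\<dots> \<le> L (cut (G N) (\<lambda>t. \<sigma> t - x))" unfolding L_eq by (intro sum_mono piece)
  finally show "(\<integral>t. indicator (G N) t * (H t (Y (j t) - x) - r (j t) * g t) \<partial>M) \<le> L (cut (G N) (\<lambda>t. \<sigma> t - x))" .
qed

text \<open>
  On \<open>G N\<close> choose points of the balls that almost attain the infima, off \<open>G N\<close> take the constant \<open>z\<close>, and
  apply the bound on \<open>L\<close> to the resulting function.  As \<open>N \<rightarrow> \<infinity>\<close>, the integral of \<open>f\<^sub>t z\<close> off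
  \<open>G N\<close> vanishes, while \<open>L\<close> of the function that is \<open>z - x\<close> off \<open>G N\<close> and zero on it tends to
  \<open>\<langle>u, z - x\<rangle> - \<integral> \<langle>H t, z - x\<rangle>\<close>: the part of \<open>L\<close> that is singular with respect to \<open>M\<close> sees only \<open>z\<close>.
\<close>

lemma selection_inequality:
  fixes j :: "'t \<Rightarrow> nat"
  assumes z: "z \<in> edom E" and j[measurable]: "j \<in> measurable M (count_space UNIV)" and jn: "\<And>t. j t \<le> n"
    and r: "\<And>i. 0 < r i" and q: "integrable M q"
    and inf_q: "AE t in M. ball_inf (f t) (Y (j t)) (r (j t)) \<le> ereal (q t)"
  shows "(\<integral>t. H t (Y (j t) - x) - r (j t) * g t - q t + Fx t \<partial>M)
    \<le> slack z"
proof -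
  define Fz where "Fz t = real_of_ereal (f t z)" for t
  have f_z: "AE t in M. f t z = ereal (Fz t)" and Fz: "integrable M Fz"
    using E_dom(1,2)[OF z] by (simp_all add: Fz_def[abs_def])
  \<comment> \<open>The infima over balls need not be attained; the margin \<open>\<delta> * h0 t\<close> has a small integral.\<close>
  obtain h0 :: "'t \<Rightarrow> real" where h0: "\<And>t. h0 t > 0" "integrable M h0"
    using obtain_positive_integrable_function by metis
  define \<Phi> where "\<Phi> t = H t (Y (j t) - x) - r (j t) * g t" for t
  have \<Phi>: "integrable M \<Phi>"
    unfolding \<Phi>_def[abs_def]
    by (intro integrable_finite_switch(1)[OF _ j jn, where \<phi> = "\<lambda>i t. H t (Y i - x) - r i * g t"]
        Bochner_Integration.integrable_diff H_int integrable_mult_right g_int)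
  define \<Psi> where "\<Psi> t = \<Phi> t - q t - H t (z - x) + Fz t" for t
  have \<Psi>: "integrable M \<Psi>"
    unfolding \<Psi>_def[abs_def] by (intro Bochner_Integration.integrable_diff Bochner_Integration.integrable_add \<Phi> q H_int Fz)
  define c where "c = u (z - x)"
  have bound: "(\<integral>t. indicator (G N) t * \<Psi> t \<partial>M) + c \<le> (\<integral>t. Fz t \<partial>M) - (\<integral>t. Fx t \<partial>M) + \<epsilon> + (1 / Suc N) * (\<integral>t. h0 t \<partial>M)" for N
  proof -
    define \<delta> :: real where "\<delta> = 1 / Suc N"
    have \<delta>: "0 < \<delta>" by (simp add: \<delta>_def)
    have "\<exists>y\<in>ball (Y (j t)) (r (j t)). ball_inf (f t) (Y (j t)) (r (j t)) \<le> ereal (q t) \<longrightarrow> f t y \<le> ereal (q t + \<delta> * h0 t)" for t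
    proof (cases "ball_inf (f t) (Y (j t)) (r (j t)) \<le> ereal (q t)")
      case True
      also have "ereal (q t) < ereal (q t + \<delta> * h0 t)" using \<delta> h0 by simp
      finally show ?thesis by (auto simp: ball_inf_less_iff intro: less_imp_le)
    next
      case False
      then show ?thesis using r[of "j t"] by (intro bexI[of _ "Y (j t)"]) auto
    qed
    then obtain \<sigma> where \<sigma>: "\<And>t. \<sigma> t \<in> ball (Y (j t)) (r (j t))"
      and \<sigma>_le: "\<And>t. ball_inf (f t) (Y (j t)) (r (j t)) \<le> ereal (q t) \<Longrightarrow> f t (\<sigma> t) \<le> ereal (q t + \<delta> * h0 t)" by metis
    have \<sigma>_norm: "norm (\<sigma> t - Y (j t)) \<le> r (j t)" for t
      using \<sigma>[of t] by (simp add: dist_norm norm_minus_commute)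
    note Lge = L_cut_ge[where j = j and n = n and \<sigma> = \<sigma> and Y = Y and r = r, OF j jn \<sigma>_norm]
    define w where "w t = (if t \<in> G N then \<sigma> t - x else z - x)" for t
    have bz: "bounded (range (\<lambda>t::'t. z - x))" by (rule bounded_rangeI, rule order_refl)
    have b1: "bounded (range (cut (G N) (\<lambda>t. \<sigma> t - x)))" by (rule bounded_cut[OF Lge(2)])
    have b2: "bounded (range (cut (G N) (\<lambda>t. z - x)))" by (rule bounded_cut[OF bz])
    have b3: "bounded (range (\<lambda>t. (-1) *\<^sub>R cut (G N) (\<lambda>t. z - x) t))" by (rule bounded_scaleR_comp[OF b2])
    have b4: "bounded (range (\<lambda>t. (z - x) + (-1) *\<^sub>R cut (G N) (\<lambda>t. z - x) t))" by (rule bounded_plus_comp[OF bz b3])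
    have w_eq: "w = (\<lambda>t. cut (G N) (\<lambda>t. \<sigma> t - x) t + ((z - x) + (-1) *\<^sub>R cut (G N) (\<lambda>t. z - x) t))"
      by (auto simp: w_def cut_def)
    have Lw: "L w = L (cut (G N) (\<lambda>t. \<sigma> t - x)) + c - (\<integral>t. indicator (G N) t * H t (z - x) \<partial>M)"
      unfolding w_eq L_add[OF b1 b4] L_add[OF bz b3] L_scale[OF b2] L_const L_cut[OF G order_refl]
      by (simp add: c_def)
    have bw: "bounded (range w)" unfolding w_eq by (rule bounded_plus_comp[OF b1 b4])
    define F where "F t = indicator (G N) t * (q t + \<delta> * h0 t) + (Fz t - indicator (G N) t * Fz t)" for t
    have F: "integrable M F"
      unfolding F_def[abs_def]
      by (intro Bochner_Integration.integrable_add Bochner_Integration.integrable_diff int_ind integrable_mult_right q h0 Fz G)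
    have "AE t in M. f t (x + w t) \<le> ereal (F t)"
      using inf_q f_z
    proof eventually_elim
      case (elim t)
      then show ?case using \<sigma>_le[of t] by (simp add: w_def F_def)
    qed
    from L_le'[OF bw F this] have "L w \<le> (\<integral>t. F t \<partial>M) - (\<integral>t. Fx t \<partial>M) + \<epsilon>" .
    moreover have "(\<integral>t. F t \<partial>M) = (\<integral>t. indicator (G N) t * q t \<partial>M) + \<delta> * (\<integral>t. indicator (G N) t * h0 t \<partial>M)
      + (\<integral>t. Fz t \<partial>M) - (\<integral>t. indicator (G N) t * Fz t \<partial>M)"
    proof -
      have "F = (\<lambda>t. indicator (G N) t * q t + \<delta> * (indicator (G N) t * h0 t) + Fz t - indicator (G N) t * Fz t)"
        by (auto simp: F_def algebra_simps)
      then show ?thesis using int_ind[OF q G] int_ind[OF h0(2) G] Fz int_ind[OF Fz G] by simp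
    qed
    moreover have "(\<integral>t. indicator (G N) t * h0 t \<partial>M) \<le> (\<integral>t. h0 t \<partial>M)"
      using int_ind[OF h0(2) G] h0 by (intro integral_mono) (auto split: split_indicator intro: less_imp_le)
    then have "\<delta> * (\<integral>t. indicator (G N) t * h0 t \<partial>M) \<le> \<delta> * (\<integral>t. h0 t \<partial>M)" using \<delta> by simp
    moreover have "(\<integral>t. indicator (G N) t * \<Psi> t \<partial>M) = (\<integral>t. indicator (G N) t * \<Phi> t \<partial>M) - (\<integral>t. indicator (G N) t * q t \<partial>M)
      - (\<integral>t. indicator (G N) t * H t (z - x) \<partial>M) + (\<integral>t. indicator (G N) t * Fz t \<partial>M)"
      unfolding \<Psi>_def right_diff_distrib distrib_left
      using int_ind[OF \<Phi> G] int_ind[OF q G] int_ind[OF H_int G] int_ind[OF Fz G] by simp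
    ultimately show ?thesis using Lge(1)[of N] Lw unfolding \<Phi>_def[symmetric] \<delta>_def by linarith
  qed
  have "(\<lambda>N. \<integral>t. indicator (G N) t * \<Psi> t \<partial>M) \<longlonglongrightarrow> (\<integral>t. \<Psi> t \<partial>M)"
  proof (rule integral_dominated_convergence[where w = "\<lambda>t. \<bar>\<Psi> t\<bar>"])
    show "AE t in M. (\<lambda>N. indicator (G N) t * \<Psi> t) \<longlonglongrightarrow> \<Psi> t"
      using AE_G
    proof eventually_elim
      case (elim t)
      then obtain N where "t \<in> G N" by blast
      then have "eventually (\<lambda>n. indicator (G n) t * \<Psi> t = \<Psi> t) sequentially"
        using incseqD[OF G_inc] by (intro eventually_mono[OF eventually_ge_at_top[of N]]) (auto split: split_indicator)
      then show ?case by (rule tendsto_eventually)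
    qed
  qed (use \<Psi> in \<open>auto split: split_indicator\<close>)
  moreover have "(\<lambda>N. (\<integral>t. Fz t \<partial>M) - (\<integral>t. Fx t \<partial>M) + \<epsilon> + (1 / Suc N) * (\<integral>t. h0 t \<partial>M)) \<longlonglongrightarrow>
    (\<integral>t. Fz t \<partial>M) - (\<integral>t. Fx t \<partial>M) + \<epsilon> + 0 * (\<integral>t. h0 t \<partial>M)"
    using LIMSEQ_inverse_real_of_nat by (intro tendsto_intros) (simp add: inverse_eq_divide)
  ultimately have "(\<integral>t. \<Psi> t \<partial>M) + c \<le> (\<integral>t. Fz t \<partial>M) - (\<integral>t. Fx t \<partial>M) + \<epsilon> + 0 * (\<integral>t. h0 t \<partial>M)"
    using bound by (intro LIMSEQ_le[OF tendsto_add[OF _ tendsto_const]]) auto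
  moreover have "(\<integral>t. \<Psi> t \<partial>M) = (\<integral>t. \<Phi> t \<partial>M) - (\<integral>t. q t \<partial>M) - (\<integral>t. H t (z - x) \<partial>M) + (\<integral>t. Fz t \<partial>M)"
    unfolding \<Psi>_def using \<Phi> q H_int Fz by simp
  moreover have "(\<integral>t. \<Phi> t - q t + Fx t \<partial>M) = (\<integral>t. \<Phi> t \<partial>M) - (\<integral>t. q t \<partial>M) + (\<integral>t. Fx t \<partial>M)"
    using \<Phi> q Fx by simp
  ultimately show ?thesis unfolding c_def \<Phi>_def by linarith
qed

text \<open>
  The sampling balls as a sequence.  Its first ball has centre \<open>x\<close>, which later gives an
  integrable lower bound for the partial suprema.
\<close>

lemma exists_sampling_sequence:
  "\<exists>(Y :: nat \<Rightarrow> 'a) r. (\<forall>i. 0 < r i \<and> r i \<le> 1) \<and> Y 0 = x \<and>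
    (AE t in M. \<forall>y a e. f t y < ereal a \<longrightarrow> 0 < e \<longrightarrow>
      (\<exists>i. ball_inf (f t) (Y i) (r i) < ereal a \<and> H t y - e < H t (Y i) - r i * g t))"
proof -
  from lusin_integrand_compact_cover[OF sigma_fin borel lusin] obtain B where
    B': "\<forall>k. compact (B k) \<and> lsc_multifun_on (B k) (\<lambda>t. epi (f t))" and ae: "AE t in M. t \<in> (\<Union>k::nat. B k)"
    by (elim exE conjE)
  have B: "compact (B k)" "lsc_multifun_on (B k) (\<lambda>t. epi (f t))" for k using B' by auto
  define \<Xi> where "\<Xi> = (\<Union>n. range (s n))"
  have \<Xi>: "countable \<Xi>"
    unfolding \<Xi>_def using simple_functionD(1)[OF s_simple] by (intro countable_UN) (auto simp: space_UNIV intro: countable_finite)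
  have H_closure: "H t \<in> closure \<Xi>" for t
    unfolding closure_sequential by (intro exI[of _ "\<lambda>n. s n t"] conjI s_lim) (auto simp: \<Xi>_def)
  from countable_sampling[where B = B, OF B \<Xi>, where H = H and g = g] obtain S where S: "countable S" "\<forall>(y, r)\<in>S. 0 < r \<and> r \<le> 1"
    and samp: "\<forall>t\<in>(\<Union>k. B k). H t \<in> closure \<Xi> \<longrightarrow> 0 \<le> g t \<longrightarrow> (\<forall>y a e. f t y < ereal a \<longrightarrow> 0 < e \<longrightarrow>
      (\<exists>(y', r)\<in>S. ball_inf (f t) y' r < ereal a \<and> H t y - e < H t y' - r * g t))"
    by (elim exE conjE)
  define yr where "yr i = (case i of 0 \<Rightarrow> (x, 1) | Suc i \<Rightarrow> from_nat_into (insert (x, 1) S) i)" for i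
  have range: "range yr = insert (x, 1) S"
  proof -
    have "range yr = yr ` insert 0 (range Suc)" by (simp only: UNIV_nat_eq[symmetric])
    also have "\<dots> = insert (x, 1) (range (from_nat_into (insert (x, 1) S)))"
      by (simp add: yr_def image_image)
    also have "range (from_nat_into (insert (x, 1) S)) = insert (x, 1) S"
      using S(1) by (intro range_from_nat_into) auto
    finally show ?thesis by simp
  qed
  have r: "0 < snd (yr i) \<and> snd (yr i) \<le> 1" for i
  proof -
    have "yr i \<in> insert (x, 1) S" using range by blast
    then show ?thesis using S(2) by (cases "yr i") auto
  qed
  have "AE t in M. \<forall>y a e. f t y < ereal a \<longrightarrow> 0 < e \<longrightarrow>
      (\<exists>i. ball_inf (f t) (fst (yr i)) (snd (yr i)) < ereal a \<and>
        H t y - e < H t (fst (yr i)) - snd (yr i) * g t)"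
    using ae
  proof eventually_elim
    case (elim t)
    show ?case
    proof (intro allI impI)
      fix y a and e :: real assume "f t y < ereal a" "0 < e"
      then obtain p where p: "p \<in> S" "ball_inf (f t) (fst p) (snd p) < ereal a"
        "H t y - e < H t (fst p) - snd p * g t"
        using bspec[OF samp elim, THEN mp, OF H_closure, THEN mp, OF g0, rule_format, of y a e] by force
      obtain i where "p = yr i" using p(1) range by (metis UNIV_I imageE insertI2)
      then show "\<exists>i. ball_inf (f t) (fst (yr i)) (snd (yr i)) < ereal a \<and>
        H t y - e < H t (fst (yr i)) - snd (yr i) * g t" using p by blast
    qed
  qed
  then show ?thesis using r by (intro exI[of _ "fst \<circ> yr"] exI[of _ "snd \<circ> yr"]) (simp add: yr_def)
qed

text \<open>
  The function \<open>l\<close> is the supremum of the sampled expressions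
  \<open>\<psi> i t = \<langle>H t, Y i - x\<rangle> - r i * g t + f\<^sub>t x - inf f\<^sub>t (ball (Y i) (r i))\<close>.  The maximum over \<open>i \<le> n\<close> is attained at a measurable
  index \<open>j n t\<close>, to which the selection inequality applies; it bounds the integral of the maximum independently
  of \<open>n\<close>, and monotone convergence bounds the integral of \<open>l\<close>.
\<close>

lemma integral_conjugate_bound:
  "\<exists>l. integrable M l \<and> (\<forall>z\<in>edom E. (\<integral>t. l t \<partial>M) \<le> slack z) \<and>
    (AE t in M. \<forall>y b. f t y = ereal b \<longrightarrow> H t (y - x) \<le> b - Fx t + l t)"
proof -
  from exists_sampling_sequence obtain Y :: "nat \<Rightarrow> 'a" and r where r': "\<forall>i. 0 < r i \<and> r i \<le> 1" and Y0: "Y 0 = x"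
    and samp: "AE t in M. \<forall>y a e. f t y < ereal a \<longrightarrow> 0 < e \<longrightarrow>
      (\<exists>i. ball_inf (f t) (Y i) (r i) < ereal a \<and> H t y - e < H t (Y i) - r i * g t)"
    by (elim exE conjE)
  have r: "0 < r i" "r i \<le> 1" for i using r' by auto
  define a where "a i t = H t (Y i - x) - r i * g t + Fx t" for i t
  have a: "integrable M (a i)" for i
    unfolding a_def[abs_def]
    by (intro Bochner_Integration.integrable_add Bochner_Integration.integrable_diff H_int integrable_mult_right g_int Fx)
  have [measurable]: "a i \<in> borel_measurable M" for i using a by auto
  have [measurable]: "g \<in> borel_measurable M" using g_int by auto
  define m where "m i t = ball_inf (f t) (Y i) (r i)" for i t
  have [measurable]: "m i \<in> borel_measurable M" for i unfolding m_def[abs_def] by measurable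
  define \<psi> where "\<psi> i t = ereal (a i t) - m i t" for i t
  have [measurable]: "\<psi> i \<in> borel_measurable M" for i unfolding \<psi>_def[abs_def] by measurable
  define R where "R i = dist x0 (Y i) + 1" for i
  have m_ge: "ereal (minorant (R i) t) \<le> m i t" for i t
    unfolding m_def ball_inf_def
  proof (rule INF_greatest)
    fix y assume "y \<in> ball (Y i) (r i)"
    then have "dist x0 y \<le> R i"
      using dist_triangle[of x0 y "Y i"] r(2)[of i] by (simp add: R_def)
    then show "ereal (minorant (R i) t) \<le> f t y"
      by (rule minorant_le) (simp add: R_def add_nonneg_pos)
  qed
  have \<psi>_le: "\<psi> i t \<le> ereal (a i t - minorant (R i) t)" for i t
    using ereal_minus_mono[OF order_refl[of "ereal (a i t)"] m_ge[of i t]] by (simp add: \<psi>_def)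
  have \<psi>_0: "AE t in M. ereal (- g t) \<le> \<psi> 0 t"
    using f_x
  proof eventually_elim
    case (elim t)
    have "m 0 t \<le> ereal (Fx t)"
      using ball_inf_le[of x "Y 0" "r 0" "f t"] r(1)[of 0] elim by (simp add: m_def Y0)
    then have "ereal (a 0 t) - ereal (Fx t) \<le> \<psi> 0 t"
      unfolding \<psi>_def by (intro ereal_minus_mono) auto
    moreover have "- g t \<le> a 0 t - Fx t"
      using mult_right_mono[OF r(2)[of 0] g0[of t]] by (simp add: a_def Y0)
    ultimately show ?case by (metis ereal_less_eq(3) ereal_minus(1) order.trans)
  qed
  define Ln where "Ln n t = (SUP i\<in>{..n}. \<psi> i t)" for n t
  have Ln_meas[measurable]: "Ln n \<in> borel_measurable M" for n unfolding Ln_def[abs_def] by measurable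
  have \<psi>_Ln: "\<psi> i t \<le> Ln n t" if "i \<le> n" for i n t
    unfolding Ln_def using that by (intro SUP_upper) auto
  have attained: "\<exists>i. i \<le> n \<and> \<psi> i t = Ln n t" for n t
  proof -
    have "Ln n t = Max ((\<lambda>i. \<psi> i t) ` {..n})" unfolding Ln_def by (simp add: Max_Sup)
    then have "Ln n t \<in> (\<lambda>i. \<psi> i t) ` {..n}" using Max_in[of "(\<lambda>i. \<psi> i t) ` {..n}"] by simp
    then show ?thesis by force
  qed
  define j where "j n t = (LEAST i. i \<le> n \<and> \<psi> i t = Ln n t)" for n t
  have j_meas[measurable]: "j n \<in> measurable M (count_space UNIV)" for n
    unfolding j_def[abs_def] by measurable
  have j: "j n t \<le> n" "\<psi> (j n t) t = Ln n t" for n t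
    using LeastI_ex[OF attained, of n t] unfolding j_def by auto
  define l' where "l' n t = real_of_ereal (Ln n t)" for n t
  have Ln_real: "AE t in M. Ln n t = ereal (l' n t) \<and> - g t \<le> l' n t \<and> l' n t \<le> a (j n t) t - minorant (R (j n t)) t" for n
    using \<psi>_0
  proof eventually_elim
    case (elim t)
    have "ereal (- g t) \<le> Ln n t" using elim \<psi>_Ln[of 0 n t] by (auto intro: order.trans)
    moreover have "Ln n t \<le> ereal (a (j n t) t - minorant (R (j n t)) t)"
      using \<psi>_le[of "j n t" t] j(2)[of n t] by simp
    ultimately show ?case by (cases "Ln n t") (auto simp: l'_def)
  qed
  have sw: "integrable M (\<lambda>t. a (j n t) t)" "integrable M (\<lambda>t. minorant (R (j n t)) t)" for n
    using integrable_finite_switch(1)[where \<phi> = a and j = "j n" and n = n, OF a j_meas j(1)]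
      integrable_finite_switch(1)[where \<phi> = "\<lambda>i. minorant (R i)" and j = "j n" and n = n, OF minorant_integrable j_meas j(1)] by auto
  have l'_meas[measurable]: "l' n \<in> borel_measurable M" for n unfolding l'_def[abs_def] by measurable
  have l'_int: "integrable M (l' n)" for n
  proof (rule Bochner_Integration.integrable_bound)
    show "integrable M (\<lambda>t. g t + \<bar>a (j n t) t - minorant (R (j n t)) t\<bar>)"
      by (intro Bochner_Integration.integrable_add g_int integrable_abs Bochner_Integration.integrable_diff sw)
    show "AE t in M. norm (l' n t) \<le> norm (g t + \<bar>a (j n t) t - minorant (R (j n t)) t\<bar>)"
      using Ln_real[of n]
    proof eventually_elim
      case (elim t)
      then show ?case
        using g0[of t] abs_ge_self[of "a (j n t) t - minorant (R (j n t)) t"] by auto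
    qed
  qed measurable
  define q where "q n t = a (j n t) t - l' n t" for n t
  have q_int: "integrable M (q n)" for n unfolding q_def[abs_def] by (intro Bochner_Integration.integrable_diff sw l'_int)
  have inf_q: "AE t in M. ball_inf (f t) (Y (j n t)) (r (j n t)) \<le> ereal (q n t)" for n
    using Ln_real[of n]
  proof eventually_elim
    case (elim t)
    have "ereal (a (j n t) t) - m (j n t) t = ereal (l' n t)"
      using elim j(2)[of n t] by (simp add: \<psi>_def)
    then show ?case unfolding m_def[symmetric] q_def by (cases "m (j n t) t") auto
  qed
  have l'_le: "(\<integral>t. l' n t \<partial>M) \<le> slack z"
    if z: "z \<in> edom E" for n z
  proof -
    have "(\<integral>t. l' n t \<partial>M) = (\<integral>t. H t (Y (j n t) - x) - r (j n t) * g t - q n t + Fx t \<partial>M)"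
      by (simp add: q_def a_def)
    also have "\<dots> \<le> slack z"
      by (rule selection_inequality[OF z j_meas j(1) r(1) q_int inf_q])
    finally show ?thesis .
  qed
  \<comment> \<open>Adding \<open>g\<close> makes the maxima nonnegative, since they are at least \<open>\<psi> 0 t \<ge> - g t\<close>.\<close>
  define W where "W t = (SUP n. ennreal (l' n t + g t))" for t
  have W_meas[measurable]: "W \<in> borel_measurable M" unfolding W_def[abs_def] by measurable
  have Ln_mono: "Ln n t \<le> Ln (Suc n) t" for n t
    unfolding Ln_def by (rule SUP_subset_mono) auto
  have all_real: "AE t in M. \<forall>n. Ln n t = ereal (l' n t) \<and> - g t \<le> l' n t \<and> l' n t \<le> a (j n t) t - minorant (R (j n t)) t"
    unfolding AE_all_countable using Ln_real by blast
  have W_le: "(\<integral>\<^sup>+t. W t \<partial>M) \<le> ennreal (slack z + (\<integral>t. g t \<partial>M))"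
    if z: "z \<in> edom E" for z
  proof -
    have "(\<integral>\<^sup>+t. W t \<partial>M) = (SUP n. \<integral>\<^sup>+t. ennreal (l' n t + g t) \<partial>M)"
      unfolding W_def
    proof (rule nn_integral_monotone_convergence_SUP_AE)
      show "AE t in M. ennreal (l' n t + g t) \<le> ennreal (l' (Suc n) t + g t)" for n
        using all_real
      proof eventually_elim
        case (elim t)
        then have "ereal (l' n t) \<le> ereal (l' (Suc n) t)" using Ln_mono[of n t] by metis
        then show ?case by (intro ennreal_leI) simp
      qed
    qed measurable
    also have "\<dots> \<le> ennreal (slack z + (\<integral>t. g t \<partial>M))"
    proof (rule SUP_least)
      fix n
      have "(\<integral>\<^sup>+t. ennreal (l' n t + g t) \<partial>M) = ennreal (\<integral>t. l' n t + g t \<partial>M)"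
      proof (rule nn_integral_eq_integral)
        show "integrable M (\<lambda>t. l' n t + g t)" using l'_int g_int by simp
        show "AE t in M. 0 \<le> l' n t + g t"
          using Ln_real[of n] by eventually_elim linarith
      qed
      also have "(\<integral>t. l' n t + g t \<partial>M) = (\<integral>t. l' n t \<partial>M) + (\<integral>t. g t \<partial>M)" using l'_int g_int by simp
      finally show "(\<integral>\<^sup>+t. ennreal (l' n t + g t) \<partial>M) \<le>
        ennreal (slack z + (\<integral>t. g t \<partial>M))"
        using l'_le[OF z, of n] by (simp add: ennreal_leI)
    qed
    finally show ?thesis .
  qed
  have W_fin: "(\<integral>\<^sup>+t. W t \<partial>M) < \<infinity>" using W_le[OF x] by (auto intro: order.strict_trans1)
  have W_real: "AE t in M. W t = ennreal (enn2real (W t))"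
  proof -
    have "AE t in M. W t \<noteq> \<infinity>" using W_fin by (intro nn_integral_PInf_AE) auto
    then show ?thesis by eventually_elim (simp add: top.not_eq_extremum)
  qed
  have nn_W: "(\<integral>\<^sup>+t. ennreal (enn2real (W t)) \<partial>M) = (\<integral>\<^sup>+t. W t \<partial>M)"
    using W_real by (intro nn_integral_cong_AE) (auto elim: eventually_mono)
  have W_int: "integrable M (\<lambda>t. enn2real (W t))"
    by (rule integrableI_nonneg) (use nn_W W_fin in auto)
  define l where "l t = enn2real (W t) - g t" for t
  have l_int: "integrable M l" unfolding l_def[abs_def] by (intro Bochner_Integration.integrable_diff W_int g_int)
  have l_le: "(\<integral>t. l t \<partial>M) \<le> slack z"
    (is "_ \<le> ?b") if z: "z \<in> edom E" for z
  proof -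
    have "0 \<le> (\<integral>t. l' 0 t + g t \<partial>M)"
    proof (rule integral_nonneg_AE)
      show "AE t in M. 0 \<le> l' 0 t + g t" using Ln_real[of 0] by eventually_elim linarith
    qed
    then have b: "0 \<le> ?b + (\<integral>t. g t \<partial>M)" using l'_le[OF z, of 0] l'_int g_int by simp
    have "ennreal (\<integral>t. enn2real (W t) \<partial>M) = (\<integral>\<^sup>+t. W t \<partial>M)"
      using nn_integral_eq_integral[OF W_int] nn_W by simp
    then have "ennreal (\<integral>t. enn2real (W t) \<partial>M) \<le> ennreal (?b + (\<integral>t. g t \<partial>M))" using W_le[OF z] by simp
    then have "(\<integral>t. enn2real (W t) \<partial>M) \<le> ?b + (\<integral>t. g t \<partial>M)" using b by (simp add: ennreal_le_iff)
    then show ?thesis unfolding l_def using W_int g_int by simp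
  qed
  have bound: "AE t in M. \<forall>y b. f t y = ereal b \<longrightarrow> H t (y - x) \<le> b - Fx t + l t"
    using all_real W_real samp
  proof eventually_elim
    case (elim t)
    have l'_l: "l' n t \<le> l t" for n
    proof -
      have "ennreal (l' n t + g t) \<le> W t" unfolding W_def by (rule SUP_upper) simp
      then have "ennreal (l' n t + g t) \<le> ennreal (enn2real (W t))" using elim(2) by simp
      then show ?thesis by (simp add: ennreal_le_iff l_def)
    qed
    show ?case
    proof (intro allI impI)
      fix y b assume fy: "f t y = ereal b"
      show "H t (y - x) \<le> b - Fx t + l t"
      proof (rule field_le_epsilon)
        fix e :: real assume "0 < e"
        then have "f t y < ereal (b + e/2)" "0 < e/2" using fy by auto
        then obtain i where i: "m i t < ereal (b + e/2)"
          "H t y - e/2 < H t (Y i) - r i * g t"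
          using elim(3) unfolding m_def by blast
        have "ereal (a i t - (b + e/2)) \<le> \<psi> i t"
          using ereal_minus_mono[OF order_refl[of "ereal (a i t)"] less_imp_le[OF i(1)]] by (simp add: \<psi>_def)
        also have "\<dots> \<le> Ln i t" by (rule \<psi>_Ln) simp
        also have "\<dots> = ereal (l' i t)" using elim(1) by blast
        finally have "a i t - (b + e/2) \<le> l' i t" by simp
        then show "H t (y - x) \<le> b - Fx t + l t + e"
          using l'_l[of i] i(2) by (simp add: a_def blinfun.diff_right)
      qed
    qed
  qed
  show ?thesis using l_int l_le bound by blast
qed

text \<open>
  \<open>p = \<integral> H\<close> is the integral part and \<open>u - p\<close> the normal part.  All that \<open>l\<close> leaves over of \<open>\<epsilon>\<close> goes into
  \<open>\<epsilon>2\<close>; it is nonnegative by the case \<open>z = x\<close> of the preceding bound.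
\<close>

lemma subgradient_decomposition:
  "\<exists>\<epsilon>1 \<epsilon>2 l. 0 \<le> \<epsilon>1 \<and> 0 \<le> \<epsilon>2 \<and> \<epsilon>1 + \<epsilon>2 \<le> \<epsilon> \<and> l \<in> Zset M \<epsilon>1 \<and>
    u \<in> integral_eps_subdiff M l f x + eps_normal \<epsilon>2 (edom E) x"
proof -
  from integral_conjugate_bound obtain l where l: "integrable M l"
    and l_le': "\<forall>z\<in>edom E. (\<integral>t. l t \<partial>M) \<le> slack z"
    and bound: "AE t in M. \<forall>y b. f t y = ereal b \<longrightarrow> H t (y - x) \<le> b - Fx t + l t"
    by (elim exE conjE)
  note l_le = bspec[OF l_le']
  have l0: "AE t in M. 0 \<le> l t"
    using bound f_x
  proof eventually_elim
    case (elim t)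
    from elim(1)[rule_format, OF elim(2)] show ?case by simp
  qed
  define p where "p = Blinfun (\<lambda>y. \<integral>t. H t y \<partial>M)"
  have norm_H: "integrable M (\<lambda>t. norm (H t))" using H_Bochner by (simp add: L1_Bochner_def)
  have "bounded_linear (\<lambda>y. \<integral>t. H t y \<partial>M)"
  proof (rule bounded_linear_intro[where K = "\<integral>t. norm (H t) \<partial>M"])
    show "norm (\<integral>t. H t y \<partial>M) \<le> norm y * (\<integral>t. norm (H t) \<partial>M)" for y
    proof -
      have "norm (\<integral>t. H t y \<partial>M) \<le> (\<integral>t. norm (H t y) \<partial>M)"
        by (rule integral_norm_bound)
      also have "\<dots> \<le> (\<integral>t. norm (H t) * norm y \<partial>M)"
        by (intro integral_mono integrable_norm H_int integrable_mult_left norm_H norm_blinfun)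
      finally show ?thesis by (simp add: mult.commute)
    qed
  qed (simp_all add: blinfun.add_right blinfun.scaleR_right H_int)
  then have p: "p y = (\<integral>t. H t y \<partial>M)" for y
    unfolding p_def by (simp add: bounded_linear_Blinfun_apply)
  have "AE t in M. H t \<in> eps_subdiff (l t) (f t) x"
    using bound f_x
  proof eventually_elim
    case (elim t)
    have "ereal (H t (y - x)) \<le> f t y - f t x + ereal (l t)" for y
    proof (cases "f t y")
      case (real b)
      then show ?thesis using elim(1)[rule_format, OF real] elim(2) by simp
    qed (use elim(2) f_not_MInf[of t y] in auto)
    then show ?case using elim(2) by (simp add: eps_subdiff_def)
  qed
  then have p_in: "p \<in> integral_eps_subdiff M l f x"
    unfolding integral_eps_subdiff_def using H_Bochner p by blast
  define \<epsilon>1 where "\<epsilon>1 = (\<integral>t. l t \<partial>M)"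
  define \<epsilon>2 where "\<epsilon>2 = \<epsilon> - \<epsilon>1"
  have v_le: "(u - p) (z - x) \<le> \<epsilon>2" if "z \<in> edom E" for z
    using l_le[OF that] by (simp add: \<epsilon>1_def \<epsilon>2_def blinfun.diff_left p)
  then have "u - p \<in> eps_normal \<epsilon>2 (edom E) x"
    using x by (auto simp: eps_normal_def eps_subdiff_def indicator_fun_def)
  with p_in have "p + (u - p) \<in> integral_eps_subdiff M l f x + eps_normal \<epsilon>2 (edom E) x"
    by (rule set_plus_intro)
  moreover have "0 \<le> \<epsilon>1" unfolding \<epsilon>1_def using l0 by (rule integral_nonneg_AE)
  moreover have "0 \<le> \<epsilon>2" using v_le[OF x] by simp
  moreover have "l \<in> Zset M \<epsilon>1" using l l0 by (simp add: Zset_def \<epsilon>1_def)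
  ultimately show ?thesis
    by (intro exI[of _ \<epsilon>1] exI[of _ \<epsilon>2] exI[of _ l]) (simp add: \<epsilon>2_def)
qed

end

lemma (in lusin_functional) eps_subdiff_subset_sum:
  assumes asp: "asplund_space TYPE('a)" and x: "x \<in> edom E" and u: "u \<in> eps_subdiff \<epsilon> E x"
  shows "\<exists>\<epsilon>1 \<epsilon>2 l. 0 \<le> \<epsilon>1 \<and> 0 \<le> \<epsilon>2 \<and> \<epsilon>1 + \<epsilon>2 \<le> \<epsilon> \<and> l \<in> Zset M \<epsilon>1 \<and>
    u \<in> integral_eps_subdiff M l f x + eps_normal \<epsilon>2 (edom E) x"
proof -
  from exists_dominated_extension[OF x u] obtain L C where bf: "bounded_functional M L C"
    and L_const: "\<forall>c. L (\<lambda>t. c) = blinfun_apply u c"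
    and L_le: "\<forall>w G. bounded (range w) \<longrightarrow> integrable M G \<longrightarrow> (AE t in M. f t (x + w t) \<le> ereal (G t)) \<longrightarrow>
      L w \<le> (\<integral>t. G t \<partial>M) - (\<integral>t. real_of_ereal (f t x) \<partial>M) + \<epsilon>"
    by (elim exE conjE)
  interpret bf: bounded_functional M L C by (rule bf)
  from bf.absolutely_continuous_part[OF asp] obtain G :: "nat \<Rightarrow> 't set" and g s H where
    G: "range G \<subseteq> sets M" "incseq G" "AE t in M. t \<in> (\<Union>n. G n)" "integrable M g" "\<forall>t. 0 \<le> g t"
      "\<forall>n. simple_function M (s n)" "\<forall>t\<in>space M. (\<lambda>n. s n t) \<longlonglongrightarrow> H t" "\<forall>t\<in>space M. norm (H t) \<le> 2 * g t"
    and L: "\<forall>N. \<forall>A\<in>sets M. A \<subseteq> G N \<longrightarrow>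
      (\<forall>y. L (cut A (\<lambda>t. y)) = (\<integral>t. indicator A t * blinfun_apply (H t) y \<partial>M)) \<and>
      (\<forall>w r. (\<forall>t. norm (w t) \<le> r) \<longrightarrow> (\<forall>t. t \<notin> A \<longrightarrow> w t = 0) \<longrightarrow> \<bar>L w\<bar> \<le> r * (\<integral>t. indicator A t * g t \<partial>M))"
    by (elim exE conjE)
  interpret represented_extension where M = M and f = f and x0 = x0 and k = k and \<eta> = \<eta> and L = L and C = C
    and x = x and u = u and \<epsilon> = \<epsilon> and G = G and g = g and s = s and H = H
  proof
    show "L (\<lambda>t. c) = blinfun_apply u c" for c using L_const by simp
    show "L w \<le> (\<integral>t. F t \<partial>M) - (\<integral>t. real_of_ereal (f t x) \<partial>M) + \<epsilon>"
      if "bounded (range w)" "integrable M F" "AE t in M. f t (x + w t) \<le> ereal (F t)" for w F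
      using L_le that by simp
    show "L (cut A (\<lambda>t. y)) = (\<integral>t. indicator A t * blinfun_apply (H t) y \<partial>M)"
      if "A \<in> sets M" "A \<subseteq> G N" for A N y using L that by simp
    show "\<bar>L w\<bar> \<le> r * (\<integral>t. indicator A t * g t \<partial>M)"
      if "A \<in> sets M" "A \<subseteq> G N" "\<And>t. norm (w t) \<le> r" "\<And>t. t \<notin> A \<Longrightarrow> w t = 0" for A N w r using L that by simp
  qed (use G x in \<open>auto simp: space_UNIV\<close>)
  show ?thesis by (rule subgradient_decomposition)
qed

theorem theorem6p9:
  fixes M :: "'t::metric_space measure"
    and f :: "'t \<Rightarrow> 'a::banach \<Rightarrow> ereal"
    and x0 :: 'a and k :: "'t \<Rightarrow> real" and \<eta> :: real
  assumes "complete_measure M" and "sigma_finite_measure M"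
    and "space M = UNIV" and "sets borel \<subseteq> sets M" and "inner_regular M"
    and "asplund_space TYPE('a)"
    and "lusin_integrand M f" and "\<And>t. f t \<in> Gamma0"
    and "\<bar>integral_functional M f x0\<bar> < \<infinity>"
    and "integrable M k" and "\<eta> > 0"
    and "\<And>t x. x \<in> cball x0 \<eta> \<Longrightarrow> f t x \<le> ereal (k t)"
  shows "\<forall>x \<in> edom (integral_functional M f). \<forall>\<epsilon>\<ge>0.
    eps_subdiff \<epsilon> (integral_functional M f) x =
      (\<Union>(\<epsilon>1, \<epsilon>2, l) \<in> {(\<epsilon>1, \<epsilon>2, l). 0 \<le> \<epsilon>1 \<and> 0 \<le> \<epsilon>2 \<and> \<epsilon>1 + \<epsilon>2 \<le> \<epsilon> \<and> l \<in> Zset M \<epsilon>1}.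
         integral_eps_subdiff M l f x + eps_normal \<epsilon>2 (edom (integral_functional M f)) x)"
proof (intro ballI allI impI)
  interpret lusin_functional M f x0 k \<eta>
    by (rule lusin_functional.intro) (fact assms)+
  fix x and \<epsilon> :: real
  assume x: "x \<in> edom (integral_functional M f)" and "0 \<le> \<epsilon>"
  show "eps_subdiff \<epsilon> (integral_functional M f) x =
      (\<Union>(\<epsilon>1, \<epsilon>2, l) \<in> {(\<epsilon>1, \<epsilon>2, l). 0 \<le> \<epsilon>1 \<and> 0 \<le> \<epsilon>2 \<and> \<epsilon>1 + \<epsilon>2 \<le> \<epsilon> \<and> l \<in> Zset M \<epsilon>1}.
         integral_eps_subdiff M l f x + eps_normal \<epsilon>2 (edom (integral_functional M f)) x)"
  proof (rule set_eqI, rule iffI)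
    fix u assume "u \<in> eps_subdiff \<epsilon> (integral_functional M f) x"
    from eps_subdiff_subset_sum[OF assms(6) x this]
    show "u \<in> (\<Union>(\<epsilon>1, \<epsilon>2, l) \<in> {(\<epsilon>1, \<epsilon>2, l). 0 \<le> \<epsilon>1 \<and> 0 \<le> \<epsilon>2 \<and> \<epsilon>1 + \<epsilon>2 \<le> \<epsilon> \<and> l \<in> Zset M \<epsilon>1}.
         integral_eps_subdiff M l f x + eps_normal \<epsilon>2 (edom (integral_functional M f)) x)" by force
  next
    fix u assume "u \<in> (\<Union>(\<epsilon>1, \<epsilon>2, l) \<in> {(\<epsilon>1, \<epsilon>2, l). 0 \<le> \<epsilon>1 \<and> 0 \<le> \<epsilon>2 \<and> \<epsilon>1 + \<epsilon>2 \<le> \<epsilon> \<and> l \<in> Zset M \<epsilon>1}.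
         integral_eps_subdiff M l f x + eps_normal \<epsilon>2 (edom (integral_functional M f)) x)"
    then show "u \<in> eps_subdiff \<epsilon> (integral_functional M f) x"
      using eps_subdiff_sum_subset[OF x] by (auto elim!: set_plus_elim)
  qed
qed

end
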